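(* For any $m\ge4$, the reduced Gröbner basis $\widetilde{G}_m$ of the indeterminate collinear translation ideal $\widetilde{I}_{\mathcal{C}(\boldsymbol v)}$ with respect to $<$ is equal to the union over all of its restrictions to subsets of $4$ cameras; more precisely, $$\widetilde{G}_m=\bigcup_{\sigma=\{\sigma_1,\dots,\sigma_4\}\in\binom{[m]}{4}}\widetilde{G}_{\mathcal{C}(v_{\sigma_1},\dots,v_{\sigma_4})}.$$ Moreover: (P1) No element of $\widetilde{G}_m$ is divisible by any of the variables $\ell_{1,1},\dots,\ell_{3,m}$. (P2) The leading terms $\mathrm{in}_<(\widetilde{G}_m)$ are all squarefree monomials. (P3) Suppose $f(\boldsymbol v)\in\mathbb{C}[\boldsymbol v]$ is the coefficient of the leading monomial in $\mathbb{C}[\boldsymbol\ell]$ of some element of $\widetilde{G}_m$. Then $f$ is of one of the forms: (i) $f(\boldsymbol v)=1$, or (ii) $f(\boldsymbol v)=v_a-v_b$, or (iii) $f(\boldsymbol v)=(v_a-v_b)(v_c-v_d)$.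
   Context: Let $\mathbb{C}[\boldsymbol\ell,\boldsymbol v]$ be the polynomial ring in the $4m$ variables $\ell_{i,j}$ ($1\le i\le3$, $1\le j\le m$) and $v_1,\dots,v_m$; $\ell_j=(\ell_{1,j},\ell_{2,j},\ell_{3,j})^T$. Let $C(v_i)=\begin{bmatrix}1&0&0&v_i\\0&1&0&0\\0&0&1&0\end{bmatrix}$, with center $(v_i:0:0:-1)$. For $\sigma=\{i_1<i_2<i_3<i_4\}\subseteq[m]$ let $\Phi_\sigma=\Phi_{\mathcal{C}(\boldsymbol v),f,\sigma}(\ell)$ be the $10\times10$ matrix obtained by applying $\nu(x,y,z,w)=(x^2,y^2,z^2,w^2,xy,xz,xw,yz,yw,zw)^T$ to each of the ten column vectors $(1,0,0,0)$, $(0,0,0,1)$, $(1,0,0,1)$, $f_1=(0,1,0,0)$, $f_2=(0,0,1,0)$, $f_3=(0,1,1,0)$, and $e_{i}=(v_{i},-\ell_{3,i},\ell_{2,i},-1)$ for $i=i_1,i_2,i_3,i_4$ (in this order). Up to sign, $$\det\Phi_\sigma=\det\begin{bmatrix}\ell_{3,i_1}v_{i_1}&\ell_{3,i_2}v_{i_2}&\ell_{3,i_3}v_{i_3}&\ell_{3,i_4}v_{i_4}\\\ell_{2,i_1}v_{i_1}&\ell_{2,i_2}v_{i_2}&\ell_{2,i_3}v_{i_3}&\ell_{2,i_4}v_{i_4}\\\ell_{3,i_1}&\ell_{3,i_2}&\ell_{3,i_3}&\ell_{3,i_4}\\\ell_{2,i_1}&\ell_{2,i_2}&\ell_{2,i_3}&\ell_{2,i_4}\end{bmatrix}.$$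 The indeterminate collinear translation ideal is $$\widetilde{I}_{\mathcal{C}(\boldsymbol v)}=\left\langle3\times3\text{-minors of }\begin{bmatrix}C(v_1)^T\ell_1&\cdots&C(v_m)^T\ell_m\end{bmatrix}\right\rangle+\sum_{\sigma\in\binom{[m]}{4}}\langle\det\Phi_\sigma\rangle.$$ For $\tau=\{\tau_1<\dots<\tau_k\}\subseteq[m]$, $\widetilde{I}_{\mathcal{C}(v_{\tau_1},\dots,v_{\tau_k})}$ is defined in the same way using only the cameras (and variables) indexed by $\tau$. The order $<$ is the product of the GRevLex orders on $\mathbb{C}[\boldsymbol\ell]$ and $\mathbb{C}[\boldsymbol v]$: $\boldsymbol\ell^{\alpha_1}\boldsymbol v^{\beta_1}<\boldsymbol\ell^{\alpha_2}\boldsymbol v^{\beta_2}$ if $\boldsymbol\ell^{\alpha_1}<_{\mathrm{GRevLex}}\boldsymbol\ell^{\alpha_2}$, or $\alpha_1=\alpha_2$ and $\boldsymbol v^{\beta_1}<_{\mathrm{GRevLex}}\boldsymbol v^{\beta_2}$, where $\alpha>_{\mathrm{GRevLex}}\beta$ iff $|\alpha|>|\beta|$, or $|\alpha|=|\beta|$ and the rightmost nonzero entry of $\alpha-\beta$ is negative; variables are listed in the order $\ell_{1,1},\dots,\ell_{1,m},\ell_{2,1},\dots,\ell_{2,m},\ell_{3,1},\dots,\ell_{3,m}$ and $v_1,\dots,v_m$. $\widetilde{G}_{\mathcal{C}(v_{\tau_1},\dots,v_{\tau_k})}$ is the reduced Gröbner basis (leading coefficients $1$, no leading term divides a term of another element)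 of $\widetilde{I}_{\mathcal{C}(v_{\tau_1},\dots,v_{\tau_k})}$ with respect to $<$, and $\widetilde{G}_m$ that of $\widetilde{I}_{\mathcal{C}(\boldsymbol v)}$. *)

theory Defs
  imports
    Complex_Main
    "HOL-Library.Poly_Mapping"
    "HOL-Library.Set_Algebras"
    "Jordan_Normal_Form.Determinant"
    "Jordan_Normal_Form.DL_Submatrix"
begin

text \<open>
  Polynomials are finitely supported maps from monomials to coefficients, and monomials are
  finitely supported maps from variables to exponents.  \<open>Ell i j\<close> stands for the \<open>i\<close>-th
  coordinate of the \<open>j\<close>-th line and \<open>V j\<close> for the translation parameter of the \<open>j\<close>-th camera.
  Both indices are 1-based.
\<close>

datatype var = Ell nat nat | V nat

type_synonym mon = "var \<Rightarrow>\<^sub>0 nat"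
type_synonym mpol = "mon \<Rightarrow>\<^sub>0 complex"

definition Var :: "var \<Rightarrow> mpol" where
  "Var x = Poly_Mapping.single (Poly_Mapping.single x 1) 1"

abbreviation ell :: "nat \<Rightarrow> nat \<Rightarrow> mpol" where
  "ell i j \<equiv> Var (Ell i j)"

abbreviation v :: "nat \<Rightarrow> mpol" where
  "v j \<equiv> Var (V j)"

text \<open>The variables of the cameras in \<open>\<tau>\<close>; the order of the lists is used by the monomial order.\<close>

definition ell_vars :: "nat set \<Rightarrow> var list" where
  "ell_vars \<tau> = [Ell i j. i \<leftarrow> [1, 2, 3], j \<leftarrow> sorted_list_of_set \<tau>]"

definition v_vars :: "nat set \<Rightarrow> var list" where
  "v_vars \<tau> = [V j. j \<leftarrow> sorted_list_of_set \<tau>]"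

definition poly_ring :: "nat set \<Rightarrow> mpol set" where
  "poly_ring \<tau> = {p. \<forall>t\<in>Poly_Mapping.keys p.
      Poly_Mapping.keys t \<subseteq> set (ell_vars \<tau>) \<union> set (v_vars \<tau>)}"

text \<open>
  The ideal generated by \<open>S\<close> in the subring \<open>R\<close>.  It is relative to \<open>R\<close> because the type
  \<^typ>\<open>mpol\<close> has infinitely many variables.
\<close>

definition ideal_in :: "'a::comm_ring_1 set \<Rightarrow> 'a set \<Rightarrow> 'a set" where
  "ideal_in R S = {\<Sum>s\<in>F. q s * s | F q. finite F \<and> F \<subseteq> S \<and> q ` F \<subseteq> R}"


section \<open>The indeterminate collinear translation ideal\<close>

definition minors :: "nat \<Rightarrow> 'a::comm_ring_1 mat \<Rightarrow> 'a set" where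
  "minors k A = {det (submatrix A I J) | I J.
      I \<subseteq> {..<dim_row A} \<and> card I = k \<and> J \<subseteq> {..<dim_col A} \<and> card J = k}"

definition camera :: "nat \<Rightarrow> mpol mat" where
  "camera j = mat_of_rows_list 4
     [[1, 0, 0, v j],
      [0, 1, 0, 0],
      [0, 0, 1, 0]]"

definition ell_vec :: "nat \<Rightarrow> mpol vec" where
  "ell_vec j = vec_of_list [ell 1 j, ell 2 j, ell 3 j]"

definition backprojection_mat :: "nat set \<Rightarrow> mpol mat" where
  "backprojection_mat \<tau> = mat_of_cols 4
     [transpose_mat (camera j) *\<^sub>v ell_vec j. j \<leftarrow> sorted_list_of_set \<tau>]"

definition nu :: "'a::comm_ring_1 \<Rightarrow> 'a \<Rightarrow> 'a \<Rightarrow> 'a \<Rightarrow> 'a vec" where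
  "nu x y z w = vec_of_list [x^2, y^2, z^2, w^2, x*y, x*z, x*w, y*z, y*w, z*w]"

definition Phi :: "nat set \<Rightarrow> mpol mat" where
  "Phi \<sigma> = mat_of_cols 10
     ([nu 1 0 0 0, nu 0 0 0 1, nu 1 0 0 1, nu 0 1 0 0, nu 0 0 1 0, nu 0 1 1 0] @
      [nu (v i) (- ell 3 i) (ell 2 i) (- 1). i \<leftarrow> sorted_list_of_set \<sigma>])"

text \<open>Sums of ideals are elementwise sums of sets, as in \<^theory>\<open>HOL-Library.Set_Algebras\<close>.\<close>

definition collinear_ideal :: "nat set \<Rightarrow> mpol set" where
  "collinear_ideal \<tau> =
     ideal_in (poly_ring \<tau>) (minors 3 (backprojection_mat \<tau>)) +
     (\<Sum>\<sigma>\<in>{\<sigma>. \<sigma> \<subseteq> \<tau> \<and> card \<sigma> = 4}. ideal_in (poly_ring \<tau>) {det (Phi \<sigma>)})"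


section \<open>The monomial order\<close>

text \<open>
  GRevLex on the variables \<open>xs\<close>, listed from the largest to the smallest: the last variable in
  which the exponents differ has the larger exponent in the smaller monomial.
\<close>

definition grevlex_less :: "var list \<Rightarrow> mon \<Rightarrow> mon \<Rightarrow> bool" where
  "grevlex_less xs s t \<longleftrightarrow>
     (let a = Poly_Mapping.lookup s; b = Poly_Mapping.lookup t;
          da = (\<Sum>x\<leftarrow>xs. a x); db = (\<Sum>x\<leftarrow>xs. b x)
      in da < db \<or>
         da = db \<and> (\<exists>k<length xs. b (xs ! k) < a (xs ! k) \<and>
           (\<forall>l. k < l \<and> l < length xs \<longrightarrow> a (xs ! l) = b (xs ! l))))"

text \<open>
  \<open>mon_less m\<close> is a strict total order only on the monomials in the variables with camera
  index in \<open>{1..m}\<close>.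
\<close>

definition mon_less :: "nat \<Rightarrow> mon \<Rightarrow> mon \<Rightarrow> bool" where
  "mon_less m s t \<longleftrightarrow>
     grevlex_less (ell_vars {1..m}) s t \<or>
     (\<forall>x\<in>set (ell_vars {1..m}). Poly_Mapping.lookup s x = Poly_Mapping.lookup t x) \<and>
     grevlex_less (v_vars {1..m}) s t"

definition max_mon :: "(mon \<Rightarrow> mon \<Rightarrow> bool) \<Rightarrow> mon set \<Rightarrow> mon" where
  "max_mon lt T = (THE t. t \<in> T \<and> (\<forall>s\<in>T. s \<noteq> t \<longrightarrow> lt s t))"

definition lead_mon :: "(mon \<Rightarrow> mon \<Rightarrow> bool) \<Rightarrow> mpol \<Rightarrow> mon" where
  "lead_mon lt p = max_mon lt (Poly_Mapping.keys p)"

definition leading_coeff :: "(mon \<Rightarrow> mon \<Rightarrow> bool) \<Rightarrow> mpol \<Rightarrow> complex" where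
  "leading_coeff lt p = Poly_Mapping.lookup p (lead_mon lt p)"

definition lead_term :: "(mon \<Rightarrow> mon \<Rightarrow> bool) \<Rightarrow> mpol \<Rightarrow> mpol" where
  "lead_term lt p = Poly_Mapping.single (lead_mon lt p) (leading_coeff lt p)"


section \<open>Reduced Groebner bases\<close>

definition is_groebner_basis :: "(mon \<Rightarrow> mon \<Rightarrow> bool) \<Rightarrow> mpol set \<Rightarrow> mpol set \<Rightarrow> mpol set \<Rightarrow> bool" where
  "is_groebner_basis lt R I G \<longleftrightarrow>
     finite G \<and> G \<subseteq> I \<and>
     ideal_in R (lead_term lt ` (G - {0})) = ideal_in R (lead_term lt ` (I - {0}))"

definition is_reduced_groebner_basis ::
    "(mon \<Rightarrow> mon \<Rightarrow> bool) \<Rightarrow> mpol set \<Rightarrow> mpol set \<Rightarrow> mpol set \<Rightarrow> bool" where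
  "is_reduced_groebner_basis lt R I G \<longleftrightarrow>
     is_groebner_basis lt R I G \<and>
     0 \<notin> G \<and>
     (\<forall>g\<in>G. leading_coeff lt g = 1) \<and>
     (\<forall>g\<in>G. \<forall>h\<in>G. g \<noteq> h \<longrightarrow>
        (\<forall>t\<in>Poly_Mapping.keys h.
           \<not> lead_term lt g dvd Poly_Mapping.single t (Poly_Mapping.lookup h t)))"

text \<open>The order on the monomials of the cameras in \<open>\<tau> \<subseteq> {1..m}\<close> is the restriction of \<open>mon_less m\<close>.\<close>

definition reduced_gb :: "nat \<Rightarrow> nat set \<Rightarrow> mpol set" where
  "reduced_gb m \<tau> =
     (THE G. is_reduced_groebner_basis (mon_less m) (poly_ring \<tau>) (collinear_ideal \<tau>) G)"


section \<open>Polynomials with coefficients in the translation parameters\<close>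

definition ell_part :: "mon \<Rightarrow> mon" where
  "ell_part = Poly_Mapping.mapp (\<lambda>x e. case x of Ell _ _ \<Rightarrow> e | V _ \<Rightarrow> 0)"

definition v_part :: "mon \<Rightarrow> mon" where
  "v_part = Poly_Mapping.mapp (\<lambda>x e. case x of Ell _ _ \<Rightarrow> 0 | V _ \<Rightarrow> e)"

text \<open>
  The leading monomial of \<open>p\<close> and its coefficient when \<open>p\<close> is viewed as a polynomial in the
  line coordinates over the polynomial ring in the translation parameters.
\<close>

definition ell_lead_mon :: "nat \<Rightarrow> mpol \<Rightarrow> mon" where
  "ell_lead_mon m p = max_mon (grevlex_less (ell_vars {1..m})) (ell_part ` Poly_Mapping.keys p)"

definition ell_lead_coeff :: "nat \<Rightarrow> mpol \<Rightarrow> mpol" where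
  "ell_lead_coeff m p =
     (\<Sum>t\<in>{t \<in> Poly_Mapping.keys p. ell_part t = ell_lead_mon m p}.
        Poly_Mapping.single (v_part t) (Poly_Mapping.lookup p t))"

definition squarefree_mon :: "mon \<Rightarrow> bool" where
  "squarefree_mon t \<longleftrightarrow> (\<forall>x. Poly_Mapping.lookup t x \<le> 1)"

end

theory Submission
  imports Defs "HOL-Computational_Algebra.Polynomial"
begin

text \<open>
  Write \<open>x\<^sub>j, y\<^sub>j, z\<^sub>j\<close> for the coordinates \<open>ell 1 j, ell 2 j, ell 3 j\<close> of the \<open>j\<close>-th line.  If all lines
  are images of one general line in space, their backprojected planes lie in a pencil, and in a
  suitable basis of the pencil this says \<open>x\<^sub>j = L\<^sub>j\<close>, \<open>y\<^sub>j = L\<^sub>j c (v\<^sub>j - a)\<close>, \<open>z\<^sub>j = L\<^sub>j d (v\<^sub>j - b)\<close>: the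
  ratios \<open>y\<^sub>j / x\<^sub>j\<close> and \<open>z\<^sub>j / x\<^sub>j\<close> are two affine functions of \<open>v\<^sub>j\<close>.  The collinear ideal \<open>I\<close> is
  contained in the ideal \<open>J\<close> of all polynomials that vanish under this substitution
  (\<open>collinear_ideal_vanishing\<close>).

  Six families of polynomials lie in \<open>I\<close>: minors, the determinants of \<open>Phi\<close>, and combinations of
  minors (\<open>terms\<close>, \<open>gen_poly_in_ideal\<close>).  They are monic with squarefree leading monomials, and no
  monomial of one of them is divisible by the leading monomial of another (\<open>lead_incomparable\<close>).
  Hence, once every leading monomial of \<open>I\<close> is known to be divisible by one of theirs, those that
  use only cameras in \<open>\<tau>\<close> form a reduced Groebner basis for \<open>\<tau>\<close> (\<open>explicit_basis_reduced\<close>), and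
  reduced bases are unique (\<open>reduced_basis_subset\<close>).  Each of the polynomials uses at most four
  cameras, which gives the union; the three other properties are read off from the explicit terms.

  The divisibility is shown for the larger ideal \<open>J\<close> and without S-polynomials.  Let \<open>T\<close> be the
  leading monomial of \<open>f \<in> J\<close>, and suppose that it is divisible by none of the six kinds of leading
  monomials.  As \<open>J\<close> is homogeneous in each camera, in the number of \<open>y\<close>'s and in the number of
  \<open>z\<close>'s, only the monomials with the degrees of \<open>T\<close> matter.  The combinatorial core
  (\<open>exists_degeneration\<close>) moves the \<open>v\<^sub>i\<close>, \<open>a\<close> and \<open>b\<close> in a one-parameter family in which some
  cameras collide, such that the image of the line part of \<open>T\<close> vanishes to a strictly smaller order
  than the image of every smaller line part.  Comparing lowest coefficients, the polynomial in \<open>v\<close>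
  that multiplies the line part of \<open>T\<close> in \<open>f\<close> vanishes when the colliding cameras are identified.
  However, \<open>T\<close> contains \<open>v\<^sub>i\<close> only for cameras that are the last of their cluster, so its term
  survives the identification, and no smaller term can be moved onto it
  (\<open>lead_mon_not_standard\<close>).
\<close>

section \<open>Comparison by leading digits\<close>

lemma int_power_geometric: "(\<Sum>p<s. (K - 1) * K ^ p) = K ^ s - (1::int)"
  by (induction s) (auto simp: algebra_simps)

text \<open>
  The digits below the leading one add up to at least \<open>- (K ^ s - 1)\<close>. Negative digits are
  needed because the digits will be differences of exponents.
\<close>

lemma leading_digit_sum_pos:
  fixes \<delta> :: "nat \<Rightarrow> int" and K :: int
  assumes "s < L" "\<delta> s > 0" and above: "\<And>p. s < p \<Longrightarrow> p < L \<Longrightarrow> \<delta> p \<ge> 0"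
    and bound: "\<And>p. p < L \<Longrightarrow> \<bar>\<delta> p\<bar> < K"
  shows "(\<Sum>p<L. \<delta> p * K ^ p) > 0"
proof -
  have K: "K > 0" using bound[OF \<open>s < L\<close>] by linarith
  have "{..<L} = insert s ({..<s} \<union> {s<..<L})" "{..<s} \<inter> {s<..<L} = {}"
    using \<open>s < L\<close> by auto
  then have "(\<Sum>p<L. \<delta> p * K ^ p)
      = (\<Sum>p<s. \<delta> p * K ^ p) + \<delta> s * K ^ s + (\<Sum>p\<in>{s<..<L}. \<delta> p * K ^ p)"
    by (simp add: sum.union_disjoint)
  moreover have "(\<Sum>p\<in>{s<..<L}. \<delta> p * K ^ p) \<ge> 0"
    using above K by (intro sum_nonneg) auto
  moreover have "(\<Sum>p<s. \<delta> p * K ^ p) \<ge> (\<Sum>p<s. - ((K - 1) * K ^ p))"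
  proof (rule sum_mono)
    fix p assume "p \<in> {..<s}"
    then have "\<bar>\<delta> p\<bar> < K" using bound \<open>s < L\<close> by auto
    then have "- (K - 1) \<le> \<delta> p" by linarith
    then have "- (K - 1) * K ^ p \<le> \<delta> p * K ^ p" using K by (intro mult_right_mono) auto
    then show "- ((K - 1) * K ^ p) \<le> \<delta> p * K ^ p" by (simp add: algebra_simps)
  qed
  moreover have "(\<Sum>p<s. - ((K - 1) * K ^ p)) = 1 - K ^ s"
    using int_power_geometric[of K s] by (simp add: sum_negf)
  moreover have "\<delta> s * K ^ s \<ge> 1 * K ^ s" using assms(2) K by (intro mult_right_mono) auto
  ultimately show ?thesis by linarith
qed

lemma digits_unique:
  fixes a b :: "nat \<Rightarrow> nat"
  assumes "(\<Sum>p<L. K ^ p * a p) = (\<Sum>p<L. K ^ p * b p)"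
    and "\<And>p. p < L \<Longrightarrow> a p < K" "\<And>p. p < L \<Longrightarrow> b p < K" and "p < L"
  shows "a p = b p"
proof (rule ccontr)
  assume "a p \<noteq> b p"
  define D where "D = {p. p < L \<and> a p \<noteq> b p}"
  have D: "finite D" "D \<noteq> {}" unfolding D_def using \<open>a p \<noteq> b p\<close> \<open>p < L\<close> by auto
  define s where "s = Max D"
  have s: "s < L" "a s \<noteq> b s" using Max_in[OF D] by (auto simp: D_def s_def)
  have above: "a q = b q" if "s < q" "q < L" for q
    using Max_ge[OF D(1), of q] that unfolding s_def[symmetric] by (auto simp: D_def)
  have zero: "(\<Sum>p<L. (int (a p) - int (b p)) * int K ^ p) = 0"
  proof -
    have "int (\<Sum>p<L. K ^ p * a p) = int (\<Sum>p<L. K ^ p * b p)" using assms(1) by simp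
    then show ?thesis by (simp add: algebra_simps sum_subtractf)
  qed
  have bd: "\<bar>int (a q) - int (b q)\<bar> < int K" if "q < L" for q
    using assms(2,3)[OF that] by linarith
  show False
  proof (cases "a s > b s")
    case True
    then have "(\<Sum>p<L. (int (a p) - int (b p)) * int K ^ p) > 0"
      using s above bd by (intro leading_digit_sum_pos[of s]) auto
    then show False using zero by simp
  next
    case False
    then have "(\<Sum>p<L. (int (b p) - int (a p)) * int K ^ p) > 0"
      using s above bd by (intro leading_digit_sum_pos[of s]) (auto simp: abs_minus_commute)
    moreover have "(\<Sum>p<L. (int (b p) - int (a p)) * int K ^ p) =
        - (\<Sum>p<L. (int (a p) - int (b p)) * int K ^ p)"
      by (simp add: sum_negf[symmetric] algebra_simps)
    ultimately show False using zero by simp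
  qed
qed

text \<open>
  A weight with four blocks of digits compares lexicographically: first \<open>hi\<close>, then the single
  digit \<open>c\<close>, then \<open>mid\<close>, then \<open>lo\<close>, and inside a block the largest index first.
\<close>

lemma block_digits_pos:
  fixes lo mid hi :: "nat \<Rightarrow> int" and c K :: int
  assumes bound: "\<And>p. p < n \<Longrightarrow> \<bar>lo p\<bar> < K" "\<And>p. p < n \<Longrightarrow> \<bar>mid p\<bar> < K" "\<bar>c\<bar> < K"
      "\<And>p. p < n \<Longrightarrow> \<bar>hi p\<bar> < K"
    and pos: "(\<exists>s<n. hi s > 0 \<and> (\<forall>p<n. s < p \<longrightarrow> hi p \<ge> 0)) \<or>
      (\<forall>p<n. hi p \<ge> 0) \<and> (c > 0 \<or> c \<ge> 0 \<and>
        ((\<exists>s<n. mid s > 0 \<and> (\<forall>p<n. s < p \<longrightarrow> mid p \<ge> 0)) \<or>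
         (\<forall>p<n. mid p \<ge> 0) \<and> (\<exists>s<n. lo s > 0 \<and> (\<forall>p<n. s < p \<longrightarrow> lo p \<ge> 0))))"
  shows "(\<Sum>i<n. lo i * K ^ i) + (\<Sum>i<n. mid i * K ^ (n + i)) + c * K ^ (2 * n)
      + (\<Sum>i<n. hi i * K ^ (2 * n + 1 + i)) > 0"
proof -
  define \<delta> where "\<delta> p = (if p < n then lo p else if p < 2 * n then mid (p - n)
    else if p = 2 * n then c else hi (p - (2 * n + 1)))" for p
  have split: "(\<Sum>p<a + b. f p) = (\<Sum>p<a. f p) + (\<Sum>p<b. f (a + p))" for a b and f :: "nat \<Rightarrow> int"
    by (induction b) auto
  have "3 * n + 1 = ((n + n) + 1) + n" by simp
  then have "(\<Sum>p<3 * n + 1. \<delta> p * K ^ p) =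
     (\<Sum>i<n. \<delta> i * K ^ i) + (\<Sum>i<n. \<delta> (n + i) * K ^ (n + i)) + \<delta> (2 * n) * K ^ (2 * n)
      + (\<Sum>i<n. \<delta> (2 * n + 1 + i) * K ^ (2 * n + 1 + i))"
    unfolding \<open>3 * n + 1 = _\<close> split by (simp add: mult_2)
  also have "\<dots> = (\<Sum>i<n. lo i * K ^ i) + (\<Sum>i<n. mid i * K ^ (n + i)) + c * K ^ (2 * n)
      + (\<Sum>i<n. hi i * K ^ (2 * n + 1 + i))"
    by (intro arg_cong2[where f = "(+)"] sum.cong) (auto simp: \<delta>_def)
  finally have eq: "(\<Sum>p<3 * n + 1. \<delta> p * K ^ p) = \<dots>" .
  have "(\<Sum>p<3 * n + 1. \<delta> p * K ^ p) > 0"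
  proof -
    have bd: "\<bar>\<delta> p\<bar> < K" if "p < 3 * n + 1" for p
      using that bound by (auto simp: \<delta>_def)
    have hi0: "\<delta> p \<ge> 0" if "\<forall>q<n. hi q \<ge> 0" "2 * n < p" "p < 3 * n + 1" for p
      using that by (auto simp: \<delta>_def)
    consider (hi) s where "s < n" "hi s > 0" "\<forall>p<n. s < p \<longrightarrow> hi p \<ge> 0"
      | (c) "\<forall>p<n. hi p \<ge> 0" "c > 0"
      | (mid) s where "\<forall>p<n. hi p \<ge> 0" "c \<ge> 0" "s < n" "mid s > 0" "\<forall>p<n. s < p \<longrightarrow> mid p \<ge> 0"
      | (lo) s where "\<forall>p<n. hi p \<ge> 0" "c \<ge> 0" "\<forall>p<n. mid p \<ge> 0" "s < n" "lo s > 0"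
          "\<forall>p<n. s < p \<longrightarrow> lo p \<ge> 0"
      using pos by blast
    then show ?thesis
    proof cases
      case hi
      then show ?thesis
        by (intro leading_digit_sum_pos[of "2 * n + 1 + s"] bd) (auto simp: \<delta>_def)
    next
      case c
      then show ?thesis
        by (intro leading_digit_sum_pos[of "2 * n"] bd) (auto simp: \<delta>_def)
    next
      case mid
      then show ?thesis
        by (intro leading_digit_sum_pos[of "n + s"] bd) (auto simp: \<delta>_def)
    next
      case lo
      then show ?thesis
        by (intro leading_digit_sum_pos[of s] bd) (auto simp: \<delta>_def)
    qed
  qed
  then show ?thesis unfolding eq .
qed

section \<open>Degenerations that isolate an exponent vector\<close>

text \<open>
  The functions \<open>x, y, z, u\<close> give the exponents of \<open>ell 1 i\<close>, \<open>ell 2 i\<close>, \<open>ell 3 i\<close> and \<open>v i\<close> in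
  a monomial. Each assumption from \<open>yxx\<close> on excludes divisibility by one kind of leading
  monomial of a generator; its name spells the line coordinates of that leading monomial at
  increasing camera indices.
\<close>

locale standard_exponents =
  fixes x y z u :: "nat \<Rightarrow> nat" and n :: nat
  assumes supp: "n \<le> i \<Longrightarrow> x i = 0 \<and> y i = 0 \<and> z i = 0"
    and yxx: "i < j \<Longrightarrow> j < k \<Longrightarrow> y i > 0 \<Longrightarrow> x j > 0 \<Longrightarrow> x k > 0 \<Longrightarrow> u j = 0"
    and zxx: "i < j \<Longrightarrow> j < k \<Longrightarrow> z i > 0 \<Longrightarrow> x j > 0 \<Longrightarrow> x k > 0 \<Longrightarrow> u j = 0"
    and zyx: "i < j \<Longrightarrow> j < k \<Longrightarrow> z i > 0 \<Longrightarrow> y j > 0 \<Longrightarrow> x k = 0"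
    and zxy: "i < j \<Longrightarrow> j < k \<Longrightarrow> z i > 0 \<Longrightarrow> x j > 0 \<Longrightarrow> y k > 0 \<Longrightarrow> u j = 0"
    and zzyy: "i < j \<Longrightarrow> j < k \<Longrightarrow> k < l \<Longrightarrow> z i > 0 \<Longrightarrow> z j > 0 \<Longrightarrow> y k > 0 \<Longrightarrow> y l > 0 \<Longrightarrow> u k > 0 \<Longrightarrow> u i = 0"
    and xzyy: "i < j \<Longrightarrow> j < k \<Longrightarrow> k < l \<Longrightarrow> x i > 0 \<Longrightarrow> z j > 0 \<Longrightarrow> y k > 0 \<Longrightarrow> y l > 0 \<Longrightarrow> u k > 0 \<Longrightarrow> u i = 0"
    and zxyy: "i < j \<Longrightarrow> j < k \<Longrightarrow> k < l \<Longrightarrow> z i > 0 \<Longrightarrow> x j > 0 \<Longrightarrow> y k > 0 \<Longrightarrow> y l > 0 \<Longrightarrow> u k = 0"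
begin

definition "K = 2 + (\<Sum>i<n. x i + y i + z i)"
definition "after_z k \<longleftrightarrow> (\<exists>i<k. z i > 0)"
definition "after_y k \<longleftrightarrow> (\<exists>i<k. y i > 0)"

text \<open>
  The line parts that compete with \<open>(x, y, z)\<close>: same degree in every camera, same number of
  \<open>y\<close>'s and of \<open>z\<close>'s, and smaller in GRevLex. For such line parts GRevLex compares the
  \<open>z\<close>-exponents from the last camera on, and then the \<open>y\<close>-exponents.
\<close>

definition lower :: "(nat \<Rightarrow> nat) \<Rightarrow> (nat \<Rightarrow> nat) \<Rightarrow> (nat \<Rightarrow> nat) \<Rightarrow> bool" where
  "lower x' y' z' \<longleftrightarrow> (\<forall>i. x' i + y' i + z' i = x i + y i + z i) \<and>
    (\<Sum>i<n. y' i) = (\<Sum>i<n. y i) \<and> (\<Sum>i<n. z' i) = (\<Sum>i<n. z i) \<and>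
    ((\<exists>t. z t < z' t \<and> (\<forall>s>t. z' s = z s)) \<or>
     (\<forall>s. z' s = z s) \<and> (\<exists>t. y t < y' t \<and> (\<forall>s>t. y' s = y s)))"

text \<open>
  Here \<open>oa i\<close> and \<open>ob i\<close> are the orders at which the images of \<open>ell 2 i\<close> and \<open>ell 3 i\<close> vanish in
  a one-parameter family.
\<close>

definition separated_by :: "(nat \<Rightarrow> nat) \<Rightarrow> (nat \<Rightarrow> nat) \<Rightarrow> bool" where
  "separated_by oa ob \<longleftrightarrow> (\<forall>x' y' z'. lower x' y' z' \<longrightarrow>
     (\<Sum>i<n. oa i * y i + ob i * z i) < (\<Sum>i<n. oa i * y' i + ob i * z' i))"

text \<open>
  In the limit camera \<open>i\<close> collides with camera \<open>\<pi> i\<close>, the last one of its cluster. The points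
  \<open>q\<close> at which the clusters sit stay arbitrary, so that a nonzero polynomial can later be
  prevented from vanishing there. The condition on \<open>u\<close> keeps the \<open>v\<close>-part of the monomial
  visible after the collision.
\<close>

definition degeneration :: "(nat \<Rightarrow> nat) \<Rightarrow> bool" where
  "degeneration \<pi> \<longleftrightarrow> (\<forall>i. i \<le> \<pi> i \<and> \<pi> (\<pi> i) = \<pi> i \<and> (u i > 0 \<longrightarrow> \<pi> i = i)) \<and>
    (\<forall>q::nat \<Rightarrow> complex. inj q \<longrightarrow> (\<exists>V a b oa ob. separated_by oa ob \<and>
      (\<forall>i<n. poly (V i) 0 = q (\<pi> i) \<and>
        (\<exists>U. poly U 0 \<noteq> 0 \<and> V i - a = monom 1 (oa i) * U) \<and>
        (\<exists>W. poly W 0 \<noteq> 0 \<and> V i - b = monom 1 (ob i) * W))))"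

text \<open>
  The cameras of \<open>P\<close> run into the zero \<open>a\<close> of the form for \<open>y\<close>, those of \<open>Q\<close> into the zero \<open>b\<close>
  of the form for \<open>z\<close>, at two different points. An empty cluster leaves its zero at a point that
  belongs to no camera.
\<close>

lemma two_clusters:
  assumes "P \<subseteq> {..<n}" "Q \<subseteq> {..<n}" "P \<inter> Q = {}" "jA \<noteq> jB"
    and "jA \<in> P \<or> P = {} \<and> jA \<ge> n" "jB \<in> Q \<or> Q = {} \<and> jB \<ge> n"
    and "\<And>i. i \<in> P \<Longrightarrow> i \<noteq> jA \<Longrightarrow> i < jA \<and> u i = 0"
    and "\<And>i. i \<in> Q \<Longrightarrow> i \<noteq> jB \<Longrightarrow> i < jB \<and> u i = 0"
    and "\<And>i. i \<in> P \<Longrightarrow> oa i > 0" "\<And>i. i \<in> Q \<Longrightarrow> ob i > 0"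
    and "\<And>i. i \<notin> P \<Longrightarrow> oa i = 0" "\<And>i. i \<notin> Q \<Longrightarrow> ob i = 0"
    and "separated_by oa ob"
  shows "\<exists>\<pi>. degeneration \<pi>"
proof -
  define \<pi> where "\<pi> i = (if i \<in> P then jA else if i \<in> Q then jB else i)" for i
  have \<pi>1: "i \<le> \<pi> i \<and> \<pi> (\<pi> i) = \<pi> i \<and> (u i > 0 \<longrightarrow> \<pi> i = i)" for i
    using assms(3,5,6) assms(7,8)[of i] by (auto simp: \<pi>_def less_imp_le)
  have "\<exists>V a b oa ob. separated_by oa ob \<and>
      (\<forall>i<n. poly (V i) 0 = q (\<pi> i) \<and>
        (\<exists>U. poly U 0 \<noteq> 0 \<and> V i - a = monom 1 (oa i) * U) \<and>
        (\<exists>W. poly W 0 \<noteq> 0 \<and> V i - b = monom 1 (ob i) * W))" if q: "inj q" for q :: "nat \<Rightarrow> complex"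
  proof -
    define V where "V i = [:q (\<pi> i):] + (if i \<in> P then monom 1 (oa i) else if i \<in> Q then monom 1 (ob i) else 0)" for i
    have V0: "poly (V i) 0 = q (\<pi> i)" for i
      using assms(9,10) by (auto simp: V_def poly_monom zero_power)
    have A: "\<exists>U. poly U 0 \<noteq> 0 \<and> V i - [:q jA:] = monom 1 (oa i) * U" if "i < n" for i
    proof (cases "i \<in> P")
      case True
      then show ?thesis by (intro exI[of _ 1]) (simp add: V_def \<pi>_def)
    next
      case False
      have "\<pi> i \<noteq> jA" using False assms(3,4,5) that by (auto simp: \<pi>_def)
      then show ?thesis using False assms(11) V0[of i] q
        by (intro exI[of _ "V i - [:q jA:]"]) (auto simp: inj_eq)
    qed
    have B: "\<exists>U. poly U 0 \<noteq> 0 \<and> V i - [:q jB:] = monom 1 (ob i) * U" if "i < n" for i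
    proof (cases "i \<in> Q")
      case True
      then show ?thesis using assms(3) by (intro exI[of _ 1]) (auto simp: V_def \<pi>_def)
    next
      case False
      have "\<pi> i \<noteq> jB" using False assms(3,4,6) that by (auto simp: \<pi>_def)
      then show ?thesis using False assms(12) V0[of i] q
        by (intro exI[of _ "V i - [:q jB:]"]) (auto simp: inj_eq)
    qed
    show ?thesis using assms(13) V0 A B by blast
  qed
  then show ?thesis using \<pi>1 by (auto simp: degeneration_def)
qed

text \<open>
  Both zeros lie in the same cluster, at distance \<open>\<epsilon> ^ s\<close>. The cameras of \<open>N\<close> are closer than
  that to \<open>b\<close> and hence see \<open>a\<close> at order exactly \<open>s\<close>; the other cameras of the cluster are
  further away and see both zeros at the same order.
\<close>

lemma one_cluster:
  assumes "R \<subseteq> {..<n}" "j \<in> R" "N \<subseteq> R"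
    and "\<And>i. i \<in> R \<Longrightarrow> i \<noteq> j \<Longrightarrow> i < j \<and> u i = 0"
    and N: "\<And>i. i \<in> N \<Longrightarrow> oa i = s \<and> s < ob i" and "s > 0"
    and RN: "\<And>i. i \<in> R \<Longrightarrow> i \<notin> N \<Longrightarrow> oa i = ob i \<and> 0 < ob i \<and> ob i < s"
    and out: "\<And>i. i \<notin> R \<Longrightarrow> oa i = 0 \<and> ob i = 0"
    and "separated_by oa ob"
  shows "\<exists>\<pi>. degeneration \<pi>"
proof -
  define \<pi> where "\<pi> i = (if i \<in> R then j else i)" for i
  have \<pi>1: "i \<le> \<pi> i \<and> \<pi> (\<pi> i) = \<pi> i \<and> (u i > 0 \<longrightarrow> \<pi> i = i)" for i
    using assms(2) assms(4)[of i] by (cases "i = j") (auto simp: \<pi>_def less_imp_le)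
  have "\<exists>V a b oa ob. separated_by oa ob \<and>
      (\<forall>i<n. poly (V i) 0 = q (\<pi> i) \<and>
        (\<exists>U. poly U 0 \<noteq> 0 \<and> V i - a = monom 1 (oa i) * U) \<and>
        (\<exists>W. poly W 0 \<noteq> 0 \<and> V i - b = monom 1 (ob i) * W))" if q: "inj q" for q :: "nat \<Rightarrow> complex"
  proof -
    define V where "V i = [:q (\<pi> i):] + (if i \<in> R then monom 1 (ob i) else 0)" for i
    have obpos: "ob i > 0" if "i \<in> R" for i using N RN that by (metis gr_zeroI not_less0)
    have V0: "poly (V i) 0 = q (\<pi> i)" for i
      using obpos by (auto simp: V_def poly_monom zero_power)
    have ne: "q (\<pi> i) \<noteq> q j" if "i \<notin> R" for i using that q assms(2) by (auto simp: \<pi>_def inj_eq)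
    have A: "\<exists>U. poly U 0 \<noteq> 0 \<and> V i - ([:q j:] + monom 1 s) = monom 1 (oa i) * U" for i
    proof -
      consider "i \<in> N" | "i \<in> R" "i \<notin> N" | "i \<notin> R" by blast
      then show ?thesis
      proof cases
        case 1
        then have "i \<in> R" "monom 1 (ob i) = monom (1::complex) s * monom 1 (ob i - s)"
          using assms(3) N[OF 1] by (auto simp: mult_monom)
        then show ?thesis using N[OF 1]
          by (intro exI[of _ "monom 1 (ob i - s) - 1"])
             (auto simp: V_def \<pi>_def poly_monom zero_power algebra_simps)
      next
        case 2
        then have "monom 1 s = monom (1::complex) (ob i) * monom 1 (s - ob i)"
          using RN[OF 2] by (auto simp: mult_monom)
        then show ?thesis using RN[OF 2] 2
          by (intro exI[of _ "1 - monom 1 (s - ob i)"])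
             (auto simp: V_def \<pi>_def poly_monom zero_power algebra_simps)
      next
        case 3
        then show ?thesis using ne[OF 3] out[OF 3] V0[of i] \<open>s > 0\<close>
          by (intro exI[of _ "V i - ([:q j:] + monom 1 s)"]) (auto simp: poly_monom zero_power)
      qed
    qed
    have B: "\<exists>U. poly U 0 \<noteq> 0 \<and> V i - [:q j:] = monom 1 (ob i) * U" for i
    proof (cases "i \<in> R")
      case True
      then show ?thesis by (intro exI[of _ 1]) (simp add: V_def \<pi>_def)
    next
      case False
      then show ?thesis using ne out V0[of i] by (intro exI[of _ "V i - [:q j:]"]) auto
    qed
    show ?thesis using assms(9) V0 A B by blast
  qed
  then show ?thesis using \<pi>1 by (auto simp: degeneration_def)
qed

lemma K_ge_2: "K \<ge> 2"
  by (simp add: K_def)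

lemma degree_less_K: "x i + y i + z i < K"
proof (cases "i < n")
  case True
  then have "x i + y i + z i \<le> (\<Sum>i<n. x i + y i + z i)" by (intro member_le_sum) auto
  then show ?thesis by (simp add: K_def)
next
  case False
  then show ?thesis using supp[of i] by (simp add: K_def)
qed

lemma lowerD:
  assumes "lower x' y' z'"
  shows "x' i + y' i + z' i = x i + y i + z i"
    and "\<bar>int (y' i) - int (y i)\<bar> < int K" "\<bar>int (z' i) - int (z i)\<bar> < int K"
    and "\<bar>int (x' i) - int (x i)\<bar> < int K"
proof -
  show "x' i + y' i + z' i = x i + y i + z i" using assms by (simp add: lower_def)
  then show "\<bar>int (y' i) - int (y i)\<bar> < int K" "\<bar>int (z' i) - int (z i)\<bar> < int K"
    "\<bar>int (x' i) - int (x i)\<bar> < int K"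
    using degree_less_K[of i] by linarith+
qed

lemma lower_sum_bound:
  assumes "lower x' y' z'" "S \<subseteq> {..<n}"
  shows "\<bar>\<Sum>i\<in>S. int (y' i) - int (y i)\<bar> < int K"
proof -
  have "\<bar>\<Sum>i\<in>S. int (y' i) - int (y i)\<bar> \<le> (\<Sum>i\<in>S. \<bar>int (y' i) - int (y i)\<bar>)" by (rule sum_abs)
  also have "\<dots> \<le> (\<Sum>i\<in>S. int (x i + y i + z i))"
  proof (rule sum_mono)
    fix i
    show "\<bar>int (y' i) - int (y i)\<bar> \<le> int (x i + y i + z i)"
      using lowerD(1)[OF assms(1), of i] by linarith
  qed
  also have "\<dots> \<le> (\<Sum>i<n. int (x i + y i + z i))" using assms(2) by (intro sum_mono2) auto
  also have "\<dots> = int (\<Sum>i<n. x i + y i + z i)" by simp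
  also have "\<dots> < int K" by (simp add: K_def)
  finally show ?thesis .
qed

text \<open>
  The sum of the \<open>z\<close>-exponents is preserved, so a growth at \<open>t\<close> is paid for by an earlier camera
  with a \<open>z\<close>; and since the degree in camera \<open>t\<close> is preserved, an \<open>x\<close> or a \<open>y\<close> makes room for
  it.
\<close>

lemma top_z_change:
  assumes "lower x' y' z'" "z t < z' t" "\<forall>s>t. z' s = z s"
  shows "after_z t" "x t + y t > 0" "t < n"
proof -
  have *: "z' i = 0" if "i \<ge> n" for i using supp[OF that] lowerD(1)[OF assms(1), of i] by simp
  show "t < n" using *[of t] assms(2) by (cases "t < n") auto
  show "x t + y t > 0" using lowerD(1)[OF assms(1), of t] assms(2) by linarith
  have eq: "(\<Sum>i<n. z' i) = (\<Sum>i<n. z i)" using assms(1) by (simp add: lower_def)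
  show "after_z t"
  proof (rule ccontr)
    assume "\<not> after_z t"
    then have "z i \<le> z' i" for i
      using assms(2,3) by (cases i t rule: linorder_cases) (auto simp: after_z_def)
    then have "(\<Sum>i<n. z i) < (\<Sum>i<n. z' i)"
      using assms(2) \<open>t < n\<close> by (intro sum_strict_mono_ex1) auto
    then show False using eq by simp
  qed
qed

lemma top_y_change:
  assumes "lower x' y' z'" "\<forall>s. z' s = z s" "y t < y' t" "\<forall>s>t. y' s = y s"
  shows "after_y t" "x t > 0" "t < n"
proof -
  have *: "y' i = 0" if "i \<ge> n" for i using supp[OF that] lowerD(1)[OF assms(1), of i] by simp
  show "t < n" using *[of t] assms(3) by (cases "t < n") auto
  show "x t > 0" using lowerD(1)[OF assms(1), of t] assms(2)[rule_format, of t] assms(3) by linarith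
  have eq: "(\<Sum>i<n. y' i) = (\<Sum>i<n. y i)" using assms(1) by (simp add: lower_def)
  show "after_y t"
  proof (rule ccontr)
    assume "\<not> after_y t"
    then have "y i \<le> y' i" for i
      using assms(3,4) by (cases i t rule: linorder_cases) (auto simp: after_y_def)
    then have "(\<Sum>i<n. y i) < (\<Sum>i<n. y' i)"
      using assms(3) \<open>t < n\<close> by (intro sum_strict_mono_ex1) auto
    then show False using eq by simp
  qed
qed

lemma separated_byI:
  assumes "\<And>x' y' z'. lower x' y' z' \<Longrightarrow>
     0 < (\<Sum>i<n. int (oa i) * (int (y' i) - int (y i)) + int (ob i) * (int (z' i) - int (z i)))"
  shows "separated_by oa ob"
  unfolding separated_by_def
proof (intro allI impI)
  fix x' y' z' assume "lower x' y' z'"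
  from assms[OF this]
  have "int (\<Sum>i<n. oa i * y i + ob i * z i) < int (\<Sum>i<n. oa i * y' i + ob i * z' i)"
    by (simp add: algebra_simps sum.distrib sum_subtractf)
  then show "(\<Sum>i<n. oa i * y i + ob i * z i) < (\<Sum>i<n. oa i * y' i + ob i * z' i)" by linarith
qed

text \<open>
  Take \<open>P\<close> to be the cameras with an \<open>x\<close> after a \<open>y\<close>, and \<open>Q\<close> those with a \<open>y\<close> after a \<open>z\<close>. By
  the first assumption they are disjoint, and all places at which a competitor can differ first
  are in \<open>Q\<close> (for a \<open>z\<close>) or in \<open>P\<close> (for a \<open>y\<close>). The weights on \<open>Q\<close> dominate those on \<open>P\<close>, as \<open>z\<close>
  is compared before \<open>y\<close>.
\<close>

lemma degeneration_separate:
  assumes noX: "\<And>i. after_z i \<Longrightarrow> x i = 0"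
    and notB: "\<And>k l. k < l \<Longrightarrow> after_z k \<Longrightarrow> y k > 0 \<Longrightarrow> y l > 0 \<Longrightarrow> u k = 0"
  shows "\<exists>\<pi>. degeneration \<pi>"
proof -
  define P where "P = {i. after_y i \<and> x i > 0}"
  define Q where "Q = {i. after_z i \<and> y i > 0}"
  \<comment> \<open>The defaults are distinct indices beyond all cameras.\<close>
  define jA where "jA = (if P = {} then n else Max P)"
  define jB where "jB = (if Q = {} then n + 1 else Max Q)"
  have sub: "P \<subseteq> {..<n}" "Q \<subseteq> {..<n}" using supp by (auto simp: P_def Q_def intro: leI ccontr)
  then have fin: "finite P" "finite Q" using finite_subset by blast+
  have disj: "P \<inter> Q = {}" using noX by (auto simp: P_def Q_def)
  have jA: "jA \<in> P \<or> P = {} \<and> jA \<ge> n" and jB: "jB \<in> Q \<or> Q = {} \<and> jB \<ge> n"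
    using Max_in[OF fin(1)] Max_in[OF fin(2)] by (auto simp: jA_def jB_def)
  have "jA \<noteq> jB" using jA jB disj sub by (auto simp: jA_def jB_def split: if_splits)
  define oa where "oa i = (if i \<in> P then K ^ i else 0)" for i
  define ob where "ob i = (if i \<in> Q then K ^ (2 * n + 1 + i) else 0)" for i
  have "K > 0" using K_ge_2 by simp
  have sep: "separated_by oa ob"
  proof (rule separated_byI)
    fix x' y' z' assume low: "lower x' y' z'"
    define lo where "lo i = (if i \<in> P then int (y' i) - int (y i) else 0)" for i
    define hi where "hi i = (if i \<in> Q then int (z' i) - int (z i) else 0)" for i
    have "(\<exists>s<n. hi s > 0 \<and> (\<forall>p<n. s < p \<longrightarrow> hi p \<ge> 0)) \<or>
        (\<forall>p<n. hi p \<ge> 0) \<and> (\<exists>s<n. lo s > 0 \<and> (\<forall>p<n. s < p \<longrightarrow> lo p \<ge> 0))"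
    proof -
      consider t where "z t < z' t" "\<forall>s>t. z' s = z s"
        | t where "\<forall>s. z' s = z s" "y t < y' t" "\<forall>s>t. y' s = y s"
        using low by (auto simp: lower_def)
      then show ?thesis
      proof cases
        case 1
        note t = top_z_change[OF low 1]
        then have "t \<in> Q" using noX by (auto simp: Q_def)
        then show ?thesis using 1 t(3) by (intro disjI1 exI[of _ t]) (auto simp: hi_def)
      next
        case 2
        note t = top_y_change[OF low 2]
        then have "t \<in> P" by (auto simp: P_def)
        then show ?thesis using 2 t(3) by (intro disjI2 conjI exI[of _ t]) (auto simp: hi_def lo_def)
      qed
    qed
    then have "0 < (\<Sum>i<n. lo i * int K ^ i) + (\<Sum>i<n. (\<lambda>_. 0) i * int K ^ (n + i)) + 0 * int K ^ (2 * n)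
      + (\<Sum>i<n. hi i * int K ^ (2 * n + 1 + i))"
      using lowerD[OF low] K_ge_2 by (intro block_digits_pos) (auto simp: lo_def hi_def)
    also have "\<dots> = (\<Sum>i<n. int (oa i) * (int (y' i) - int (y i)) + int (ob i) * (int (z' i) - int (z i)))"
      unfolding sum.distrib by (auto simp: lo_def hi_def oa_def ob_def intro!: arg_cong2[where f = "(+)"] sum.cong)
    finally show "0 < \<dots>" .
  qed
  show ?thesis
  proof (rule two_clusters[OF sub disj \<open>jA \<noteq> jB\<close> jA jB _ _ _ _ _ _ sep])
    fix i assume i: "i \<in> P" "i \<noteq> jA"
    then have "i < jA" "jA \<in> P" using Max_ge[OF fin(1), of i] jA by (auto simp: jA_def split: if_splits)
    moreover obtain i' where "i' < i" "y i' > 0" using i by (auto simp: P_def after_y_def)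
    ultimately show "i < jA \<and> u i = 0" using yxx[of i' i jA] i by (auto simp: P_def)
  next
    fix i assume i: "i \<in> Q" "i \<noteq> jB"
    then have "i < jB" "jB \<in> Q" using Max_ge[OF fin(2), of i] jB by (auto simp: jB_def split: if_splits)
    then show "i < jB \<and> u i = 0" using notB[of i jB] i by (auto simp: Q_def)
  qed (use \<open>K > 0\<close> in \<open>auto simp: oa_def ob_def\<close>)
qed

text \<open>
  If an \<open>x\<close> comes after a \<open>z\<close>, its camera may have to be near both zeros, so there is only one
  cluster. A first difference in \<open>z\<close> is at a camera of \<open>N\<close>, where \<open>ob\<close> dominates. If the
  \<open>z\<close>-exponents agree, the first difference is in \<open>y\<close>, at a camera \<open>t\<close> with an \<open>x\<close>. If \<open>t\<close> is in
  \<open>N\<close>, then by \<open>zyx\<close> no earlier camera of \<open>N\<close> has a \<open>y\<close>, so the number of \<open>y\<close>'s in \<open>N\<close> has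
  grown, which the common weight \<open>s\<close> detects; otherwise \<open>N\<close> lies beyond \<open>t\<close> and the weights
  \<open>K ^ i\<close> decide.
\<close>

lemma degeneration_joint:
  assumes X: "after_z q0" "x q0 > 0"
    and notB: "\<And>k l. k < l \<Longrightarrow> after_z k \<Longrightarrow> y k > 0 \<Longrightarrow> y l > 0 \<Longrightarrow> u k = 0"
  shows "\<exists>\<pi>. degeneration \<pi>"
proof -
  define N where "N = {i. after_z i \<and> x i + y i > 0}"
  define R where "R = {i. after_y i \<and> x i > 0} \<union> N"
  define j where "j = Max R"
  have sub: "R \<subseteq> {..<n}" using supp by (fastforce simp: R_def N_def intro: leI ccontr)
  then have fin: "finite R" using finite_subset by blast
  have "q0 \<in> R" using X by (auto simp: R_def N_def)
  then have j: "j \<in> R" unfolding j_def using fin by (intro Max_in) auto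
  have NR: "N \<subseteq> R" by (auto simp: R_def)
  have az_mono: "after_z i \<Longrightarrow> i \<le> i' \<Longrightarrow> after_z i'" for i i' using less_le_trans by (auto simp: after_z_def)
  have N_zero: "u i = 0" if "i \<in> N" "i' \<in> R" "i < i'" for i i'
  proof -
    from that obtain h where h: "h < i" "z h > 0" by (auto simp: N_def after_z_def)
    have "i' \<in> N" using that az_mono[of i i'] by (auto simp: R_def N_def)
    with that(1) have "x i > 0 \<or> y i > 0" "x i' > 0 \<or> y i' > 0" by (auto simp: N_def)
    then consider "x i > 0" "x i' > 0" | "x i > 0" "y i' > 0" | "y i > 0" "x i' > 0" | "y i > 0" "y i' > 0"
      by metis
    then show ?thesis
    proof cases
      case 1
      then show ?thesis using zxx[OF h(1) \<open>i < i'\<close> h(2)] by simp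
    next
      case 2
      then show ?thesis using zxy[OF h(1) \<open>i < i'\<close> h(2)] by simp
    next
      case 3
      then show ?thesis using zyx[OF h(1) \<open>i < i'\<close> h(2)] by simp
    next
      case 4
      then show ?thesis using notB[OF \<open>i < i'\<close>] \<open>i \<in> N\<close> by (simp add: N_def)
    qed
  qed
  define s where "s = K ^ (2 * n)"
  define oa where "oa i = (if i \<in> N then s else if i \<in> R then K ^ i else 0)" for i
  define ob where "ob i = (if i \<in> N then K ^ (2 * n + 1 + i) else if i \<in> R then K ^ i else 0)" for i
  have "K > 1" using K_ge_2 by simp
  have sep: "separated_by oa ob"
  proof (rule separated_byI)
    fix x' y' z' assume low: "lower x' y' z'"
    define lo where "lo i = (if i \<in> R - N then int (x i) - int (x' i) else 0)" for i
    define c where "c = (\<Sum>i\<in>N. int (y' i) - int (y i))"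
    define hi where "hi i = (if i \<in> N then int (z' i) - int (z i) else 0)" for i
    have "(\<exists>s<n. hi s > 0 \<and> (\<forall>p<n. s < p \<longrightarrow> hi p \<ge> 0)) \<or>
        (\<forall>p<n. hi p \<ge> 0) \<and> (c > 0 \<or> c \<ge> 0 \<and> (\<exists>s<n. lo s > 0 \<and> (\<forall>p<n. s < p \<longrightarrow> lo p \<ge> 0)))"
    proof -
      consider t where "z t < z' t" "\<forall>s>t. z' s = z s"
        | t where "\<forall>s. z' s = z s" "y t < y' t" "\<forall>s>t. y' s = y s"
        using low by (auto simp: lower_def)
      then show ?thesis
      proof cases
        case 1
        note t = top_z_change[OF low 1]
        then have "t \<in> N" by (auto simp: N_def)
        then show ?thesis using 1 t(3) by (intro disjI1 exI[of _ t]) (auto simp: hi_def)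
      next
        case 2
        note t = top_y_change[OF low 2]
        have hi0: "hi p \<ge> 0" for p using 2 by (auto simp: hi_def)
        have "t \<in> R" using t by (auto simp: R_def)
        show ?thesis
        proof (cases "after_z t")
          case True
          then have "t \<in> N" using t by (auto simp: N_def)
          have "y i \<le> y' i" if "i \<in> N" for i
          proof (cases i t rule: linorder_cases)
            case less
            from that obtain h where "h < i" "z h > 0" by (auto simp: N_def after_z_def)
            then have "y i = 0" using zyx[OF _ less, of h] t(2) by fastforce
            then show ?thesis by simp
          qed (use 2 in auto)
          then have "(\<Sum>i\<in>N. y i) < (\<Sum>i\<in>N. y' i)"
            using \<open>t \<in> N\<close> 2(2) finite_subset[OF NR fin] by (intro sum_strict_mono_ex1) auto
          then have "int (\<Sum>i\<in>N. y i) < int (\<Sum>i\<in>N. y' i)" by linarith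
          then have "c > 0" by (simp add: c_def sum_subtractf)
          then show ?thesis using hi0 by blast
        next
          case False
          have "y' i = y i" if "i \<in> N" for i
            using that 2(3) False az_mono[of i t] by (cases "t < i") (auto simp: N_def)
          then have "c = 0" by (simp add: c_def)
          have xx: "int (x p) - int (x' p) = int (y' p) - int (y p)" for p
            using lowerD(1)[OF low, of p] 2(1)[rule_format, of p] by linarith
          have "lo t > 0" "\<forall>p<n. t < p \<longrightarrow> lo p \<ge> 0"
            using False \<open>t \<in> R\<close> 2 unfolding lo_def xx by (auto simp: N_def)
          then show ?thesis using hi0 \<open>c = 0\<close> t(3) by auto
        qed
      qed
    qed
    then have "0 < (\<Sum>i<n. lo i * int K ^ i) + (\<Sum>i<n. (\<lambda>_. 0) i * int K ^ (n + i)) + c * int K ^ (2 * n)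
      + (\<Sum>i<n. hi i * int K ^ (2 * n + 1 + i))"
      using lowerD[OF low] K_ge_2 lower_sum_bound[OF low, of N] NR sub unfolding c_def[symmetric]
      by (intro block_digits_pos) (auto simp: lo_def hi_def abs_minus_commute)
    also have "c * int K ^ (2 * n) = (\<Sum>i<n. if i \<in> N then (int (y' i) - int (y i)) * int K ^ (2 * n) else 0)"
    proof -
      have "{..<n} \<inter> N = N" using NR sub by auto
      then show ?thesis by (simp add: c_def sum_distrib_right sum.inter_restrict[symmetric])
    qed
    also have "(\<Sum>i<n. lo i * int K ^ i) + (\<Sum>i<n. (\<lambda>_. 0) i * int K ^ (n + i)) +
        (\<Sum>i<n. if i \<in> N then (int (y' i) - int (y i)) * int K ^ (2 * n) else 0) +
        (\<Sum>i<n. hi i * int K ^ (2 * n + 1 + i))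
      = (\<Sum>i<n. int (oa i) * (int (y' i) - int (y i)) + int (ob i) * (int (z' i) - int (z i)))"
      unfolding sum.distrib[symmetric]
    proof (rule sum.cong[OF refl])
      fix i
      have x_eq: "int (x i) - int (x' i) = (int (y' i) - int (y i)) + (int (z' i) - int (z i))"
        using lowerD(1)[OF low, of i] by linarith
      show "lo i * int K ^ i + 0 * int K ^ (n + i)
          + (if i \<in> N then (int (y' i) - int (y i)) * int K ^ (2 * n) else 0)
          + hi i * int K ^ (2 * n + 1 + i) =
         int (oa i) * (int (y' i) - int (y i)) + int (ob i) * (int (z' i) - int (z i))"
        using NR unfolding lo_def x_eq by (auto simp: hi_def oa_def ob_def s_def algebra_simps)
    qed
    finally show "0 < (\<Sum>i<n. int (oa i) * (int (y' i) - int (y i)) + int (ob i) * (int (z' i) - int (z i)))" .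
  qed
  show ?thesis
  proof (rule one_cluster[OF sub j NR _ _ _ _ _ sep, of s])
    fix i assume i: "i \<in> R" "i \<noteq> j"
    then have "i < j" using Max_ge[OF fin, of i] by (auto simp: j_def)
    have "u i = 0"
    proof (cases "i \<in> N")
      case True
      then show ?thesis using N_zero j \<open>i < j\<close> by blast
    next
      case False
      then obtain h where "h < i" "y h > 0" "x i > 0" using i by (auto simp: R_def after_y_def)
      moreover have "i < q0" using False X \<open>x i > 0\<close> az_mono[of q0 i] by (cases "i < q0") (auto simp: N_def)
      ultimately show ?thesis using yxx[of h i q0] X by auto
    qed
    then show "i < j \<and> u i = 0" using \<open>i < j\<close> by simp
  next
    fix i assume "i \<in> N"
    then show "oa i = s \<and> s < ob i"
      using power_strict_increasing[of "2 * n" "2 * n + 1 + i" K] \<open>K > 1\<close> by (simp add: oa_def ob_def s_def)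
  next
    fix i assume "i \<in> R" "i \<notin> N"
    then show "oa i = ob i \<and> 0 < ob i \<and> ob i < s"
      using \<open>K > 1\<close> sub by (auto simp: oa_def ob_def s_def intro!: power_strict_increasing)
  qed (use \<open>K > 1\<close> NR in \<open>auto simp: oa_def ob_def s_def\<close>)
qed

text \<open>
  Let \<open>k\<close> be the last camera that violates the assumption of the previous two lemmas. It cannot
  join a cluster, because \<open>u k > 0\<close> and there is a later \<open>y\<close>. On the other hand \<open>zyx\<close>, \<open>zxy\<close> and
  \<open>zxyy\<close> now exclude any \<open>x\<close> after a \<open>z\<close>. With \<open>j\<close> the last camera before \<open>k\<close> that has a \<open>z\<close>,
  let \<open>P\<close> consist of the cameras up to \<open>j\<close> that have an \<open>x\<close> or a \<open>z\<close>; \<open>zzyy\<close> and \<open>xzyy\<close> show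
  \<open>u = 0\<close> on \<open>P\<close> except at \<open>j\<close>. Let \<open>Q\<close> consist of the cameras beyond \<open>k\<close> with a \<open>y\<close>, where
  \<open>u = 0\<close> except at the last one by the choice of \<open>k\<close>.

  A competitor that agrees in \<open>z\<close> beyond \<open>k\<close> has at least as many \<open>y\<close>'s in \<open>P\<close>: the cameras up
  to \<open>j\<close> outside \<open>P\<close> are full of \<open>y\<close>'s, and beyond \<open>j\<close> there is no \<open>x\<close> that could be replaced by
  a \<open>y\<close>. This number is the digit at \<open>K ^ (2 * n)\<close>. If it agrees, a first difference in \<open>z\<close>
  takes away a \<open>y\<close> at a camera after the first \<open>z\<close>, whence the negative correction
  \<open>- K ^ (n + i)\<close> there, whereas a first difference in \<open>y\<close> adds a \<open>y\<close> at a camera that is not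
  after any \<open>z\<close>, whence \<open>+ K ^ i\<close>.
\<close>

lemma degeneration_split:
  assumes "k0 < l0" "after_z k0" "y k0 > 0" "y l0 > 0" "u k0 > 0"
  shows "\<exists>\<pi>. degeneration \<pi>"
proof -
  define B where "B = {k. after_z k \<and> y k > 0 \<and> u k > 0 \<and> (\<exists>l>k. y l > 0)}"
  define k where "k = Max B"
  have "B \<subseteq> {..<n}" using supp by (fastforce simp: B_def intro: leI ccontr)
  then have finB: "finite B" using finite_subset by blast
  have "k0 \<in> B" using assms by (auto simp: B_def)
  then have "k \<in> B" unfolding k_def using finB by (intro Max_in) auto
  then obtain l where k: "after_z k" "y k > 0" "u k > 0" "k < l" "y l > 0" by (auto simp: B_def)
  have kmax: "u r = 0" if "k < r" "y r > 0" "r < r'" "y r' > 0" for r r'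
  proof (rule ccontr)
    assume "u r \<noteq> 0"
    moreover have "after_z r" using k(1) that(1) by (meson after_z_def less_trans)
    ultimately have "r \<in> B" using that by (auto simp: B_def)
    then show False using Max_ge[OF finB, of r] that(1) by (simp add: k_def)
  qed
  have noX: "x i = 0" if "after_z i" for i
  proof (rule ccontr)
    assume "x i \<noteq> 0"
    from that obtain h where h: "h < i" "z h > 0" by (auto simp: after_z_def)
    obtain h' where h': "h' < k" "z h' > 0" using k by (auto simp: after_z_def)
    show False
    proof (cases i k rule: linorder_cases)
      case less
      then show False using zxyy[OF h(1) less k(4) h(2) _ k(2,5)] \<open>x i \<noteq> 0\<close> k(3) by simp
    next
      case equal
      then show False using zxy[OF h'(1) k(4) h'(2) _ k(5)] \<open>x i \<noteq> 0\<close> k(3) by simp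
    next
      case greater
      then show False using zyx[OF h'(1) greater h'(2) k(2)] \<open>x i \<noteq> 0\<close> by simp
    qed
  qed
  define j where "j = Max {i. i < k \<and> z i > 0}"
  have "j \<in> {i. i < k \<and> z i > 0}"
    unfolding j_def using k(1) by (intro Max_in) (auto simp: after_z_def)
  then have j: "j < k" "z j > 0" by auto
  have jmax: "z i = 0" if "j < i" "i < k" for i
    using Max_ge[of "{i. i < k \<and> z i > 0}" i] that unfolding j_def[symmetric] by auto
  have az_j: "after_z i" if "j < i" for i using that j by (auto simp: after_z_def)
  define P where "P = {i. i \<le> j \<and> x i + z i > 0}"
  define Q where "Q = {i. k < i \<and> y i > 0}"
  define jB where "jB = Max Q"
  have "k < n" using k(2) supp[of k] by (cases "k < n") auto
  then have sub: "P \<subseteq> {..<n}" using j by (auto simp: P_def)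
  have subQ: "Q \<subseteq> {..<n}" using supp by (auto simp: Q_def intro: leI ccontr)
  have finQ: "finite Q" using subQ finite_subset by blast
  have jB: "jB \<in> Q" unfolding jB_def using finQ k by (intro Max_in) (auto simp: Q_def)
  have jA: "j \<in> P" using j by (auto simp: P_def)
  have disj: "P \<inter> Q = {}" using j by (auto simp: P_def Q_def)
  define oa where "oa i = (if i \<in> P then (if after_z i then K ^ (2 * n) - K ^ (n + i) else K ^ (2 * n) + K ^ i) else 0)" for i
  define ob where "ob i = (if i \<in> Q then K ^ (2 * n + 1 + i) else 0)" for i
  have "K > 1" using K_ge_2 by simp
  have Kless: "K ^ (n + i) < K ^ (2 * n)" if "i < n" for i
    using that \<open>K > 1\<close> by (intro power_strict_increasing) auto
  have sep: "separated_by oa ob"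
  proof (rule separated_byI)
    fix x' y' z' assume low: "lower x' y' z'"
    define dy where "dy i = int (y' i) - int (y i)" for i
    define dz where "dz i = int (z' i) - int (z i)" for i
    define lo where "lo i = (if i \<in> P \<and> \<not> after_z i then dy i else 0)" for i
    define mid where "mid i = (if i \<in> P \<and> after_z i then - dy i else 0)" for i
    define c where "c = (\<Sum>i\<in>P. dy i)"
    define hi where "hi i = (if i \<in> Q then dz i else 0)" for i
    have deg: "int (x' i) - int (x i) + dy i + dz i = 0" for i
      using lowerD(1)[OF low, of i] by (simp add: dy_def dz_def)
    have sums: "(\<Sum>i<n. dy i) = 0" "(\<Sum>i<n. dz i) = 0"
    proof -
      have "int (\<Sum>i<n. y' i) = int (\<Sum>i<n. y i)" "int (\<Sum>i<n. z' i) = int (\<Sum>i<n. z i)"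
        using low by (simp_all add: lower_def)
      then show "(\<Sum>i<n. dy i) = 0" "(\<Sum>i<n. dz i) = 0"
        by (simp_all add: dy_def dz_def sum_subtractf)
    qed
    have c_eq: "c = - (\<Sum>i\<in>{..<n} - P. dy i)"
      using sum.subset_diff[OF sub, of dy] sums(1) by (simp add: c_def)
    have outP: "dy i \<le> 0" if "i \<notin> P" "i > j \<Longrightarrow> dz i \<ge> 0" for i
    proof (cases "i \<le> j")
      case True
      then have "x i = 0" "z i = 0" using that by (auto simp: P_def)
      then show ?thesis using deg[of i] by (simp add: dz_def)
    next
      case False
      then show ?thesis using deg[of i] that(2) noX[OF az_j[of i]] by simp
    qed
    have tail: "c \<ge> 0" "c = 0 \<Longrightarrow> i < n \<Longrightarrow> i \<notin> P \<Longrightarrow> dy i = 0" if "\<And>i. i > j \<Longrightarrow> dz i = 0" for i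
    proof -
      have np: "\<And>i. i \<in> {..<n} - P \<Longrightarrow> dy i \<le> 0" using outP that by auto
      then show "c \<ge> 0" unfolding c_eq using sum_nonpos[of "{..<n} - P" dy] by simp
      assume "c = 0" "i < n" "i \<notin> P"
      moreover have "(\<Sum>i\<in>{..<n} - P. - dy i) = 0 \<longleftrightarrow> (\<forall>i\<in>{..<n} - P. - dy i = 0)"
        using np by (intro sum_nonneg_eq_0_iff) auto
      ultimately show "dy i = 0" unfolding c_eq by (auto simp: sum_negf)
    qed
    have "(\<exists>s<n. hi s > 0 \<and> (\<forall>p<n. s < p \<longrightarrow> hi p \<ge> 0)) \<or>
      (\<forall>p<n. hi p \<ge> 0) \<and> (c > 0 \<or> c \<ge> 0 \<and>
        ((\<exists>s<n. mid s > 0 \<and> (\<forall>p<n. s < p \<longrightarrow> mid p \<ge> 0)) \<or>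
         (\<forall>p<n. mid p \<ge> 0) \<and> (\<exists>s<n. lo s > 0 \<and> (\<forall>p<n. s < p \<longrightarrow> lo p \<ge> 0))))"
    proof -
      consider (z) t where "z t < z' t" "\<forall>s>t. z' s = z s"
        | (y) t where "\<forall>s. z' s = z s" "y t < y' t" "\<forall>s>t. y' s = y s"
        using low by (auto simp: lower_def)
      then show ?thesis
      proof cases
        case z
        note t = top_z_change[OF low z]
        have "x t = 0" "y t > 0" using t noX[OF t(1)] by auto
        have dzt: "dz t > 0" "\<And>s. s > t \<Longrightarrow> dz s = 0" using z by (auto simp: dz_def)
        consider "t > k" | "j < t" "t \<le> k" | "t \<le> j" by linarith
        then show ?thesis
        proof cases
          case 1
          then have "t \<in> Q" using \<open>y t > 0\<close> by (auto simp: Q_def)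
          then show ?thesis using dzt t(3) by (intro disjI1 exI[of _ t]) (auto simp: hi_def)
        next
          case 2
          have dz0: "dz i \<ge> 0" if "i > j" for i
          proof (cases i t rule: linorder_cases)
            case less
            then show ?thesis using jmax[OF that] 2 by (simp add: dz_def)
          qed (use dzt in auto)
          have "t \<notin> P" using 2 by (auto simp: P_def)
          have "dy t < 0" using deg[of t] dzt(1) \<open>x t = 0\<close> by simp
          then have "(\<Sum>i\<in>{..<n} - P. dy i) < (\<Sum>i\<in>{..<n} - P. 0)"
            using outP dz0 \<open>t \<notin> P\<close> t(3) by (intro sum_strict_mono_ex1) auto
          then have "c > 0" by (simp add: c_eq)
          moreover have "hi p \<ge> 0" for p using 2 dzt by (auto simp: hi_def Q_def)
          ultimately show ?thesis by blast
        next
          case 3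
          have hi0: "hi p \<ge> 0" for p using 3 j dzt by (auto simp: hi_def Q_def)
          have dz0: "\<And>i. i > j \<Longrightarrow> dz i = 0" using dzt 3 by auto
          have "dy t < 0" using deg[of t] dzt(1) \<open>x t = 0\<close> by simp
          show ?thesis
          proof (cases "c = 0")
            case True
            have "t \<in> P" using tail(2)[OF dz0 True t(3)] \<open>dy t < 0\<close> by (cases "t \<in> P") auto
            moreover have "dy i \<le> 0" if "i > t" for i
            proof -
              have "after_z i" using that t(1) by (meson after_z_def less_trans)
              then show ?thesis using deg[of i] dzt(2)[OF that] noX by simp
            qed
            ultimately have "mid t > 0" "\<forall>p<n. t < p \<longrightarrow> mid p \<ge> 0"
              using \<open>dy t < 0\<close> t(1) by (auto simp: mid_def)
            then show ?thesis using hi0 True t(3) by auto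
          next
            case False
            then have "c > 0" using tail(1)[OF dz0] by simp
            then show ?thesis using hi0 by blast
          qed
        qed
      next
        case y
        note t = top_y_change[OF low y]
        have dz0: "\<And>i. dz i = 0" using y by (simp add: dz_def)
        then have hi0: "\<And>p. hi p \<ge> 0" by (simp add: hi_def)
        have "\<not> after_z t" using noX[of t] t(2) by auto
        then have "t \<in> P" using az_j[of t] t(2) by (cases "j < t") (auto simp: P_def)
        have dyt: "dy t > 0" "\<And>s. s > t \<Longrightarrow> dy s = 0" using y by (auto simp: dy_def)
        show ?thesis
        proof (cases "c = 0")
          case True
          have "mid p \<ge> 0" for p
          proof (cases "after_z p")
            case True
            then have "p > t" using \<open>\<not> after_z t\<close> by (meson after_z_def less_le_trans not_le)
            then show ?thesis using dyt by (simp add: mid_def)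
          qed (simp add: mid_def)
          moreover have "lo t > 0" "\<forall>p<n. t < p \<longrightarrow> lo p \<ge> 0"
            using dyt \<open>t \<in> P\<close> \<open>\<not> after_z t\<close> by (auto simp: lo_def)
          ultimately show ?thesis using hi0 True t(3) by auto
        next
          case False
          then have "c > 0" using tail(1)[OF dz0] by simp
          then show ?thesis using hi0 by blast
        qed
      qed
    qed
    then have "0 < (\<Sum>i<n. lo i * int K ^ i) + (\<Sum>i<n. mid i * int K ^ (n + i)) + c * int K ^ (2 * n)
      + (\<Sum>i<n. hi i * int K ^ (2 * n + 1 + i))"
      using lowerD[OF low, folded dy_def dz_def] K_ge_2 lower_sum_bound[OF low sub, folded dy_def, folded c_def]
      by (intro block_digits_pos) (auto simp: lo_def hi_def mid_def)
    also have "c * int K ^ (2 * n) = (\<Sum>i<n. if i \<in> P then dy i * int K ^ (2 * n) else 0)"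
    proof -
      have "{..<n} \<inter> P = P" using sub by auto
      then show ?thesis by (simp add: c_def sum_distrib_right sum.inter_restrict[symmetric])
    qed
    also have "(\<Sum>i<n. lo i * int K ^ i) + (\<Sum>i<n. mid i * int K ^ (n + i)) +
        (\<Sum>i<n. if i \<in> P then dy i * int K ^ (2 * n) else 0) +
        (\<Sum>i<n. hi i * int K ^ (2 * n + 1 + i))
      = (\<Sum>i<n. int (oa i) * dy i + int (ob i) * dz i)"
      unfolding sum.distrib[symmetric]
    proof (rule sum.cong[OF refl])
      fix i assume "i \<in> {..<n}"
      then have "int (K ^ (2 * n) - K ^ (n + i)) = int K ^ (2 * n) - int K ^ (n + i)"
        using Kless[of i] by (simp add: of_nat_diff)
      then have oa: "int (oa i) = (if i \<in> P then
          if after_z i then int K ^ (2 * n) - int K ^ (n + i) else int K ^ (2 * n) + int K ^ i else 0)"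
        by (simp add: oa_def)
      show "lo i * int K ^ i + mid i * int K ^ (n + i)
          + (if i \<in> P then dy i * int K ^ (2 * n) else 0)
          + hi i * int K ^ (2 * n + 1 + i) = int (oa i) * dy i + int (ob i) * dz i"
        unfolding oa by (auto simp: lo_def mid_def hi_def ob_def algebra_simps)
    qed
    finally show "0 < (\<Sum>i<n. int (oa i) * (int (y' i) - int (y i)) + int (ob i) * (int (z' i) - int (z i)))"
      by (simp add: dy_def dz_def)
  qed
  show ?thesis
  proof (rule two_clusters[OF sub subQ disj _ _ _ _ _ _ _ _ _ sep, of j jB])
    show "j \<noteq> jB" using jA jB disj by auto
  next
    fix i assume i: "i \<in> P" "i \<noteq> j"
    then have "i < j" by (auto simp: P_def)
    moreover have "u i = 0"
      using i zzyy[OF \<open>i < j\<close> j(1) k(4) _ j(2) k(2,5,3)] xzyy[OF \<open>i < j\<close> j(1) k(4) _ j(2) k(2,5,3)]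
      by (auto simp: P_def)
    ultimately show "i < j \<and> u i = 0" by simp
  next
    fix i assume i: "i \<in> Q" "i \<noteq> jB"
    then have "i < jB" using Max_ge[OF finQ, of i] by (auto simp: jB_def)
    then show "i < jB \<and> u i = 0" using i jB kmax[of i jB] by (auto simp: Q_def)
  next
    fix i assume "i \<in> P"
    then have "i < n" using sub by auto
    then show "oa i > 0" using \<open>i \<in> P\<close> \<open>K > 1\<close> Kless[of i] by (auto simp: oa_def)
  qed (use \<open>K > 1\<close> jA jB in \<open>auto simp: oa_def ob_def\<close>)
qed

lemma exists_degeneration: "\<exists>\<pi>. degeneration \<pi>"
proof (cases "\<exists>k l. k < l \<and> after_z k \<and> y k > 0 \<and> y l > 0 \<and> u k > 0")
  case True
  then show ?thesis using degeneration_split by blast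
next
  case False
  then have nB: "\<And>k l. k < l \<Longrightarrow> after_z k \<Longrightarrow> y k > 0 \<Longrightarrow> y l > 0 \<Longrightarrow> u k = 0" by (meson gr0I)
  show ?thesis
  proof (cases "\<exists>i. after_z i \<and> x i > 0")
    case True
    then show ?thesis using degeneration_joint nB by blast
  next
    case False
    then show ?thesis using degeneration_separate nB by (meson gr0I)
  qed
qed

end

section \<open>Monomials and the monomial order\<close>

abbreviation (input) keys where "keys \<equiv> Poly_Mapping.keys"
abbreviation (input) single where "single \<equiv> Poly_Mapping.single"
abbreviation (input) lookup where "lookup \<equiv> Poly_Mapping.lookup"

abbreviation ring_vars :: "nat set \<Rightarrow> var set" where
  "ring_vars \<tau> \<equiv> set (ell_vars \<tau>) \<union> set (v_vars \<tau>)"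

abbreviation exponent :: "mon \<Rightarrow> var \<Rightarrow> nat" where "exponent \<equiv> lookup"

definition word_mon :: "var list \<Rightarrow> mon" where
  "word_mon xs = (\<Sum>x\<leftarrow>xs. single x 1)"

lemma exponent_word_mon: "exponent (word_mon xs) x = count_list xs x"
  by (induction xs) (auto simp: word_mon_def lookup_add lookup_single)

lemma keys_word_mon: "keys (word_mon xs) = set xs"
  by (auto simp: in_keys_iff exponent_word_mon count_list_0_iff)

lemma word_mon_Cons: "word_mon (x # xs) = single x 1 + word_mon xs"
  by (simp add: word_mon_def)

definition mon_le :: "mon \<Rightarrow> mon \<Rightarrow> bool" where
  "mon_le s t \<longleftrightarrow> (\<forall>x. exponent s x \<le> exponent t x)"

lemma mon_le_split: "mon_le s t \<Longrightarrow> t = s + (t - s)"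
  by (rule poly_mapping_eqI) (simp add: mon_le_def lookup_add lookup_minus)

lemma mon_le_add: "mon_le s (s + t)"
  by (simp add: mon_le_def lookup_add)

lemma single_dvd_imp_mon_le:
  fixes c d :: complex
  assumes "single s c dvd single t d" "d \<noteq> 0"
  shows "mon_le s t"
proof -
  obtain q where q: "single t d = single s c * q" using assms(1) by (auto simp: dvd_def)
  have "t \<in> keys (single s c * q)" using assms(2) q[symmetric] by simp
  then show ?thesis using keys_mult[of "single s c" q] by (auto simp: mon_le_add split: if_splits)
qed

lemma mon_le_imp_single_dvd:
  fixes d :: complex
  assumes "mon_le s t" shows "single s 1 dvd single t d"
proof -
  have "single t d = single s 1 * single (t - s) d"
    using mon_le_split[OF assms] by (simp add: mult_single)
  then show ?thesis by simp
qed

lemma word_mon_le_iff: "distinct ps \<Longrightarrow> mon_le (word_mon ps) t \<longleftrightarrow> set ps \<subseteq> keys t"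
proof -
  assume "distinct ps"
  then have "count_list ps x = (if x \<in> set ps then 1 else 0)" for x
    by (induction ps) auto
  then show ?thesis
    by (auto simp: mon_le_def exponent_word_mon in_keys_iff Suc_le_eq)
qed

fun earlier :: "var \<Rightarrow> var \<Rightarrow> bool" where
  "earlier (Ell i j) (Ell i' j') \<longleftrightarrow> i < i' \<or> i = i' \<and> j < j'"
| "earlier (V j) (V j') \<longleftrightarrow> j < j'"
| "earlier _ _ \<longleftrightarrow> False"

lemma cameras_list: "sorted_list_of_set {1..m::nat} = [1..<Suc m]"
  by (metis atLeastLessThanSuc_atLeastAtMost sorted_list_of_set_range)

lemma ell_vars_eq: "ell_vars \<tau> = map (Ell 1) (sorted_list_of_set \<tau>) @ map (Ell 2) (sorted_list_of_set \<tau>)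
    @ map (Ell 3) (sorted_list_of_set \<tau>)"
  by (simp add: ell_vars_def)

lemma v_vars_eq: "v_vars \<tau> = map V (sorted_list_of_set \<tau>)"
  by (simp add: v_vars_def)

lemma set_ell_vars: "finite \<tau> \<Longrightarrow> set (ell_vars \<tau>) = {Ell i j | i j. i \<in> {1, 2, 3} \<and> j \<in> \<tau>}"
  by (auto simp: ell_vars_eq)

lemma set_v_vars: "finite \<tau> \<Longrightarrow> set (v_vars \<tau>) = V ` \<tau>"
  by (auto simp: v_vars_eq)

lemma sum_ell_vars:
  "(\<Sum>x\<leftarrow>ell_vars {1..m}. f x) = (\<Sum>j\<in>{1..m}. f (Ell 1 j) + f (Ell 2 j) + f (Ell 3 j) :: nat)"
  by (simp add: ell_vars_eq sum.distrib sum_list_distinct_conv_sum_set comp_def)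

lemma sum_v_vars: "(\<Sum>x\<leftarrow>v_vars {1..m}. f x) = (\<Sum>j\<in>{1..m}. f (V j) :: nat)"
  by (simp add: v_vars_eq sum_list_distinct_conv_sum_set comp_def)

lemma sorted_ell_vars: "sorted_wrt earlier (ell_vars {1..m})"
  unfolding ell_vars_eq cameras_list
  by (auto simp: sorted_wrt_append sorted_wrt_map simp del: upt_Suc)

lemma sorted_v_vars: "sorted_wrt earlier (v_vars {1..m})"
  unfolding v_vars_eq cameras_list by (auto simp: sorted_wrt_map simp del: upt_Suc)

lemma earlier_asym: "earlier x y \<Longrightarrow> \<not> earlier y x"
  by (cases x; cases y) auto

text \<open>
  The tie-break of \<open>grevlex_less\<close>, with positions in the list of variables replaced by
  \<open>earlier\<close>.
\<close>

definition revlex_less :: "var set \<Rightarrow> (var \<Rightarrow> nat) \<Rightarrow> (var \<Rightarrow> nat) \<Rightarrow> bool" where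
  "revlex_less X a b \<longleftrightarrow> (\<exists>x\<in>X. b x < a x \<and> (\<forall>y\<in>X. earlier x y \<longrightarrow> a y = b y))"

lemma grevlex_less_iff:
  assumes "sorted_wrt earlier xs"
  shows "grevlex_less xs s t \<longleftrightarrow>
    (\<Sum>x\<leftarrow>xs. exponent s x) < (\<Sum>x\<leftarrow>xs. exponent t x) \<or>
    (\<Sum>x\<leftarrow>xs. exponent s x) = (\<Sum>x\<leftarrow>xs. exponent t x) \<and>
    revlex_less (set xs) (exponent s) (exponent t)"
proof -
  have idx: "earlier (xs ! k) (xs ! l) \<longleftrightarrow> k < l" if "k < length xs" "l < length xs" for k l
    using sorted_wrt_nth_less[OF assms, of k l] sorted_wrt_nth_less[OF assms, of l k] that
      earlier_asym by (metis linorder_neqE_nat)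
  have "(\<exists>k<length xs. exponent t (xs ! k) < exponent s (xs ! k) \<and>
           (\<forall>l. k < l \<and> l < length xs \<longrightarrow> exponent s (xs ! l) = exponent t (xs ! l))) \<longleftrightarrow>
        revlex_less (set xs) (exponent s) (exponent t)"
    unfolding revlex_less_def set_conv_nth
    by (auto simp: idx; metis idx)
  then show ?thesis by (simp add: grevlex_less_def Let_def)
qed

definition ell_degree :: "nat \<Rightarrow> mon \<Rightarrow> nat" where
  "ell_degree m t = (\<Sum>j\<in>{1..m}. exponent t (Ell 1 j) + exponent t (Ell 2 j) + exponent t (Ell 3 j))"

definition v_degree :: "nat \<Rightarrow> mon \<Rightarrow> nat" where
  "v_degree m t = (\<Sum>j\<in>{1..m}. exponent t (V j))"

lemma grevlex_ell: "grevlex_less (ell_vars {1..m}) s t \<longleftrightarrow> ell_degree m s < ell_degree m t \<or>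
    ell_degree m s = ell_degree m t \<and> revlex_less (set (ell_vars {1..m})) (exponent s) (exponent t)"
  unfolding grevlex_less_iff[OF sorted_ell_vars] sum_ell_vars ell_degree_def ..

lemma grevlex_v: "grevlex_less (v_vars {1..m}) s t \<longleftrightarrow> v_degree m s < v_degree m t \<or>
    v_degree m s = v_degree m t \<and> revlex_less (set (v_vars {1..m})) (exponent s) (exponent t)"
  unfolding grevlex_less_iff[OF sorted_v_vars] sum_v_vars v_degree_def ..

subsection \<open>Properties of a strict total order\<close>

lemma grevlex_irrefl: "\<not> grevlex_less xs s s"
  by (auto simp: grevlex_less_def Let_def)

lemma grevlex_trans:
  assumes "grevlex_less xs s t" "grevlex_less xs t w"
  shows "grevlex_less xs s w"
proof -
  let ?d = "\<lambda>s. \<Sum>x\<leftarrow>xs. exponent s x"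
  show ?thesis
  proof (cases "?d s < ?d w")
    case True
    then show ?thesis by (simp add: grevlex_less_def Let_def)
  next
    case False
    then have eq: "?d s = ?d t" "?d t = ?d w" using assms by (auto simp: grevlex_less_def Let_def)
    obtain k where k: "k < length xs" "exponent t (xs ! k) < exponent s (xs ! k)"
      "\<And>l. k < l \<Longrightarrow> l < length xs \<Longrightarrow> exponent s (xs ! l) = exponent t (xs ! l)"
      using assms(1) eq by (auto simp: grevlex_less_def Let_def)
    obtain k' where k': "k' < length xs" "exponent w (xs ! k') < exponent t (xs ! k')"
      "\<And>l. k' < l \<Longrightarrow> l < length xs \<Longrightarrow> exponent t (xs ! l) = exponent w (xs ! l)"
      using assms(2) eq by (auto simp: grevlex_less_def Let_def)
    have "max k k' < length xs" using k k' by simp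
    moreover have "exponent w (xs ! max k k') < exponent s (xs ! max k k')"
      using k(2) k'(2) k(3)[of k'] k'(3)[of k] k(1) k'(1)
      by (cases k k' rule: linorder_cases) (auto simp: max_def)
    moreover have "\<forall>l. max k k' < l \<and> l < length xs \<longrightarrow> exponent s (xs ! l) = exponent w (xs ! l)"
      using k(3) k'(3) by simp
    ultimately show ?thesis unfolding grevlex_less_def Let_def using eq by metis
  qed
qed

lemma grevlex_total:
  assumes "x \<in> set xs" "exponent s x \<noteq> exponent t x"
  shows "grevlex_less xs s t \<or> grevlex_less xs t s"
proof -
  let ?d = "\<lambda>s. \<Sum>x\<leftarrow>xs. exponent s x"
  define D where "D = {k. k < length xs \<and> exponent s (xs ! k) \<noteq> exponent t (xs ! k)}"
  have D: "finite D" "D \<noteq> {}" using assms by (auto simp: D_def in_set_conv_nth)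
  then have k: "Max D < length xs" "exponent s (xs ! Max D) \<noteq> exponent t (xs ! Max D)"
    using Max_in[OF D] by (auto simp: D_def)
  have "exponent s (xs ! l) = exponent t (xs ! l)" if "Max D < l" "l < length xs" for l
  proof (rule ccontr)
    assume "\<not> ?thesis"
    then have "l \<in> D" using that by (simp add: D_def)
    then show False using Max_ge[OF D(1), of l] that(1) by simp
  qed
  then show ?thesis using k
    by (cases "?d s" "?d t" rule: linorder_cases; cases "exponent s (xs ! Max D)" "exponent t (xs ! Max D)" rule: linorder_cases)
       (auto simp: grevlex_less_def Let_def)
qed

lemma mon_less_irrefl: "\<not> mon_less m s s"
  by (simp add: mon_less_def grevlex_irrefl)

lemma grevlex_cong:
  assumes "\<forall>x\<in>set xs. exponent s x = exponent s' x" "\<forall>x\<in>set xs. exponent t x = exponent t' x"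
  shows "grevlex_less xs s t \<longleftrightarrow> grevlex_less xs s' t'"
proof -
  have maps: "map (exponent s) xs = map (exponent s') xs" "map (exponent t) xs = map (exponent t') xs"
    using assms by auto
  show ?thesis unfolding grevlex_less_def Let_def maps using assms by (simp cong: conj_cong)
qed

lemma mon_less_trans: "mon_less m s t \<Longrightarrow> mon_less m t w \<Longrightarrow> mon_less m s w"
  unfolding mon_less_def
  using grevlex_trans grevlex_cong[of "ell_vars {1..m}" s t w w] grevlex_cong[of "ell_vars {1..m}" s s t w]
  by auto

lemma mon_less_asym: "mon_less m s t \<Longrightarrow> \<not> mon_less m t s"
  using mon_less_trans mon_less_irrefl by blast

definition ring_mons :: "nat set \<Rightarrow> mon set" where
  "ring_mons \<tau> = {t. keys t \<subseteq> ring_vars \<tau>}"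

lemma poly_ring_iff: "p \<in> poly_ring \<tau> \<longleftrightarrow> keys p \<subseteq> ring_mons \<tau>"
  by (auto simp: poly_ring_def ring_mons_def)

lemma mon_less_total:
  assumes "s \<in> ring_mons {1..m}" "t \<in> ring_mons {1..m}" "s \<noteq> t"
  shows "mon_less m s t \<or> mon_less m t s"
proof -
  obtain x where x: "exponent s x \<noteq> exponent t x" using \<open>s \<noteq> t\<close> by (metis poly_mapping_eqI)
  then have "x \<in> keys s \<union> keys t" by (auto simp: in_keys_iff)
  then have x': "x \<in> set (ell_vars {1..m}) \<or> x \<in> set (v_vars {1..m})" using assms by (auto simp: ring_mons_def)
  show ?thesis
  proof (cases "\<forall>x\<in>set (ell_vars {1..m}). exponent s x = exponent t x")
    case True
    then have "x \<in> set (v_vars {1..m})" using x x' by blast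
    from grevlex_total[OF this x] show ?thesis using True by (auto simp: mon_less_def)
  next
    case False
    then obtain y where "y \<in> set (ell_vars {1..m})" "exponent s y \<noteq> exponent t y" by auto
    from grevlex_total[OF this] show ?thesis by (auto simp: mon_less_def)
  qed
qed

text \<open>
  The order refines divisibility.
\<close>

lemma mon_le_not_less: "mon_le s t \<Longrightarrow> \<not> mon_less m t s"
proof -
  assume le: "mon_le s t"
  have "\<not> grevlex_less xs t s" for xs
  proof
    assume g: "grevlex_less xs t s"
    have le': "(\<Sum>x\<leftarrow>ys. exponent s x) \<le> (\<Sum>x\<leftarrow>ys. exponent t x)" for ys
      using le by (intro sum_list_mono) (simp add: mon_le_def)
    with g le'[of xs] have "(\<Sum>x\<leftarrow>xs. exponent s x) = (\<Sum>x\<leftarrow>xs. exponent t x)"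
      unfolding grevlex_less_def Let_def by linarith
    moreover obtain k where "k < length xs" "exponent s (xs ! k) < exponent t (xs ! k)"
      using g calculation by (auto simp: grevlex_less_def Let_def)
    moreover have "(\<Sum>x\<leftarrow>xs. exponent s x) < (\<Sum>x\<leftarrow>xs. exponent t x)"
      if "x \<in> set xs" "exponent s x < exponent t x" for x
    proof -
      obtain as bs where "xs = as @ x # bs" using \<open>x \<in> set xs\<close> by (meson split_list)
      then show ?thesis using that(2) le'[of as] le'[of bs] by simp
    qed
    ultimately show False by (metis nth_mem less_irrefl)
  qed
  then show ?thesis by (simp add: mon_less_def)
qed

lemma max_mon_eq:
  assumes "t \<in> T" "\<And>s. s \<in> T \<Longrightarrow> s \<noteq> t \<Longrightarrow> lt s t" "\<And>s t. lt s t \<Longrightarrow> \<not> lt t s"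
  shows "max_mon lt T = t"
  unfolding max_mon_def
proof (rule the_equality)
  show "t \<in> T \<and> (\<forall>s\<in>T. s \<noteq> t \<longrightarrow> lt s t)" using assms(1,2) by simp
  fix t' assume t': "t' \<in> T \<and> (\<forall>s\<in>T. s \<noteq> t' \<longrightarrow> lt s t')"
  show "t' = t"
  proof (rule ccontr)
    assume "t' \<noteq> t"
    then have "lt t' t" "lt t t'" using assms(1,2) t' by auto
    then show False using assms(3) by simp
  qed
qed

lemma max_mon_props:
  assumes "finite T" "T \<noteq> {}" "T \<subseteq> ring_mons {1..m}"
  shows "max_mon (mon_less m) T \<in> T" "\<And>s. s \<in> T \<Longrightarrow> s \<noteq> max_mon (mon_less m) T \<Longrightarrow> mon_less m s (max_mon (mon_less m) T)"
proof -
  have "\<exists>t\<in>T. \<forall>s\<in>T. s \<noteq> t \<longrightarrow> mon_less m s t" using assms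
  proof (induction T rule: finite_ne_induct)
    case (singleton x)
    then show ?case by simp
  next
    case (insert x F)
    then obtain t where t: "t \<in> F" "\<And>s. s \<in> F \<Longrightarrow> s \<noteq> t \<Longrightarrow> mon_less m s t" by auto
    have "mon_less m x t \<or> mon_less m t x"
      using insert t(1) by (intro mon_less_total) auto
    then show ?case
    proof
      assume "mon_less m x t"
      then show ?thesis using t by auto
    next
      assume "mon_less m t x"
      then have "mon_less m s x" if "s \<in> F" for s using t(2)[OF that] mon_less_trans by (cases "s = t") auto
      then show ?thesis by auto
    qed
  qed
  then obtain t where t: "t \<in> T" "\<And>s. s \<in> T \<Longrightarrow> s \<noteq> t \<Longrightarrow> mon_less m s t" by blast
  then have "max_mon (mon_less m) T = t" using mon_less_asym by (intro max_mon_eq) auto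
  then show "max_mon (mon_less m) T \<in> T" "\<And>s. s \<in> T \<Longrightarrow> s \<noteq> max_mon (mon_less m) T \<Longrightarrow> mon_less m s (max_mon (mon_less m) T)"
    using t by auto
qed

lemma lead_mon_props:
  assumes "p \<in> poly_ring {1..m}" "p \<noteq> 0"
  shows "lead_mon (mon_less m) p \<in> keys p"
    and "\<And>s. s \<in> keys p \<Longrightarrow> s \<noteq> lead_mon (mon_less m) p \<Longrightarrow> mon_less m s (lead_mon (mon_less m) p)"
  using max_mon_props[of "keys p" m] assms by (auto simp: lead_mon_def poly_ring_iff)

section \<open>Specialisation along lines\<close>

definition specialise_mon :: "(var \<Rightarrow> complex poly) \<Rightarrow> mon \<Rightarrow> complex poly" where
  "specialise_mon \<theta> t = (\<Prod>x\<in>keys t. \<theta> x ^ exponent t x)"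

text \<open>
  Values in \<open>complex poly\<close> allow one-parameter families; constants in it serve as single points.
\<close>

definition specialise :: "(var \<Rightarrow> complex poly) \<Rightarrow> mpol \<Rightarrow> complex poly" where
  "specialise \<theta> p = (\<Sum>t\<in>keys p. smult (lookup p t) (specialise_mon \<theta> t))"

lemma specialise_mon_superset:
  assumes "finite S" "keys t \<subseteq> S"
  shows "specialise_mon \<theta> t = (\<Prod>x\<in>S. \<theta> x ^ exponent t x)"
  unfolding specialise_mon_def using assms by (intro prod.mono_neutral_left) (auto simp: in_keys_iff)

lemma specialise_mon_add: "specialise_mon \<theta> (s + t) = specialise_mon \<theta> s * specialise_mon \<theta> t"
proof -
  let ?S = "keys s \<union> keys t"
  have "specialise_mon \<theta> (s + t) = (\<Prod>x\<in>?S. \<theta> x ^ exponent (s + t) x)"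
    using keys_add[of s t] by (intro specialise_mon_superset) auto
  then show ?thesis
    using specialise_mon_superset[of ?S s] specialise_mon_superset[of ?S t]
    by (simp add: lookup_add power_add prod.distrib)
qed

lemma specialise_superset:
  assumes "finite S" "keys p \<subseteq> S"
  shows "specialise \<theta> p = (\<Sum>t\<in>S. smult (lookup p t) (specialise_mon \<theta> t))"
  unfolding specialise_def using assms by (intro sum.mono_neutral_left) (auto simp: in_keys_iff)

lemma specialise_add: "specialise \<theta> (p + q) = specialise \<theta> p + specialise \<theta> q"
proof -
  let ?S = "keys p \<union> keys q"
  have "specialise \<theta> (p + q) = (\<Sum>t\<in>?S. smult (lookup (p + q) t) (specialise_mon \<theta> t))"
    using keys_add[of p q] by (intro specialise_superset) auto
  then show ?thesis
    using specialise_superset[of ?S p] specialise_superset[of ?S q]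
    by (simp add: lookup_add smult_add_left sum.distrib)
qed

lemma specialise_zero: "specialise \<theta> 0 = 0"
  by (simp add: specialise_def)

lemma specialise_sum: "specialise \<theta> (\<Sum>i\<in>A. f i) = (\<Sum>i\<in>A. specialise \<theta> (f i))"
  by (induction A rule: infinite_finite_induct) (auto simp: specialise_zero specialise_add)

lemma specialise_single: "specialise \<theta> (single t c) = smult c (specialise_mon \<theta> t)"
  by (simp add: specialise_def)

lemma sum_of_terms: "p = (\<Sum>t\<in>keys p. single t (lookup p t))"
  by (rule poly_mapping_eqI) (auto simp: lookup_sum lookup_single when_def in_keys_iff)

lemma specialise_mult: "specialise \<theta> (p * q) = specialise \<theta> p * specialise \<theta> q"
proof -
  let ?m = "\<lambda>p t. single t (lookup p t)"
  have "specialise \<theta> (p * q) = specialise \<theta> ((\<Sum>s\<in>keys p. ?m p s) * (\<Sum>t\<in>keys q. ?m q t))"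
    by (simp flip: sum_of_terms)
  also have "\<dots> = (\<Sum>s\<in>keys p. \<Sum>t\<in>keys q. specialise \<theta> (?m p s) * specialise \<theta> (?m q t))"
    unfolding sum_product specialise_sum by (simp add: mult_single specialise_single specialise_mon_add mult.commute)
  also have "\<dots> = specialise \<theta> (\<Sum>s\<in>keys p. ?m p s) * specialise \<theta> (\<Sum>t\<in>keys q. ?m q t)"
    unfolding sum_product specialise_sum ..
  finally show ?thesis by (simp flip: sum_of_terms)
qed

lemma specialise_mon_zero: "specialise_mon \<theta> 0 = 1"
  by (simp add: specialise_mon_def)

lemma specialise_one: "specialise \<theta> 1 = 1"
  using specialise_single[of \<theta> 0 1] by (simp add: specialise_mon_zero)

lemma specialise_uminus: "specialise \<theta> (- p) = - specialise \<theta> p"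
  using specialise_add[of \<theta> p "- p"] by (simp add: specialise_zero add_eq_0_iff)

lemma specialise_minus: "specialise \<theta> (p - q) = specialise \<theta> p - specialise \<theta> q"
  using specialise_add[of \<theta> p "- q"] by (simp add: specialise_uminus)

lemma specialise_mon_var: "specialise_mon \<theta> (single x 1) = \<theta> x"
  unfolding specialise_mon_def by simp

lemma specialise_Var: "specialise \<theta> (Var x) = \<theta> x"
  unfolding Var_def specialise_single specialise_mon_var by simp

lemmas specialise_simps = specialise_add specialise_zero specialise_mult specialise_one specialise_uminus specialise_minus specialise_Var specialise_sum

text \<open>
  The image of a line, up to the choice of coordinates on its pencil of planes: the
  backprojected plane of camera \<open>j\<close> is \<open>L j\<close> times \<open>(1, c (W j - a), d (W j - b), W j)\<close>.
\<close>

definition line_image :: "(nat \<Rightarrow> complex poly) \<Rightarrow> complex poly \<Rightarrow> complex poly \<Rightarrow> (nat \<Rightarrow> complex poly) \<Rightarrow>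
    complex poly \<Rightarrow> complex poly \<Rightarrow> var \<Rightarrow> complex poly" where
  "line_image L c d W a b x = (case x of
      Ell i j \<Rightarrow> (if i = 1 then L j else if i = 2 then L j * c * (W j - a)
                  else if i = 3 then L j * d * (W j - b) else 0)
    | V j \<Rightarrow> W j)"

lemma line_image_simps [simp]:
  "line_image L c d W a b (Ell (Suc 0) j) = L j"
  "line_image L c d W a b (Ell 1 j) = L j"
  "line_image L c d W a b (Ell 2 j) = L j * c * (W j - a)"
  "line_image L c d W a b (Ell 3 j) = L j * d * (W j - b)"
  "line_image L c d W a b (V j) = W j"
  by (auto simp: line_image_def)

definition vanishing_on_lines :: "mpol set" where
  "vanishing_on_lines = {f. \<forall>L c d W a b. specialise (line_image L c d W a b) f = 0}"

lemma power_class_sum: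
  fixes h :: "'a \<Rightarrow> complex"
  assumes "finite F" "infinite C" "\<And>c. c \<in> C \<Longrightarrow> (\<Sum>t\<in>F. h t * c ^ e t) = 0"
  shows "(\<Sum>t\<in>{t\<in>F. e t = k}. h t) = 0"
proof -
  define P where "P = (\<Sum>t\<in>F. monom (h t) (e t))"
  have "C \<subseteq> {c. poly P c = 0}" using assms(3) by (auto simp: P_def poly_sum poly_monom)
  then have "P = 0" using assms(2) poly_roots_finite[of P] finite_subset by blast
  then have "coeff P k = 0" by simp
  moreover have "coeff P k = (\<Sum>t\<in>F. if e t = k then h t else 0)" by (simp add: P_def coeff_sum)
  moreover have "\<dots> = (\<Sum>t\<in>{t\<in>F. e t = k}. h t)" using assms(1) by (simp add: sum.inter_filter)
  ultimately show ?thesis by simp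
qed

lemma prod_ring_vars:
  assumes "t \<in> ring_mons {1..m}"
  shows "specialise_mon \<theta> t = (\<Prod>j\<le>m. \<theta> (Ell 1 j) ^ exponent t (Ell 1 j) * \<theta> (Ell 2 j) ^ exponent t (Ell 2 j) *
     \<theta> (Ell 3 j) ^ exponent t (Ell 3 j) * \<theta> (V j) ^ exponent t (V j))"
proof -
  let ?S = "Ell 1 ` {..m} \<union> Ell 2 ` {..m} \<union> Ell 3 ` {..m} \<union> V ` {..m}"
  have "keys t \<subseteq> ?S" using assms by (auto simp: ring_mons_def set_ell_vars set_v_vars)
  then have "specialise_mon \<theta> t = (\<Prod>x\<in>?S. \<theta> x ^ exponent t x)" by (intro specialise_mon_superset) auto
  also have "\<dots> = (\<Prod>j\<le>m. \<theta> (Ell 1 j) ^ exponent t (Ell 1 j)) * (\<Prod>j\<le>m. \<theta> (Ell 2 j) ^ exponent t (Ell 2 j)) *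
     (\<Prod>j\<le>m. \<theta> (Ell 3 j) ^ exponent t (Ell 3 j)) * (\<Prod>j\<le>m. \<theta> (V j) ^ exponent t (V j))"
    by (subst prod.union_disjoint, simp, simp, force)+ (simp add: prod.reindex inj_on_def)
  finally show ?thesis by (simp add: prod.distrib)
qed

lemma ring_mons_outside:
  assumes "t \<in> ring_mons {1..m}" "j = 0 \<or> j > m"
  shows "exponent t (Ell i j) = 0" "exponent t (V j) = 0"
  using assms by (auto simp: ring_mons_def set_ell_vars set_v_vars in_keys_iff subset_iff)

section \<open>Leading monomials of polynomials vanishing on lines\<close>

text \<open>
  The image of a monomial under \<open>line_image\<close> with \<open>L\<close>, \<open>c\<close> and \<open>d\<close> set to 1.
\<close>

definition line_value :: "(nat \<Rightarrow> complex poly) \<Rightarrow> complex poly \<Rightarrow> complex poly \<Rightarrow> nat \<Rightarrow> mon \<Rightarrow> complex poly" where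
  "line_value W a b m t = (\<Prod>j\<le>m. (W j - a) ^ exponent t (Ell 2 j) * (W j - b) ^ exponent t (Ell 3 j) *
      W j ^ exponent t (V j))"

text \<open>
  The degree in camera \<open>p\<close> for \<open>p \<le> m\<close>, and then the number of \<open>y\<close>'s and the number of \<open>z\<close>'s.
  Indexing them by one number makes them the digits of an exponent.
\<close>

definition multidegree :: "nat \<Rightarrow> mon \<Rightarrow> nat \<Rightarrow> nat" where
  "multidegree m t p = (if p \<le> m then exponent t (Ell 1 p) + exponent t (Ell 2 p) + exponent t (Ell 3 p)
     else if p = m + 1 then (\<Sum>j\<le>m. exponent t (Ell 2 j)) else (\<Sum>j\<le>m. exponent t (Ell 3 j)))"

lemma specialise_mon_scaled:
  fixes c :: "complex poly"
  assumes t: "t \<in> ring_mons {1..m}"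
  shows "specialise_mon (line_image (\<lambda>j. c ^ (K ^ j)) (c ^ (K ^ (m + 1))) (c ^ (K ^ (m + 2))) W a b) t
    = c ^ (\<Sum>p<m + 3. K ^ p * multidegree m t p) * line_value W a b m t"
proof -
  have "{..<m + 3} = insert (m + 2) (insert (m + 1) {..m})" by auto
  then have enc: "(\<Sum>p<m + 3. K ^ p * multidegree m t p) =
      (\<Sum>j\<le>m. K ^ j * (exponent t (Ell 1 j) + exponent t (Ell 2 j) + exponent t (Ell 3 j)))
      + (\<Sum>j\<le>m. K ^ (m + 1) * exponent t (Ell 2 j)) + (\<Sum>j\<le>m. K ^ (m + 2) * exponent t (Ell 3 j))"
    by (simp add: multidegree_def sum_distrib_left)
  show ?thesis
    unfolding enc power_add power_sum line_value_def prod.distrib[symmetric] prod_ring_vars[OF t] line_image_simps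
    by (intro prod.cong refl)
       (simp add: power_mult_distrib power_mult[symmetric] power_add distrib_left mult_ac)
qed

text \<open>
  Choosing all \<open>L j\<close> and the factors of \<open>y\<close> and \<open>z\<close> as powers \<open>c ^ (K ^ p)\<close> of one number \<open>c\<close>
  multiplies the image of a monomial by \<open>c\<close> to its multidegree read in base \<open>K\<close>. For large \<open>K\<close>
  different multidegrees give different powers of \<open>c\<close>, and since \<open>c\<close> is arbitrary each component
  vanishes separately.
\<close>

lemma multidegree_component_vanishes:
  assumes "f \<in> vanishing_on_lines" "f \<in> poly_ring {1..m}"
    and same: "\<And>t. t \<in> F \<longleftrightarrow> t \<in> keys f \<and> (\<forall>p<m + 3. multidegree m t p = multidegree m T p)"
    and T: "T \<in> keys f"
  shows "(\<Sum>t\<in>F. smult (lookup f t) (line_value W a b m t)) = 0"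
proof -
  let ?X = "keys f"
  have X: "?X \<subseteq> ring_mons {1..m}" using assms(2) by (simp add: poly_ring_iff)
  define K where "K = Suc (\<Sum>t\<in>?X. \<Sum>p<m + 3. multidegree m t p)"
  have Kbound: "multidegree m t p < K" if "t \<in> ?X" "p < m + 3" for t p
  proof -
    have "multidegree m t p \<le> (\<Sum>p<m + 3. multidegree m t p)" using that by (intro member_le_sum) auto
    also have "\<dots> \<le> (\<Sum>t\<in>?X. \<Sum>p<m + 3. multidegree m t p)"
      using that by (intro member_le_sum[where f = "\<lambda>t. \<Sum>p<m + 3. multidegree m t p"]) auto
    finally show ?thesis by (simp add: K_def)
  qed
  define e where "e t = (\<Sum>p<m + 3. K ^ p * multidegree m t p)" for t
  have F: "F = {t \<in> ?X. e t = e T}"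
  proof (rule Set.set_eqI)
    fix t
    have "(\<forall>p<m + 3. multidegree m t p = multidegree m T p) \<longleftrightarrow> e t = e T" if "t \<in> ?X"
    proof
      assume "\<forall>p<m + 3. multidegree m t p = multidegree m T p"
      then show "e t = e T" unfolding e_def by (intro sum.cong) simp_all
    next
      assume "e t = e T"
      then show "\<forall>p<m + 3. multidegree m t p = multidegree m T p"
        unfolding e_def
        using digits_unique[of K "multidegree m t" "m + 3" "multidegree m T"] Kbound[OF that] Kbound[OF T] by blast
    qed
    then show "t \<in> F \<longleftrightarrow> t \<in> {t \<in> ?X. e t = e T}" unfolding same by blast
  qed
  show ?thesis
  proof (rule poly_eqI)
    fix r
    have "(\<Sum>t\<in>{t \<in> ?X. e t = e T}. lookup f t * coeff (line_value W a b m t) r) = 0"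
    proof (rule power_class_sum[of ?X UNIV])
      fix c :: complex
      have "0 = specialise (line_image (\<lambda>j. [:c:] ^ (K ^ j)) ([:c:] ^ (K ^ (m + 1))) ([:c:] ^ (K ^ (m + 2))) W a b) f"
        using assms(1) by (simp add: vanishing_on_lines_def)
      also have "\<dots> = (\<Sum>t\<in>?X. smult (lookup f t) ([:c:] ^ e t * line_value W a b m t))"
        unfolding specialise_def using X by (intro sum.cong refl) (subst specialise_mon_scaled, auto simp: e_def)
      finally have "coeff (\<Sum>t\<in>?X. smult (lookup f t) ([:c:] ^ e t * line_value W a b m t)) r = 0"
        by simp
      then show "(\<Sum>t\<in>?X. lookup f t * coeff (line_value W a b m t) r * c ^ e t) = 0"
        by (simp add: coeff_sum poly_const_pow mult_ac)
    qed (auto simp: infinite_UNIV_char_0)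
    then show "coeff (\<Sum>t\<in>F. smult (lookup f t) (line_value W a b m t)) r = coeff 0 r"
      by (simp add: F coeff_sum)
  qed
qed

text \<open>
  A first difference at \<open>ell 1 k\<close> is impossible: the exponents of \<open>ell 2 k\<close> and \<open>ell 3 k\<close> would
  agree, and then so would that of \<open>ell 1 k\<close> by the degree in camera \<open>k\<close>.
\<close>

lemma mon_less_same_multidegree:
  assumes "mon_less m s t" "s \<in> ring_mons {1..m}" "t \<in> ring_mons {1..m}"
    and "\<forall>p<m + 3. multidegree m s p = multidegree m t p"
  shows "(\<exists>k. exponent t (Ell 3 k) < exponent s (Ell 3 k) \<and> (\<forall>l>k. exponent s (Ell 3 l) = exponent t (Ell 3 l))) \<or>
     (\<forall>l. exponent s (Ell 3 l) = exponent t (Ell 3 l)) \<and>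
       (\<exists>k. exponent t (Ell 2 k) < exponent s (Ell 2 k) \<and> (\<forall>l>k. exponent s (Ell 2 l) = exponent t (Ell 2 l))) \<or>
     (\<forall>i\<in>{1,2,3}. \<forall>l. exponent s (Ell i l) = exponent t (Ell i l)) \<and> grevlex_less (v_vars {1..m}) s t"
proof -
  have deg: "exponent s (Ell 1 p) + exponent s (Ell 2 p) + exponent s (Ell 3 p) =
      exponent t (Ell 1 p) + exponent t (Ell 2 p) + exponent t (Ell 3 p)" for p
  proof (cases "p \<le> m")
    case True
    then show ?thesis using assms(4)[rule_format, of p] by (simp add: multidegree_def)
  next
    case False
    then show ?thesis using ring_mons_outside[OF assms(2), of p] ring_mons_outside[OF assms(3), of p] by simp
  qed
  then have "ell_degree m s = ell_degree m t" by (simp add: ell_degree_def)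
  have out: "exponent s (Ell i l) = exponent t (Ell i l)" if "l \<notin> {1..m}" for i l
    using ring_mons_outside[OF assms(2), of l] ring_mons_outside[OF assms(3), of l] that by auto
  consider "revlex_less (set (ell_vars {1..m})) (exponent s) (exponent t)"
    | "\<forall>x\<in>set (ell_vars {1..m}). exponent s x = exponent t x" "grevlex_less (v_vars {1..m}) s t"
    using assms(1) \<open>ell_degree m s = _\<close> unfolding mon_less_def grevlex_ell by auto
  then show ?thesis
  proof cases
    case 1
    then obtain y where y: "y \<in> set (ell_vars {1..m})" "exponent t y < exponent s y"
      "\<And>w. w \<in> set (ell_vars {1..m}) \<Longrightarrow> earlier y w \<Longrightarrow> exponent s w = exponent t w"
      unfolding revlex_less_def by blast
    obtain i k where yik: "y = Ell i k" and ik': "i \<in> {1,2,3}" "k \<in> {1..m}"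
      using y(1) unfolding set_ell_vars[OF finite_atLeastAtMost] by blast
    note ik = ik' y(2)[unfolded yik]
    have above: "exponent s (Ell i' l) = exponent t (Ell i' l)"
      if "i' \<in> {1,2,3}" "l \<in> {1..m}" "earlier (Ell i k) (Ell i' l)" for i' l
      using that y(3)[of "Ell i' l"] unfolding set_ell_vars[OF finite_atLeastAtMost] yik by blast
    have above': "exponent s (Ell i' l) = exponent t (Ell i' l)"
      if "i' \<in> {1,2,3}" "earlier (Ell i k) (Ell i' l)" for i' l
      using that above out[of l i'] by (cases "l \<in> {1..m}") auto
    consider "i = 1" | "i = 2" | "i = 3" using ik by auto
    then show ?thesis
    proof cases
      case 1
      then show ?thesis using deg[of k] ik(3) above'[of 2 k] above'[of 3 k] by simp
    next
      case 2
      then show ?thesis using ik(3) above' by (intro disjI2 disjI1) auto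
    next
      case 3
      then show ?thesis using ik(3) above' by (intro disjI1) auto
    qed
  next
    case 2
    then have "exponent s (Ell i l) = exponent t (Ell i l)" if "i \<in> {1,2,3}" for i l
      using that out[of l i] by (cases "l \<in> {1..m}") (auto simp: set_ell_vars)
    then show ?thesis using 2 by blast
  qed
qed

lemma coeff_monom_times:
  "coeff (monom (1::complex) n * p) e = (if n \<le> e then coeff p (e - n) else 0)"
  by (auto simp: coeff_monom_mult)

text \<open>
  \<open>F\<close> collects the monomials of \<open>f\<close> with the multidegree of \<open>T\<close>, and \<open>F'\<close> those that also have
  the line part of \<open>T\<close>. In the degeneration the monomials of \<open>F - F'\<close> have larger order, so the
  lowest coefficient only involves \<open>F'\<close>, where it is the specialisation of the coefficient of
  the line part of \<open>T\<close> to the cluster points \<open>q (\<pi> j) = c ^ (B ^ \<pi> j)\<close>. With these points a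
  \<open>v\<close>-monomial becomes \<open>c\<close> to a number from which the exponents of the identified variables can
  be recovered.
\<close>

lemma lead_mon_not_standard:
  assumes f: "f \<in> vanishing_on_lines" "f \<in> poly_ring {1..m}" "f \<noteq> 0"
    and T: "T = lead_mon (mon_less m) f"
  shows "\<not> standard_exponents (\<lambda>i. exponent T (Ell 1 i)) (\<lambda>i. exponent T (Ell 2 i))
     (\<lambda>i. exponent T (Ell 3 i)) (\<lambda>i. exponent T (V i)) (Suc m)"
proof
  let ?X = "keys f"
  define x where "x t i = exponent t (Ell 1 i)" for t i
  define y where "y t i = exponent t (Ell 2 i)" for t i
  define z where "z t i = exponent t (Ell 3 i)" for t i
  define u where "u t i = exponent t (V i)" for t i
  assume "standard_exponents (\<lambda>i. exponent T (Ell 1 i)) (\<lambda>i. exponent T (Ell 2 i))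
     (\<lambda>i. exponent T (Ell 3 i)) (\<lambda>i. exponent T (V i)) (Suc m)"
  then interpret standard_exponents "x T" "y T" "z T" "u T" "Suc m"
    by (simp add: x_def[abs_def] y_def[abs_def] z_def[abs_def] u_def[abs_def])
  have X: "?X \<subseteq> ring_mons {1..m}" using f(2) by (simp add: poly_ring_iff)
  have outE: "exponent t (Ell c i) = 0" and outV: "exponent t (V i) = 0"
    if "t \<in> ?X" "i = 0 \<or> i > m" for t c i
    using ring_mons_outside[of t m i] that X by auto
  have TX: "T \<in> ?X" and Tmax: "\<And>s. s \<in> ?X \<Longrightarrow> s \<noteq> T \<Longrightarrow> mon_less m s T"
    using lead_mon_props[OF f(2,3)] by (simp_all add: T)
  obtain \<pi> where \<pi>: "degeneration \<pi>" using exists_degeneration by blast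
  have \<pi>1: "i \<le> \<pi> i" "\<pi> (\<pi> i) = \<pi> i" "u T i > 0 \<Longrightarrow> \<pi> i = i" for i
    using \<pi> by (auto simp: degeneration_def)
  define F where "F = {t \<in> ?X. \<forall>p<m + 3. multidegree m t p = multidegree m T p}"
  define F' where "F' = {t \<in> F. \<forall>i\<in>{1,2,3}. \<forall>l. exponent t (Ell i l) = exponent T (Ell i l)}"
  have finF: "finite F" by (simp add: F_def)
  have TF: "T \<in> F'" using TX by (simp add: F_def F'_def)
  have lower: "lower (x t) (y t) (z t)" if "t \<in> F" "t \<notin> F'" for t
  proof -
    have t: "t \<in> ?X" "t \<noteq> T" and md: "\<forall>p<m + 3. multidegree m t p = multidegree m T p"
      using that TF by (auto simp: F_def)
    have sums: "(\<Sum>i<Suc m. y t i) = (\<Sum>i<Suc m. y T i)" "(\<Sum>i<Suc m. z t i) = (\<Sum>i<Suc m. z T i)"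
      using md[rule_format, of "m + 1"] md[rule_format, of "m + 2"]
      unfolding lessThan_Suc_atMost by (simp_all add: multidegree_def y_def z_def)
    have "x t i + y t i + z t i = x T i + y T i + z T i" for i
    proof (cases "i \<le> m")
      case True
      then show ?thesis using md[rule_format, of i] by (simp add: multidegree_def x_def y_def z_def)
    next
      case False
      then show ?thesis using outE[OF t(1)] outE[OF TX] by (simp add: x_def y_def z_def)
    qed
    then show ?thesis
      using mon_less_same_multidegree[OF Tmax[OF t] _ _ md] X t(1) TX that sums
      unfolding lower_def F'_def x_def y_def z_def by blast
  qed
  define B where "B = (\<Sum>t\<in>?X. \<Sum>j\<le>m. u t j) + 2"
  define L where "L = Suc (\<Sum>j\<le>m. \<pi> j)"
  have \<pi>L: "\<pi> j < L" if "j \<le> m" for j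
    using that member_le_sum[of j "{..m}" \<pi>] by (simp add: L_def)
  define \<nu> where "\<nu> t p = (\<Sum>j\<in>{j\<in>{..m}. \<pi> j = p}. u t j)" for t p
  have \<nu>bound: "\<nu> t p < B" if "t \<in> ?X" for t p
  proof -
    have "\<nu> t p \<le> (\<Sum>j\<le>m. u t j)" unfolding \<nu>_def by (intro sum_mono2) auto
    also have "\<dots> \<le> (\<Sum>t\<in>?X. \<Sum>j\<le>m. u t j)"
      using that by (intro member_le_sum[where f = "\<lambda>t. \<Sum>j\<le>m. u t j"]) auto
    finally show ?thesis by (simp add: B_def)
  qed
  define e where "e t = (\<Sum>j\<le>m. B ^ \<pi> j * u t j)" for t
  have e: "e t = (\<Sum>p<L. B ^ p * \<nu> t p)" for t
  proof -
    have "e t = (\<Sum>p<L. \<Sum>j\<in>{j\<in>{..m}. \<pi> j = p}. B ^ \<pi> j * u t j)"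
      unfolding e_def using \<pi>L by (intro sum.group[symmetric]) auto
    also have "\<dots> = (\<Sum>p<L. B ^ p * \<nu> t p)" by (simp add: \<nu>_def sum_distrib_left)
    finally show ?thesis .
  qed
  \<comment> \<open>If \<open>t\<close> is smaller than \<open>T\<close> with equal exponents after identification, consider the last camera
    \<open>k\<close> at which their \<open>v\<close>-exponents differ, where that of \<open>t\<close> is larger. At \<open>\<pi> k\<close> the exponents
    collected from \<open>t\<close> exceed those from \<open>T\<close>, to which only \<open>\<pi> k\<close> itself contributes.\<close>
  have e_inj: "t = T" if t: "t \<in> F'" "e t = e T" for t
  proof (rule ccontr)
    assume "t \<noteq> T"
    have tX: "t \<in> ?X" using t by (simp add: F_def F'_def)
    have \<nu>: "\<nu> t p = \<nu> T p" if "p < L" for p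
      using digits_unique[of B "\<nu> t" L "\<nu> T" p] \<nu>bound[OF tX] \<nu>bound[OF TX] t(2) that by (simp add: e)
    have deg: "v_degree m t' = (\<Sum>p<L. \<nu> t' p)" if "t' \<in> ?X" for t'
    proof -
      have "v_degree m t' = (\<Sum>j\<le>m. u t' j)"
      proof -
        have "{..m} = insert 0 {1..m}" by auto
        then show ?thesis by (simp add: v_degree_def u_def outV[OF that])
      qed
      also have "\<dots> = (\<Sum>p<L. \<nu> t' p)"
        unfolding \<nu>_def using \<pi>L by (intro sum.group[symmetric]) auto
      finally show ?thesis .
    qed
    have "v_degree m t = v_degree m T" using deg tX TX \<nu> by simp
    moreover have "grevlex_less (v_vars {1..m}) t T"
    proof -
      have md: "\<forall>p<m + 3. multidegree m t p = multidegree m T p"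
        and eq: "exponent t (Ell 2 l) = exponent T (Ell 2 l)" "exponent t (Ell 3 l) = exponent T (Ell 3 l)" for l
        using t(1) by (simp_all add: F_def F'_def)
      from mon_less_same_multidegree[OF Tmax[OF tX \<open>t \<noteq> T\<close>] _ _ md] show ?thesis
        using X tX TX unfolding eq by blast
    qed
    ultimately have "revlex_less (set (v_vars {1..m})) (exponent t) (exponent T)"
      unfolding grevlex_v by simp
    then obtain k where k: "k \<in> {1..m}" "u T k < u t k" "\<And>l. l \<in> {1..m} \<Longrightarrow> k < l \<Longrightarrow> u t l = u T l"
      unfolding revlex_less_def set_v_vars[OF finite_atLeastAtMost] u_def by fastforce
    have kL: "\<pi> k < L" using k(1) \<pi>L by simp
    have out: "u t l = u T l" if "l > k" for l
      using k(1) k(3)[of l] that outV[OF tX, of l] outV[OF TX, of l]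
      by (cases "l \<le> m") (auto simp: u_def)
    have "\<nu> T (\<pi> k) \<le> u T (\<pi> k)"
    proof -
      have "\<nu> T (\<pi> k) = (\<Sum>j\<in>{j\<in>{..m}. \<pi> j = \<pi> k}. if j = \<pi> k then u T j else 0)"
        unfolding \<nu>_def using \<pi>1(3) by (intro sum.cong) force+
      also have "\<dots> \<le> u T (\<pi> k)" by (simp add: sum.delta)
      finally show ?thesis .
    qed
    moreover have "u T (\<pi> k) < \<nu> t (\<pi> k)"
    proof (cases "\<pi> k = k")
      case True
      have "u t k \<le> \<nu> t k"
        unfolding \<nu>_def using True k(1) by (intro member_le_sum) auto
      then show ?thesis using True k(2) by simp
    next
      case False
      then have "k < \<pi> k" using \<pi>1(1)[of k] by simp
      show ?thesis
      proof (cases "\<pi> k \<le> m")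
        case True
        have "(\<Sum>j\<in>{k, \<pi> k}. u t j) \<le> \<nu> t (\<pi> k)"
          unfolding \<nu>_def using True k(1) \<pi>1(2) by (intro sum_mono2) auto
        then show ?thesis using False k(2) out[OF \<open>k < \<pi> k\<close>] by simp
      next
        case False
        then have "u T (\<pi> k) = 0" using outV[OF TX, of "\<pi> k"] by (simp add: u_def)
        moreover have "u t k \<le> \<nu> t (\<pi> k)"
          unfolding \<nu>_def using k(1) by (intro member_le_sum) auto
        ultimately show ?thesis using k(2) by simp
      qed
    qed
    ultimately show False using \<nu>[OF kL] by simp
  qed
  \<comment> \<open>The lowest coefficient is a polynomial in \<open>c\<close> that vanishes for all \<open>c \<ge> 2\<close>, hence so does each
    of its coefficients; by injectivity the one at \<open>c ^ e T\<close> is the coefficient of \<open>T\<close> alone.\<close>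
  have "(\<Sum>t\<in>{t \<in> F'. e t = e T}. lookup f t) = 0"
  proof (rule power_class_sum[of F' "of_nat ` {2..}"])
    show "finite F'" using finF by (simp add: F'_def)
    show "infinite (of_nat ` {2::nat..} :: complex set)"
      by (simp add: finite_image_iff inj_on_def infinite_Ici)
  next
    fix c :: complex assume "c \<in> of_nat ` {2..}"
    then obtain c' :: nat where c: "c = of_nat c'" "c' \<ge> 2" by auto
    define q where "q i = c ^ (B ^ i)" for i :: nat
    have "inj q"
    proof (rule injI)
      fix i j assume "q i = q j"
      then have "(of_nat (c' ^ (B ^ i)) :: complex) = of_nat (c' ^ (B ^ j))" by (simp add: q_def c)
      then have "c' ^ (B ^ i) = c' ^ (B ^ j)" by (simp only: of_nat_eq_iff)
      then have "B ^ i = B ^ j" using c(2) by (simp add: power_inject_exp)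
      then show "i = j" by (simp add: B_def power_inject_exp)
    qed
    with \<pi> have "\<exists>W a b oa ob. separated_by oa ob \<and> (\<forall>i<Suc m. poly (W i) 0 = q (\<pi> i) \<and>
        (\<exists>U. poly U 0 \<noteq> 0 \<and> W i - a = monom 1 (oa i) * U) \<and>
        (\<exists>U. poly U 0 \<noteq> 0 \<and> W i - b = monom 1 (ob i) * U))"
      unfolding degeneration_def by simp
    then obtain W a b oa ob where sep: "separated_by oa ob"
      and W: "\<forall>i<Suc m. poly (W i) 0 = q (\<pi> i) \<and>
        (\<exists>U. poly U 0 \<noteq> 0 \<and> W i - a = monom 1 (oa i) * U) \<and>
        (\<exists>U. poly U 0 \<noteq> 0 \<and> W i - b = monom 1 (ob i) * U)"
      by blast
    have W0: "poly (W i) 0 = q (\<pi> i)"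
      and A: "\<exists>U. poly U 0 \<noteq> 0 \<and> W i - a = monom 1 (oa i) * U"
      and B: "\<exists>U. poly U 0 \<noteq> 0 \<and> W i - b = monom 1 (ob i) * U" if "i < Suc m" for i
      using W that by auto
    obtain UA where UA: "\<And>i. i < Suc m \<Longrightarrow> poly (UA i) 0 \<noteq> 0 \<and> W i - a = monom 1 (oa i) * UA i"
      using A by metis
    obtain UB where UB: "\<And>i. i < Suc m \<Longrightarrow> poly (UB i) 0 \<noteq> 0 \<and> W i - b = monom 1 (ob i) * UB i"
      using B by metis
    define ord where "ord t = (\<Sum>i<Suc m. oa i * y t i + ob i * z t i)" for t
    define R where "R t = (\<Prod>j\<le>m. UA j ^ y t j * UB j ^ z t j * W j ^ u t j)" for t
    have val: "line_value W a b m t = monom 1 (ord t) * R t" for t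
    proof -
      have "line_value W a b m t = (\<Prod>j\<le>m. monom 1 (oa j * y t j + ob j * z t j) *
          (UA j ^ y t j * UB j ^ z t j * W j ^ u t j))"
        unfolding line_value_def
      proof (intro prod.cong refl)
        fix j assume "j \<in> {..m}"
        then have "W j - a = monom 1 (oa j) * UA j" "W j - b = monom 1 (ob j) * UB j"
          using UA[of j] UB[of j] by auto
        moreover have "monom 1 (p + q) = monom 1 p * monom (1::complex) q" for p q by (simp add: mult_monom)
        ultimately show "(W j - a) ^ exponent t (Ell 2 j) * (W j - b) ^ exponent t (Ell 3 j) * W j ^ exponent t (V j) =
           monom 1 (oa j * y t j + ob j * z t j) * (UA j ^ y t j * UB j ^ z t j * W j ^ u t j)"
          by (simp add: y_def z_def u_def power_mult_distrib monom_power mult_ac)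
      qed
      also have "\<dots> = monom 1 (ord t) * R t"
      proof -
        have "(\<Prod>j\<in>J. monom 1 (g j)) = monom (1::complex) (\<Sum>j\<in>J. g j)" if "finite J" for J :: "nat set" and g
          using that by (induction J) (auto simp: mult_monom)
        then show ?thesis unfolding prod.distrib R_def ord_def lessThan_Suc_atMost by simp
      qed
      finally show ?thesis .
    qed
    have ordF': "ord t = ord T" if "t \<in> F'" for t
      using that by (simp add: F'_def ord_def y_def z_def)
    have ord_less: "ord T < ord t" if "t \<in> F" "t \<notin> F'" for t
      using lower[OF that] sep by (simp add: separated_by_def ord_def)
    define C where "C = (\<Prod>j\<le>m. poly (UA j) 0 ^ y T j * poly (UB j) 0 ^ z T j)"
    have "C \<noteq> 0" unfolding C_def using UA UB by simp
    have R0: "poly (R t) 0 = C * c ^ e t" if "t \<in> F'" for t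
    proof -
      have "poly (R t) 0 = (\<Prod>j\<le>m. (poly (UA j) 0 ^ y T j * poly (UB j) 0 ^ z T j) * c ^ (B ^ \<pi> j * u t j))"
        unfolding R_def poly_prod using that W0
        by (intro prod.cong refl) (simp add: F'_def y_def z_def q_def power_mult)
      then show ?thesis by (simp add: prod.distrib C_def e_def power_sum)
    qed
    have "0 = coeff (\<Sum>t\<in>F. smult (lookup f t) (line_value W a b m t)) (ord T)"
      using multidegree_component_vanishes[OF f(1,2) _ TX, of F W a b] by (simp add: F_def)
    also have "\<dots> = (\<Sum>t\<in>F. lookup f t * (if t \<in> F' then C * c ^ e t else 0))"
      unfolding coeff_sum coeff_smult val coeff_monom_times
    proof (intro sum.cong refl arg_cong2[where f = "(*)"])
      fix t assume "t \<in> F"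
      then show "(if ord t \<le> ord T then coeff (R t) (ord T - ord t) else 0) = (if t \<in> F' then C * c ^ e t else 0)"
        using ordF'[of t] ord_less[of t] R0[of t] by (auto simp: poly_0_coeff_0)
    qed
    also have "\<dots> = (\<Sum>t\<in>F'. lookup f t * (C * c ^ e t))"
      using finF by (intro sum.mono_neutral_cong_right) (auto simp: F'_def)
    also have "\<dots> = C * (\<Sum>t\<in>F'. lookup f t * c ^ e t)"
      by (simp add: sum_distrib_left mult_ac)
    finally show "(\<Sum>t\<in>F'. lookup f t * c ^ e t) = 0" using \<open>C \<noteq> 0\<close> by simp
  qed
  moreover have "{t \<in> F'. e t = e T} = {T}" using e_inj TF by auto
  ultimately show False using TX by (simp add: in_keys_iff)
qed

section \<open>The generators\<close>

definition poly_of :: "(complex \<times> var list) list \<Rightarrow> mpol" where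
  "poly_of ts = (\<Sum>(c, w)\<leftarrow>ts. single (word_mon w) c)"

definition tmul :: "(complex \<times> var list) list \<Rightarrow> (complex \<times> var list) list \<Rightarrow> (complex \<times> var list) list"
  (infixl "\<star>" 70) where
  "ps \<star> qs = [(c * d, w @ w'). (c, w) \<leftarrow> ps, (d, w') \<leftarrow> qs]"

definition vdiff :: "nat \<Rightarrow> nat \<Rightarrow> (complex \<times> var list) list" where
  "vdiff a b = [(1, [V a]), (- 1, [V b])]"

datatype generator =
    Affine nat nat nat nat
  | Planar nat nat nat
  | Spatial nat nat nat
  | ZZYY nat nat nat nat
  | XZYY nat nat nat nat
  | ZXYY nat nat nat nat

text \<open>
  The generators as lists of coefficients and words, with the leading term first. In the
  notation \<open>x, y, z\<close> for the three line coordinates, \<open>Affine 2\<close> and \<open>Affine 3\<close> are the minors of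
  the backprojection matrix on the rows \<open>x, y, v x\<close> and \<open>x, z, v x\<close>; \<open>Planar\<close> is, up to sign,
  the one on \<open>x, y, z\<close>; and \<open>Spatial\<close> is the one on \<open>y, z, v x\<close>, reduced by \<open>Planar\<close>. \<open>ZZYY\<close> is
  \<open>- det Phi\<close>. \<open>XZYY\<close> and \<open>ZXYY\<close> are combinations of two \<open>Spatial\<close> generators on overlapping
  triples: \<open>XZYY\<close> eliminates the monomial \<open>z\<^sub>i x\<^sub>j y\<^sub>k y\<^sub>l\<close>, and \<open>ZXYY\<close> removes \<open>v\<^sub>j\<close> from its
  coefficient.
\<close>

fun terms :: "generator \<Rightarrow> (complex \<times> var list) list" where
  "terms (Affine c i j k) =
     vdiff j k \<star> [(1, [Ell c i, Ell 1 j, Ell 1 k])] @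
     vdiff k i \<star> [(1, [Ell 1 i, Ell c j, Ell 1 k])] @
     vdiff i j \<star> [(1, [Ell 1 i, Ell 1 j, Ell c k])]"
| "terms (Planar i j k) =
     [(1, [Ell 3 i, Ell 2 j, Ell 1 k]), (- 1, [Ell 2 i, Ell 3 j, Ell 1 k]),
      (- 1, [Ell 3 i, Ell 1 j, Ell 2 k]), (1, [Ell 2 i, Ell 1 j, Ell 3 k]),
      (- 1, [Ell 1 i, Ell 2 j, Ell 3 k]), (1, [Ell 1 i, Ell 3 j, Ell 2 k])]"
| "terms (Spatial i j k) =
     vdiff j k \<star> [(1, [Ell 3 i, Ell 1 j, Ell 2 k]), (- 1, [Ell 2 i, Ell 1 j, Ell 3 k])] @
     vdiff i k \<star> [(1, [Ell 1 i, Ell 2 j, Ell 3 k]), (- 1, [Ell 1 i, Ell 3 j, Ell 2 k])]"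
| "terms (ZZYY i j k l) =
     vdiff i j \<star> vdiff k l \<star> [(1, [Ell 3 i, Ell 3 j, Ell 2 k, Ell 2 l]), (1, [Ell 2 i, Ell 2 j, Ell 3 k, Ell 3 l])] @
     vdiff i k \<star> vdiff j l \<star> [(- 1, [Ell 3 i, Ell 2 j, Ell 3 k, Ell 2 l]), (- 1, [Ell 2 i, Ell 3 j, Ell 2 k, Ell 3 l])] @
     vdiff i l \<star> vdiff j k \<star> [(1, [Ell 3 i, Ell 2 j, Ell 2 k, Ell 3 l]), (1, [Ell 2 i, Ell 3 j, Ell 3 k, Ell 2 l])]"
| "terms (XZYY i j k l) =
     vdiff i j \<star> vdiff k l \<star> [(1, [Ell 1 i, Ell 3 j, Ell 2 k, Ell 2 l])] @
     vdiff j k \<star> vdiff j l \<star> [(1, [Ell 2 i, Ell 1 j, Ell 3 k, Ell 2 l]), (- 1, [Ell 2 i, Ell 1 j, Ell 2 k, Ell 3 l])] @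
     vdiff i k \<star> vdiff j l \<star> [(- 1, [Ell 1 i, Ell 2 j, Ell 3 k, Ell 2 l])] @
     vdiff i l \<star> vdiff j k \<star> [(1, [Ell 1 i, Ell 2 j, Ell 2 k, Ell 3 l])]"
| "terms (ZXYY i j k l) =
     vdiff k l \<star> [(1, [Ell 3 i, Ell 1 j, Ell 2 k, Ell 2 l]), (- 1, [Ell 1 i, Ell 3 j, Ell 2 k, Ell 2 l])] @
     vdiff j k \<star> [(1, [Ell 2 i, Ell 1 j, Ell 3 k, Ell 2 l])] @
     vdiff j l \<star> [(- 1, [Ell 2 i, Ell 1 j, Ell 2 k, Ell 3 l])] @
     vdiff i k \<star> [(- 1, [Ell 1 i, Ell 2 j, Ell 3 k, Ell 2 l])] @
     vdiff i l \<star> [(1, [Ell 1 i, Ell 2 j, Ell 2 k, Ell 3 l])]"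

definition gen_poly :: "generator \<Rightarrow> mpol" where "gen_poly g = poly_of (terms g)"

definition lead :: "generator \<Rightarrow> var list" where "lead g = snd (hd (terms g))"

fun over :: "nat set \<Rightarrow> generator \<Rightarrow> bool" where
  "over \<tau> (Affine c i j k) \<longleftrightarrow> c \<in> {2, 3} \<and> {i, j, k} \<subseteq> \<tau> \<and> i < j \<and> j < k"
| "over \<tau> (Planar i j k) \<longleftrightarrow> {i, j, k} \<subseteq> \<tau> \<and> i < j \<and> j < k"
| "over \<tau> (Spatial i j k) \<longleftrightarrow> {i, j, k} \<subseteq> \<tau> \<and> i < j \<and> j < k"
| "over \<tau> (ZZYY i j k l) \<longleftrightarrow> {i, j, k, l} \<subseteq> \<tau> \<and> i < j \<and> j < k \<and> k < l"
| "over \<tau> (XZYY i j k l) \<longleftrightarrow> {i, j, k, l} \<subseteq> \<tau> \<and> i < j \<and> j < k \<and> k < l"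
| "over \<tau> (ZXYY i j k l) \<longleftrightarrow> {i, j, k, l} \<subseteq> \<tau> \<and> i < j \<and> j < k \<and> k < l"

lemmas term_simps = tmul_def vdiff_def

lemma lead_simps [simp]:
  "lead (Affine c i j k) = [V j, Ell c i, Ell 1 j, Ell 1 k]"
  "lead (Planar i j k) = [Ell 3 i, Ell 2 j, Ell 1 k]"
  "lead (Spatial i j k) = [V j, Ell 3 i, Ell 1 j, Ell 2 k]"
  "lead (ZZYY i j k l) = [V i, V k, Ell 3 i, Ell 3 j, Ell 2 k, Ell 2 l]"
  "lead (XZYY i j k l) = [V i, V k, Ell 1 i, Ell 3 j, Ell 2 k, Ell 2 l]"
  "lead (ZXYY i j k l) = [V k, Ell 3 i, Ell 1 j, Ell 2 k, Ell 2 l]"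
  by (simp_all add: lead_def term_simps)

lemma terms_lead: "terms g = (1, lead g) # tl (terms g)"
  by (cases g) (simp_all add: term_simps)

subsection \<open>Comparison of words\<close>

fun is_ell :: "var \<Rightarrow> bool" where "is_ell (Ell i j) \<longleftrightarrow> True" | "is_ell (V j) \<longleftrightarrow> False"

definition ells :: "var list \<Rightarrow> var list" where "ells = filter is_ell"
definition vs :: "var list \<Rightarrow> var list" where "vs = filter (\<lambda>x. \<not> is_ell x)"

text \<open>
  A test for GRevLex on words of equal length without repetitions: a larger exponent at the last
  variable in which two words differ makes a monomial smaller.
\<close>

definition word_less :: "var list \<Rightarrow> var list \<Rightarrow> bool" where
  "word_less ws ts \<longleftrightarrow> length ws = length ts \<and> distinct ws \<and> distinct ts \<and>
     (\<exists>x\<in>set ws. x \<notin> set ts \<and> (\<forall>y\<in>set ws \<union> set ts. earlier x y \<longrightarrow> (y \<in> set ws \<longleftrightarrow> y \<in> set ts)))"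

lemma distinct_indices:
  "i < j \<Longrightarrow> i \<noteq> j" "i < j \<Longrightarrow> j \<noteq> i" "i < j \<Longrightarrow> \<not> j < i" for i j :: nat
  by auto

lemma tail_words_less:
  assumes "over \<tau> g"
  shows "list_all (\<lambda>(c, w). word_less (ells w) (ells (lead g)) \<or>
     ells w = ells (lead g) \<and> word_less (vs w) (vs (lead g))) (tl (terms g))"
proof (cases g)
  case (Affine c i j k)
  then have *: "i < j" "j < k" "i < k" "c = 2 \<or> c = 3" using assms by auto
  note n = *(1-3) *(1-3)[THEN distinct_indices(1)] *(1-3)[THEN distinct_indices(2)] *(1-3)[THEN distinct_indices(3)]
  show ?thesis using *(4) n
    by (elim disjE) (simp_all add: Affine n term_simps word_less_def ells_def vs_def del: set_filter)
next
  case (Planar i j k)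
  then have *: "i < j" "j < k" "i < k" using assms by auto
  note n = *(1-3) *(1-3)[THEN distinct_indices(1)] *(1-3)[THEN distinct_indices(2)] *(1-3)[THEN distinct_indices(3)]
  show ?thesis using n by (simp add: Planar n term_simps word_less_def ells_def vs_def del: set_filter)
next
  case (Spatial i j k)
  then have *: "i < j" "j < k" "i < k" using assms by auto
  note n = *(1-3) *(1-3)[THEN distinct_indices(1)] *(1-3)[THEN distinct_indices(2)] *(1-3)[THEN distinct_indices(3)]
  show ?thesis using n by (simp add: Spatial n term_simps word_less_def ells_def vs_def del: set_filter)
next
  case (ZZYY i j k l)
  then have *: "i < j" "j < k" "i < k" "k < l" "i < l" "j < l" using assms by auto
  note n = * *[THEN distinct_indices(1)] *[THEN distinct_indices(2)] *[THEN distinct_indices(3)]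
  show ?thesis using n by (simp add: ZZYY n term_simps word_less_def ells_def vs_def del: set_filter)
next
  case (XZYY i j k l)
  then have *: "i < j" "j < k" "i < k" "k < l" "i < l" "j < l" using assms by auto
  note n = * *[THEN distinct_indices(1)] *[THEN distinct_indices(2)] *[THEN distinct_indices(3)]
  show ?thesis using n by (simp add: XZYY n term_simps word_less_def ells_def vs_def del: set_filter)
next
  case (ZXYY i j k l)
  then have *: "i < j" "j < k" "i < k" "k < l" "i < l" "j < l" using assms by auto
  note n = * *[THEN distinct_indices(1)] *[THEN distinct_indices(2)] *[THEN distinct_indices(3)]
  show ?thesis using n by (simp add: ZXYY n term_simps word_less_def ells_def vs_def del: set_filter)
qed

text \<open>
  Either the line parts differ, or they agree and the \<open>v\<close>-parts decide.
\<close>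

lemma tail_word_less:
  assumes "over \<tau> g" "(c, w) \<in> set (tl (terms g))"
  shows "word_less (ells w) (ells (lead g)) \<or> ells w = ells (lead g) \<and> word_less (vs w) (vs (lead g))"
  using tail_words_less[OF assms(1)] assms(2) by (auto simp: list_all_iff)

text \<open>
  This gives both the minimality of the leading monomials and the reducedness of the tails.
\<close>

lemma lead_incomparable:
  assumes "over \<tau> g" "over \<tau> h" "(c, w) \<in> set (terms h)" "set (lead g) \<subseteq> set w"
  shows "g = h"
proof -
  have "list_all (\<lambda>(c, w). set (lead g) \<subseteq> set w \<longrightarrow> g = h) (terms h)"
  proof (cases h)
    case h: (Affine e i j k)
    then have *: "i < j" "j < k" "i < k" using assms(2) by auto
    note n = * *[THEN distinct_indices(1)] *[THEN distinct_indices(2)] *[THEN distinct_indices(3)]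
    show ?thesis using assms(1,2) n unfolding h by (cases g) (auto simp: term_simps)
  next
    case h: (Planar i j k)
    then have *: "i < j" "j < k" "i < k" using assms(2) by auto
    note n = * *[THEN distinct_indices(1)] *[THEN distinct_indices(2)] *[THEN distinct_indices(3)]
    show ?thesis using assms(1,2) n unfolding h by (cases g) (auto simp: term_simps)
  next
    case h: (Spatial i j k)
    then have *: "i < j" "j < k" "i < k" using assms(2) by auto
    note n = * *[THEN distinct_indices(1)] *[THEN distinct_indices(2)] *[THEN distinct_indices(3)]
    show ?thesis using assms(1,2) n unfolding h by (cases g) (auto simp: term_simps)
  next
    case h: (ZZYY i j k l)
    then have *: "i < j" "j < k" "i < k" "k < l" "i < l" "j < l" using assms(2) by auto
    note n = * *[THEN distinct_indices(1)] *[THEN distinct_indices(2)] *[THEN distinct_indices(3)]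
    show ?thesis using assms(1,2) n unfolding h by (cases g) (auto simp: term_simps)
  next
    case h: (XZYY i j k l)
    then have *: "i < j" "j < k" "i < k" "k < l" "i < l" "j < l" using assms(2) by auto
    note n = * *[THEN distinct_indices(1)] *[THEN distinct_indices(2)] *[THEN distinct_indices(3)]
    show ?thesis using assms(1,2) n unfolding h by (cases g) (auto simp: term_simps)
  next
    case h: (ZXYY i j k l)
    then have *: "i < j" "j < k" "i < k" "k < l" "i < l" "j < l" using assms(2) by auto
    note n = * *[THEN distinct_indices(1)] *[THEN distinct_indices(2)] *[THEN distinct_indices(3)]
    show ?thesis using assms(1,2) n unfolding h by (cases g) (auto simp: term_simps)
  qed
  then show ?thesis using assms(3,4) by (auto simp: list_all_iff)
qed

lemma terms_vars:
  assumes "over \<tau> g" "finite \<tau>" "(c, w) \<in> set (terms g)"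
  shows "set w \<subseteq> ring_vars \<tau>"
  using assms by (cases g) (auto simp: term_simps set_ell_vars set_v_vars)

text \<open>
  Setting the variables in \<open>S\<close> to 1 and all others to 0 gives a point at which \<open>ell a b\<close>
  vanishes but the generator does not. If \<open>ell a b\<close> is not in the leading monomial, that
  monomial serves as \<open>S\<close>; otherwise another term without \<open>ell a b\<close> does.
\<close>

lemma avoid_variable:
  assumes "over \<tau> g"
  shows "\<exists>S. Ell a b \<notin> S \<and> (\<Sum>(c, w)\<leftarrow>terms g. if set w \<subseteq> S then c else 0) \<noteq> 0"
proof (cases "Ell a b \<in> set (lead g)")
  case False
  then show ?thesis using assms
    by (intro exI[of _ "set (lead g)"]; cases g) (auto simp: term_simps)
next
  case True
  show ?thesis
  proof (cases g)
    case (Affine e i j k)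
    then consider "Ell a b \<notin> {V k, Ell 1 i, Ell e j, Ell 1 k}"
      | "Ell a b \<notin> {V i, Ell 1 i, Ell 1 j, Ell e k}"
      using True assms by auto
    then show ?thesis
    proof cases
      case 1
      then show ?thesis using assms unfolding Affine
        by (intro exI[of _ "{V k, Ell 1 i, Ell e j, Ell 1 k}"]) (auto simp: term_simps)
    next
      case 2
      then show ?thesis using assms unfolding Affine
        by (intro exI[of _ "{V i, Ell 1 i, Ell 1 j, Ell e k}"]) (auto simp: term_simps)
    qed
  next
    case (Planar i j k)
    then show ?thesis using True assms
      by (intro exI[of _ "{Ell 2 i, Ell 1 j, Ell 3 k}"]) (auto simp: term_simps)
  next
    case (Spatial i j k)
    then show ?thesis using True assms
      by (intro exI[of _ "{V i, Ell 1 i, Ell 2 j, Ell 3 k}"]) (auto simp: term_simps)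
  next
    case (ZZYY i j k l)
    then show ?thesis using True assms
      by (intro exI[of _ "{V i, V k, Ell 2 i, Ell 2 j, Ell 3 k, Ell 3 l}"]) (auto simp: term_simps)
  next
    case (XZYY i j k l)
    then consider "Ell a b \<notin> {V j, Ell 2 i, Ell 1 j, Ell 3 k, Ell 2 l}"
      | "Ell a b \<notin> {V j, Ell 2 i, Ell 1 j, Ell 2 k, Ell 3 l}"
      using True assms by auto
    then show ?thesis
    proof cases
      case 1
      then show ?thesis using assms unfolding XZYY
        by (intro exI[of _ "{V j, Ell 2 i, Ell 1 j, Ell 3 k, Ell 2 l}"]) (auto simp: term_simps)
    next
      case 2
      then show ?thesis using assms unfolding XZYY
        by (intro exI[of _ "{V j, Ell 2 i, Ell 1 j, Ell 2 k, Ell 3 l}"]) (auto simp: term_simps)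
    qed
  next
    case (ZXYY i j k l)
    then consider "Ell a b \<notin> {V i, Ell 1 i, Ell 2 j, Ell 3 k, Ell 2 l}"
      | "Ell a b \<notin> {V j, Ell 2 i, Ell 1 j, Ell 2 k, Ell 3 l}"
      using True assms by auto
    then show ?thesis
    proof cases
      case 1
      then show ?thesis using assms unfolding ZXYY
        by (intro exI[of _ "{V i, Ell 1 i, Ell 2 j, Ell 3 k, Ell 2 l}"]) (auto simp: term_simps)
    next
      case 2
      then show ?thesis using assms unfolding ZXYY
        by (intro exI[of _ "{V j, Ell 2 i, Ell 1 j, Ell 2 k, Ell 3 l}"]) (auto simp: term_simps)
    qed
  qed
qed

section \<open>Generators as polynomials and determinants\<close>

subsection \<open>Closed forms\<close>

lemma poly_of_Nil: "poly_of [] = 0" by (simp add: poly_of_def)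

lemma poly_of_Cons: "poly_of ((c, w) # ts) = single (word_mon w) c + poly_of ts"
  by (simp add: poly_of_def)

lemma poly_of_append: "poly_of (ps @ qs) = poly_of ps + poly_of qs"
  by (simp add: poly_of_def)

lemma word_mon_append: "word_mon (xs @ ys) = word_mon xs + word_mon ys"
  by (simp add: word_mon_def)

lemma poly_of_tmul: "poly_of (ps \<star> qs) = poly_of ps * poly_of qs"
proof (induction ps)
  case Nil
  then show ?case by (simp add: tmul_def poly_of_Nil)
next
  case (Cons p ps)
  obtain c w where p: "p = (c, w)" by fastforce
  have "poly_of (map (\<lambda>(d, w'). (c * d, w @ w')) qs) = single (word_mon w) c * poly_of qs"
    by (induction qs) (auto simp: poly_of_Nil poly_of_Cons distrib_left mult_single word_mon_append)
  moreover have "(p # ps) \<star> qs = map (\<lambda>(d, w'). (c * d, w @ w')) qs @ (ps \<star> qs)"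
    by (simp add: tmul_def p)
  ultimately show ?case using Cons by (simp add: p poly_of_append poly_of_Cons distrib_right)
qed

lemma word_Nil: "single (word_mon []) 1 = 1"
  by (simp add: word_mon_def)

lemma word_Cons: "single (word_mon (x # w)) 1 = Var x * single (word_mon w) 1"
  by (simp only: word_mon_Cons Var_def mult_single mult_1)

lemma word_uminus: "single (word_mon w) (- 1) = - single (word_mon w) 1"
  by (rule single_uminus)

lemma poly_of_vdiff: "poly_of (vdiff a b) = v a - v b"
  unfolding vdiff_def poly_of_Cons poly_of_Nil word_uminus word_Cons word_Nil by simp

lemmas poly_of_expand = poly_of_append poly_of_tmul poly_of_vdiff poly_of_Cons poly_of_Nil
  word_uminus word_Cons word_Nil

text \<open>
  The last two equations express \<open>XZYY\<close> and \<open>ZXYY\<close> through \<open>Spatial\<close>, from which their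
  membership in the ideal follows.
\<close>

lemma gen_poly_expand:
  "gen_poly (Affine c i j k) = (v j - v k) * ell c i * ell 1 j * ell 1 k
     + (v k - v i) * ell 1 i * ell c j * ell 1 k + (v i - v j) * ell 1 i * ell 1 j * ell c k"
  "gen_poly (Planar i j k) = ell 3 i * (ell 2 j * ell 1 k - ell 1 j * ell 2 k)
     - ell 2 i * (ell 3 j * ell 1 k - ell 1 j * ell 3 k) - ell 1 i * (ell 2 j * ell 3 k - ell 3 j * ell 2 k)"
  "gen_poly (Spatial i j k) = (v j - v k) * ell 1 j * (ell 3 i * ell 2 k - ell 2 i * ell 3 k)
     + (v i - v k) * ell 1 i * (ell 2 j * ell 3 k - ell 3 j * ell 2 k)"
  "gen_poly (ZZYY i j k l) =
     (v i - v j) * (v k - v l) * (ell 3 i * ell 3 j * ell 2 k * ell 2 l + ell 2 i * ell 2 j * ell 3 k * ell 3 l)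
   - (v i - v k) * (v j - v l) * (ell 3 i * ell 2 j * ell 3 k * ell 2 l + ell 2 i * ell 3 j * ell 2 k * ell 3 l)
   + (v i - v l) * (v j - v k) * (ell 3 i * ell 2 j * ell 2 k * ell 3 l + ell 2 i * ell 3 j * ell 3 k * ell 2 l)"
  "gen_poly (XZYY i j k l) = (v j - v k) * ell 2 k * gen_poly (Spatial i j l)
     - (v j - v l) * ell 2 l * gen_poly (Spatial i j k)"
  "gen_poly (ZXYY i j k l) = ell 2 k * gen_poly (Spatial i j l) - ell 2 l * gen_poly (Spatial i j k)"
  by (simp_all only: gen_poly_def terms.simps poly_of_expand) (simp_all add: algebra_simps)

lemma gen_poly_vanishing:
  assumes "over \<tau> g" shows "gen_poly g \<in> vanishing_on_lines"
proof -
  have spatial: "gen_poly (Spatial i j k) \<in> vanishing_on_lines" for i j k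
    unfolding vanishing_on_lines_def gen_poly_expand mem_Collect_eq specialise_simps line_image_simps
    by (simp add: algebra_simps)
  show ?thesis
  proof (cases g)
    case (Affine c i j k)
    then have "c = 2 \<or> c = 3" using assms by auto
    then show ?thesis unfolding Affine
      by (elim disjE; simp only: vanishing_on_lines_def gen_poly_expand mem_Collect_eq specialise_simps line_image_simps)
         (simp_all add: algebra_simps)
  next
    case (Planar i j k)
    show ?thesis
      unfolding Planar vanishing_on_lines_def gen_poly_expand mem_Collect_eq specialise_simps line_image_simps
      by (simp add: algebra_simps)
  next
    case (Spatial i j k)
    then show ?thesis using spatial by simp
  next
    case (ZZYY i j k l)
    show ?thesis
      unfolding ZZYY vanishing_on_lines_def gen_poly_expand mem_Collect_eq specialise_simps line_image_simps
      by (simp add: algebra_simps)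
  next
    case (XZYY i j k l)
    then show ?thesis using spatial by (simp add: vanishing_on_lines_def gen_poly_expand(5) specialise_simps)
  next
    case (ZXYY i j k l)
    then show ?thesis using spatial by (simp add: vanishing_on_lines_def gen_poly_expand(6) specialise_simps)
  qed
qed

subsection \<open>Determinants\<close>

lemma det_expand_first_column:
  fixes f :: "nat \<Rightarrow> nat \<Rightarrow> 'a::comm_ring_1"
  shows "det (mat (Suc n) (Suc n) (\<lambda>(i, j). f i j)) =
    (\<Sum>i<Suc n. (-1) ^ i * f i 0 * det (mat n n (\<lambda>(a, b). f (if a < i then a else Suc a) (Suc b))))"
proof -
  let ?A = "mat (Suc n) (Suc n) (\<lambda>(i, j). f i j)"
  have "det ?A = (\<Sum>i<Suc n. ?A $$ (i, 0) * cofactor ?A i 0)"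
    by (rule laplace_expansion_column) auto
  also have "\<dots> = (\<Sum>i<Suc n. (-1) ^ i * f i 0 * det (mat n n (\<lambda>(a, b). f (if a < i then a else Suc a) (Suc b))))"
  proof (rule sum.cong[OF refl])
    fix i assume i: "i \<in> {..<Suc n}"
    have "mat_delete ?A i 0 = mat n n (\<lambda>(a, b). f (if a < i then a else Suc a) (Suc b))"
      using i by (intro eq_matI) (auto simp: mat_delete_def)
    then show "?A $$ (i, 0) * cofactor ?A i 0 =
        (-1) ^ i * f i 0 * det (mat n n (\<lambda>(a, b). f (if a < i then a else Suc a) (Suc b)))"
      using i by (simp add: cofactor_def mult_ac)
  qed
  finally show ?thesis .
qed

lemma det_mat_3:
  fixes f :: "nat \<Rightarrow> nat \<Rightarrow> 'a::comm_ring_1"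
  shows "det (mat 3 3 (\<lambda>(i, j). f i j)) =
    f 0 0 * (f 1 1 * f 2 2 - f 2 1 * f 1 2) - f 1 0 * (f 0 1 * f 2 2 - f 2 1 * f 0 2)
    + f 2 0 * (f 0 1 * f 1 2 - f 1 1 * f 0 2)"
  by (simp add: numeral_3_eq_3 numeral_2_eq_2 det_expand_first_column algebra_simps)

lemma det_mat_4:
  fixes f :: "nat \<Rightarrow> nat \<Rightarrow> 'a::comm_ring_1"
  shows "det (mat 4 4 (\<lambda>(i, j). f i j)) =
    (f 0 0 * f 1 1 - f 1 0 * f 0 1) * (f 2 2 * f 3 3 - f 3 2 * f 2 3)
  - (f 0 0 * f 2 1 - f 2 0 * f 0 1) * (f 1 2 * f 3 3 - f 3 2 * f 1 3)
  + (f 0 0 * f 3 1 - f 3 0 * f 0 1) * (f 1 2 * f 2 3 - f 2 2 * f 1 3)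
  + (f 1 0 * f 2 1 - f 2 0 * f 1 1) * (f 0 2 * f 3 3 - f 3 2 * f 0 3)
  - (f 1 0 * f 3 1 - f 3 0 * f 1 1) * (f 0 2 * f 2 3 - f 2 2 * f 0 3)
  + (f 2 0 * f 3 1 - f 3 0 * f 2 1) * (f 0 2 * f 1 3 - f 1 2 * f 0 3)"
  by (simp add: eval_nat_numeral det_expand_first_column algebra_simps)

text \<open>
  Laplace expansion along a column with one nonzero entry, for the submatrix of \<open>M\<close> on a list of
  rows and on the columns from \<open>k\<close> on.
\<close>

lemma det_single_column:
  fixes M :: "nat \<Rightarrow> nat \<Rightarrow> 'a::comm_ring_1"
  assumes "\<And>s. s \<in> set (as @ bs) \<Longrightarrow> M s k = 0"
  shows "det (mat (length (as @ r # bs)) (length (as @ r # bs)) (\<lambda>(i, j). M ((as @ r # bs) ! i) (k + j))) =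
    (-1) ^ length as * M r k * det (mat (length (as @ bs)) (length (as @ bs)) (\<lambda>(i, j). M ((as @ bs) ! i) (Suc k + j)))"
proof -
  let ?n = "length (as @ bs)" and ?l = "as @ r # bs"
  let ?g = "\<lambda>i. (-1) ^ i * M (?l ! i) (k + 0) *
      det (mat ?n ?n (\<lambda>(a, b). M (?l ! (if a < i then a else Suc a)) (k + Suc b)))"
  have zero: "M (?l ! i) k = 0" if "i < Suc ?n" "i \<noteq> length as" for i
  proof -
    have "?l ! i \<in> set (as @ bs)" using that by (auto simp: nth_append nth_Cons')
    then show ?thesis by (rule assms)
  qed
  have "det (mat (Suc ?n) (Suc ?n) (\<lambda>(i, j). M (?l ! i) (k + j))) = (\<Sum>i<Suc ?n. ?g i)"
    by (rule det_expand_first_column)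
  also have "\<dots> = (\<Sum>i\<in>{length as}. ?g i)"
    using zero by (intro sum.mono_neutral_right) auto
  also have "\<dots> = (-1) ^ length as * M r k * det (mat ?n ?n (\<lambda>(i, j). M ((as @ bs) ! i) (Suc k + j)))"
  proof -
    have "?l ! (if a < length as then a else Suc a) = (as @ bs) ! a" for a by (auto simp: nth_append)
    then show ?thesis by simp
  qed
  finally show ?thesis by simp
qed

text \<open>
  The first six columns are constant, and after deletion of the rows already used each of them
  is a unit vector. Expanding along them leaves the rows \<open>xy, xz, yw, zw\<close> of the four columns
  that depend on the cameras, which is the \<open>4 \<times> 4\<close> determinant of the \<open>v\<close>-multiples of \<open>z\<close> and
  \<open>y\<close>, and of \<open>z\<close> and \<open>y\<close>, up to the signs of two rows.
\<close>

lemma det_Phi: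
  assumes "i < j" "j < k" "k < l"
  shows "det (Phi {i, j, k, l}) = - gen_poly (ZZYY i j k l)"
proof -
  have sl: "sorted_list_of_set {i, j, k, l} = [i, j, k, l]"
    using sorted_list_of_set_unique[of "{i, j, k, l}" "[i, j, k, l]"] assms by simp
  define cols where "cols = [nu 1 0 0 0, nu 0 0 0 1, nu 1 0 0 1, nu 0 1 0 0, nu 0 0 1 0, nu 0 1 1 0] @
      [nu (v i) (- ell 3 i) (ell 2 i) (- 1). i \<leftarrow> [i, j, k, l]]"
  define M where "M r c = cols ! c $ r" for r c
  have "length cols = 10" by (simp add: cols_def)
  moreover have "Phi {i, j, k, l} = mat_of_cols 10 cols" by (simp only: Phi_def sl cols_def)
  ultimately have Phi: "Phi {i, j, k, l} = mat 10 10 (\<lambda>(r, c). M r c)"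
    by (simp only: mat_of_cols_def M_def)
  define D where "D \<rho> c = det (mat (length \<rho>) (length \<rho>) (\<lambda>(a, b). M (\<rho> ! a) (c + b)))" for \<rho> c
  have step: "D (as @ r # bs) c = D (as @ bs) (Suc c)"
    if "\<forall>s\<in>set (as @ bs). M s c = 0" "even (length as)" "M r c = 1" for as r bs c
    unfolding D_def using that by (subst det_single_column) auto
  have nu_index: "nu x y z w $ r = [x^2, y^2, z^2, w^2, x*y, x*z, x*w, y*z, y*w, z*w] ! r"
    for x y z w :: mpol and r
    unfolding nu_def vec_of_list_index ..
  note M = M_def cols_def nu_index
  have "det (Phi {i, j, k, l}) = D [0,1,2,3,4,5,6,7,8,9] 0"
  proof -
    have "mat 10 10 (\<lambda>(r, c). M r c) = mat 10 10 (\<lambda>(r, c). M ([0,1,2,3,4,5,6,7,8,9] ! r) (0 + c))"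
      by (intro eq_matI) (auto simp: nth_Cons' less_Suc_eq numeral_eq_Suc)
    moreover have "length [0,1,2,3,4,5,6,7,8,9::nat] = 10" by simp
    ultimately show ?thesis by (simp only: Phi D_def)
  qed
  also have "\<dots> = D [1,2,3,4,5,6,7,8,9] 1" using step[of "[]" "[1,2,3,4,5,6,7,8,9]" 0 0] by (simp add: M)
  also have "\<dots> = D [1,2,4,5,6,7,8,9] 2" using step[of "[1,2]" "[4,5,6,7,8,9]" 1 3] by (simp add: M numeral_2_eq_2)
  also have "\<dots> = D [1,2,4,5,7,8,9] 3" using step[of "[1,2,4,5]" "[7,8,9]" 2 6] by (simp add: M)
  also have "\<dots> = D [2,4,5,7,8,9] 4" using step[of "[]" "[2,4,5,7,8,9]" 3 1] by (simp add: M)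
  also have "\<dots> = D [4,5,7,8,9] 5" using step[of "[]" "[4,5,7,8,9]" 4 2] by (simp add: M)
  also have "\<dots> = D [4,5,8,9] 6" using step[of "[4,5]" "[8,9]" 5 7] by (simp add: M)
  also have "\<dots> = det (mat 4 4 (\<lambda>(r, c). M ([4,5,8,9] ! r) (6 + c)))"
  proof -
    have "length [4,5,8,9::nat] = 4" by simp
    then show ?thesis by (simp only: D_def)
  qed
  also have "\<dots> = - gen_poly (ZZYY i j k l)"
    unfolding det_mat_4[of "\<lambda>r c. M ([4,5,8,9] ! r) (6 + c)"] gen_poly_expand
    by (simp add: M algebra_simps)
  finally show ?thesis .
qed

section \<open>The ideal is generated by the generators\<close>

subsection \<open>The polynomial ring\<close>

lemma ring_mons_add: "s \<in> ring_mons \<tau> \<Longrightarrow> t \<in> ring_mons \<tau> \<Longrightarrow> s + t \<in> ring_mons \<tau>"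
  using keys_add[of s t] by (auto simp: ring_mons_def)

lemma poly_ring_add: "p \<in> poly_ring \<tau> \<Longrightarrow> q \<in> poly_ring \<tau> \<Longrightarrow> p + q \<in> poly_ring \<tau>"
  using keys_add[of p q] by (auto simp: poly_ring_iff)

lemma poly_ring_mult: "p \<in> poly_ring \<tau> \<Longrightarrow> q \<in> poly_ring \<tau> \<Longrightarrow> p * q \<in> poly_ring \<tau>"
  using keys_mult[of p q] ring_mons_add by (fastforce simp: poly_ring_iff)

lemma poly_ring_single: "t \<in> ring_mons \<tau> \<Longrightarrow> single t c \<in> poly_ring \<tau>"
  by (simp add: poly_ring_iff)

lemma poly_ring_zero: "0 \<in> poly_ring \<tau>"
  by (simp add: poly_ring_iff)

lemma poly_ring_one: "1 \<in> poly_ring \<tau>"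
  by (simp add: poly_ring_iff ring_mons_def)

lemma poly_ring_uminus: "p \<in> poly_ring \<tau> \<Longrightarrow> - p \<in> poly_ring \<tau>"
  using poly_ring_mult[OF poly_ring_single[of 0 \<tau> "- 1"], of p] by (simp add: ring_mons_def single_uminus)

lemma poly_ring_minus: "p \<in> poly_ring \<tau> \<Longrightarrow> q \<in> poly_ring \<tau> \<Longrightarrow> p - q \<in> poly_ring \<tau>"
  using poly_ring_add[OF _ poly_ring_uminus] by fastforce

lemma poly_ring_Var: "x \<in> ring_vars \<tau> \<Longrightarrow> Var x \<in> poly_ring \<tau>"
  unfolding Var_def by (rule poly_ring_single) (simp add: ring_mons_def)

lemma poly_ring_ell: "finite \<tau> \<Longrightarrow> i \<in> {1,2,3} \<Longrightarrow> j \<in> \<tau> \<Longrightarrow> ell i j \<in> poly_ring \<tau>"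
  by (rule poly_ring_Var) (auto simp: set_ell_vars)

lemma poly_ring_v: "finite \<tau> \<Longrightarrow> j \<in> \<tau> \<Longrightarrow> v j \<in> poly_ring \<tau>"
  by (rule poly_ring_Var) (auto simp: set_v_vars)

lemmas poly_ring_intros = poly_ring_add poly_ring_mult poly_ring_uminus poly_ring_minus poly_ring_one poly_ring_zero
  poly_ring_ell poly_ring_v

subsection \<open>Ideals relative to a subring\<close>

locale coefficient_ring =
  fixes R :: "'a::comm_ring_1 set"
  assumes zero: "0 \<in> R" and one: "1 \<in> R"
    and add: "p \<in> R \<Longrightarrow> q \<in> R \<Longrightarrow> p + q \<in> R"
    and mult: "p \<in> R \<Longrightarrow> q \<in> R \<Longrightarrow> p * q \<in> R"
begin

lemma ideal_inI:
  "p = (\<Sum>s\<in>F. q s * s) \<Longrightarrow> finite F \<Longrightarrow> F \<subseteq> S \<Longrightarrow> q ` F \<subseteq> R \<Longrightarrow> p \<in> ideal_in R S"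
  unfolding ideal_in_def by (intro CollectI exI[of _ F] exI[of _ q] conjI)

lemma ideal_in_memI: "s \<in> S \<Longrightarrow> q \<in> R \<Longrightarrow> q * s \<in> ideal_in R S"
  unfolding ideal_in_def by (rule CollectI, rule exI[of _ "{s}"], rule exI[of _ "\<lambda>_. q"]) auto

lemma ideal_in_zero: "0 \<in> ideal_in R S"
  unfolding ideal_in_def by (rule CollectI, rule exI[of _ "{}"]) auto

lemma ideal_in_add:
  assumes "p \<in> ideal_in R S" "q \<in> ideal_in R S" shows "p + q \<in> ideal_in R S"
proof -
  obtain F f where F: "p = (\<Sum>s\<in>F. f s * s)" "finite F" "F \<subseteq> S" "f ` F \<subseteq> R"
    using assms(1) by (auto simp: ideal_in_def)
  obtain H h where H: "q = (\<Sum>s\<in>H. h s * s)" "finite H" "H \<subseteq> S" "h ` H \<subseteq> R"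
    using assms(2) by (auto simp: ideal_in_def)
  define k where "k s = (if s \<in> F then f s else 0) + (if s \<in> H then h s else 0)" for s
  have "p = (\<Sum>s\<in>F \<union> H. (if s \<in> F then f s else 0) * s)"
    unfolding F(1) using F(2) H(2) by (intro sum.mono_neutral_cong_left) auto
  moreover have "q = (\<Sum>s\<in>F \<union> H. (if s \<in> H then h s else 0) * s)"
    unfolding H(1) using F(2) H(2) by (intro sum.mono_neutral_cong_left) auto
  ultimately have "p + q = (\<Sum>s\<in>F \<union> H. k s * s)"
    by (simp add: k_def distrib_right sum.distrib)
  moreover have "k ` (F \<union> H) \<subseteq> R" using F(4) H(4) zero add by (auto simp: k_def image_subset_iff)
  ultimately show ?thesis using F(2,3) H(2,3) by (intro ideal_inI[of _ k "F \<union> H"]) auto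
qed

lemma ideal_in_mult:
  assumes "p \<in> ideal_in R S" "c \<in> R" shows "c * p \<in> ideal_in R S"
proof -
  obtain F f where F: "p = (\<Sum>s\<in>F. f s * s)" "finite F" "F \<subseteq> S" "f ` F \<subseteq> R"
    using assms(1) by (auto simp: ideal_in_def)
  have "c * p = (\<Sum>s\<in>F. (c * f s) * s)" by (simp add: F(1) sum_distrib_left mult.assoc)
  moreover have "(\<lambda>s. c * f s) ` F \<subseteq> R" using F(4) assms(2) mult by (auto simp: image_subset_iff)
  ultimately show ?thesis using F(2,3) by (intro ideal_inI[of _ "\<lambda>s. c * f s" F]) auto
qed

lemma ideal_in_sum: "(\<And>i. i \<in> A \<Longrightarrow> f i \<in> ideal_in R S) \<Longrightarrow> (\<Sum>i\<in>A. f i) \<in> ideal_in R S"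
  by (induction A rule: infinite_finite_induct) (auto simp: ideal_in_zero ideal_in_add)

lemma ideal_in_subset: "S \<subseteq> ideal_in R S' \<Longrightarrow> ideal_in R S \<subseteq> ideal_in R S'"
proof
  fix p assume S: "S \<subseteq> ideal_in R S'" and "p \<in> ideal_in R S"
  then obtain F f where F: "p = (\<Sum>s\<in>F. f s * s)" "finite F" "F \<subseteq> S" "f ` F \<subseteq> R"
    by (auto simp: ideal_in_def)
  then show "p \<in> ideal_in R S'" using S by (auto intro!: ideal_in_sum ideal_in_mult)
qed

lemma ideal_in_incl: "S \<subseteq> ideal_in R S"
  using ideal_in_memI[OF _ one] by auto

lemma ideal_in_induct:
  assumes "p \<in> ideal_in R S" "P 0" "\<And>a b. P a \<Longrightarrow> P b \<Longrightarrow> P (a + b)"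
    "\<And>s q. s \<in> S \<Longrightarrow> q \<in> R \<Longrightarrow> P (q * s)"
  shows "P p"
proof -
  obtain F f where F: "p = (\<Sum>s\<in>F. f s * s)" "finite F" "F \<subseteq> S" "f ` F \<subseteq> R"
    using assms(1) by (auto simp: ideal_in_def)
  from F(2,3,4) have "P (\<Sum>s\<in>F. f s * s)" by (induction F) (auto intro!: assms(2,3,4))
  then show ?thesis by (simp add: F(1))
qed

end

interpretation poly_ring: coefficient_ring "poly_ring \<tau>" for \<tau>
  by unfold_locales (auto intro: poly_ring_intros)

subsection \<open>The collinear ideal\<close>

definition backprojection_entry :: "nat \<Rightarrow> nat \<Rightarrow> mpol" where
  "backprojection_entry r j = [ell 1 j, ell 2 j, ell 3 j, v j * ell 1 j] ! r"

text \<open>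
  The minor on the rows \<open>r, s, t\<close> and the columns of the cameras \<open>i, j, k\<close>.
\<close>

definition minor3 :: "nat \<Rightarrow> nat \<Rightarrow> nat \<Rightarrow> nat \<Rightarrow> nat \<Rightarrow> nat \<Rightarrow> mpol" where
  "minor3 r s t i j k = (let e = backprojection_entry in
    e r i * (e s j * e t k - e t j * e s k) - e s i * (e r j * e t k - e t j * e r k)
    + e t i * (e r j * e s k - e s j * e r k))"

context
  fixes \<tau> :: "nat set"
  assumes fin: "finite \<tau>"
begin

lemma finite_quadruples: "finite {\<sigma>. \<sigma> \<subseteq> \<tau> \<and> card \<sigma> = 4}"
  using fin by (intro finite_subset[OF _ finite_Pow_iff[THEN iffD2, OF fin]]) auto

lemma collinear_ideal_iff:
  "f \<in> collinear_ideal \<tau> \<longleftrightarrow> (\<exists>a s. a \<in> ideal_in (poly_ring \<tau>) (minors 3 (backprojection_mat \<tau>)) \<and>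
     (\<forall>\<sigma>\<in>{\<sigma>. \<sigma> \<subseteq> \<tau> \<and> card \<sigma> = 4}. s \<sigma> \<in> ideal_in (poly_ring \<tau>) {det (Phi \<sigma>)}) \<and>
     f = a + (\<Sum>\<sigma>\<in>{\<sigma>. \<sigma> \<subseteq> \<tau> \<and> card \<sigma> = 4}. s \<sigma>))"
  unfolding collinear_ideal_def set_sum_alt[OF finite_quadruples] set_plus_def by blast

lemma collinear_ideal_add:
  assumes "f \<in> collinear_ideal \<tau>" "g \<in> collinear_ideal \<tau>" shows "f + g \<in> collinear_ideal \<tau>"
proof -
  let ?A = "{\<sigma>. \<sigma> \<subseteq> \<tau> \<and> card \<sigma> = 4}"
  obtain a s where f: "a \<in> ideal_in (poly_ring \<tau>) (minors 3 (backprojection_mat \<tau>))"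
    "\<forall>\<sigma>\<in>?A. s \<sigma> \<in> ideal_in (poly_ring \<tau>) {det (Phi \<sigma>)}" "f = a + (\<Sum>\<sigma>\<in>?A. s \<sigma>)"
    using assms(1) unfolding collinear_ideal_iff by blast
  obtain b r where g: "b \<in> ideal_in (poly_ring \<tau>) (minors 3 (backprojection_mat \<tau>))"
    "\<forall>\<sigma>\<in>?A. r \<sigma> \<in> ideal_in (poly_ring \<tau>) {det (Phi \<sigma>)}" "g = b + (\<Sum>\<sigma>\<in>?A. r \<sigma>)"
    using assms(2) unfolding collinear_ideal_iff by blast
  have "f + g = (a + b) + (\<Sum>\<sigma>\<in>?A. s \<sigma> + r \<sigma>)" by (simp add: f(3) g(3) sum.distrib)
  moreover have "\<forall>\<sigma>\<in>?A. s \<sigma> + r \<sigma> \<in> ideal_in (poly_ring \<tau>) {det (Phi \<sigma>)}"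
    using f(2) g(2) poly_ring.ideal_in_add by blast
  ultimately show ?thesis
    unfolding collinear_ideal_iff using poly_ring.ideal_in_add[OF f(1) g(1)]
    by (intro exI[of _ "a + b"] exI[of _ "\<lambda>\<sigma>. s \<sigma> + r \<sigma>"]) simp
qed

lemma collinear_ideal_mult:
  assumes "f \<in> collinear_ideal \<tau>" "c \<in> poly_ring \<tau>" shows "c * f \<in> collinear_ideal \<tau>"
proof -
  let ?A = "{\<sigma>. \<sigma> \<subseteq> \<tau> \<and> card \<sigma> = 4}"
  obtain a s where f: "a \<in> ideal_in (poly_ring \<tau>) (minors 3 (backprojection_mat \<tau>))"
    "\<forall>\<sigma>\<in>?A. s \<sigma> \<in> ideal_in (poly_ring \<tau>) {det (Phi \<sigma>)}" "f = a + (\<Sum>\<sigma>\<in>?A. s \<sigma>)"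
    using assms(1) unfolding collinear_ideal_iff by blast
  have "c * f = c * a + (\<Sum>\<sigma>\<in>?A. c * s \<sigma>)" by (simp add: f(3) distrib_left sum_distrib_left)
  then show ?thesis
    unfolding collinear_ideal_iff using poly_ring.ideal_in_mult[OF _ assms(2)] f(1,2)
    by (intro exI[of _ "c * a"] exI[of _ "\<lambda>\<sigma>. c * s \<sigma>"]) simp
qed

lemma collinear_ideal_minus:
  assumes "f \<in> collinear_ideal \<tau>" "g \<in> collinear_ideal \<tau>" shows "f - g \<in> collinear_ideal \<tau>"
  using collinear_ideal_add[OF assms(1) collinear_ideal_mult[OF assms(2), of "- 1"]]
  by (simp add: poly_ring_uminus poly_ring_one)

lemma collinear_ideal_minor:
  "d \<in> minors 3 (backprojection_mat \<tau>) \<Longrightarrow> d \<in> collinear_ideal \<tau>"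
  unfolding collinear_ideal_iff using poly_ring.ideal_in_incl
  by (intro exI[of _ d] exI[of _ "\<lambda>_. 0"]) (auto simp: poly_ring.ideal_in_zero)

lemma collinear_ideal_Phi:
  assumes "\<sigma> \<subseteq> \<tau>" "card \<sigma> = 4" shows "det (Phi \<sigma>) \<in> collinear_ideal \<tau>"
  unfolding collinear_ideal_iff using assms finite_quadruples poly_ring.ideal_in_incl
  by (intro exI[of _ 0] exI[of _ "\<lambda>\<rho>. if \<rho> = \<sigma> then det (Phi \<sigma>) else 0"])
     (auto simp: poly_ring.ideal_in_zero sum.delta)

lemma collinear_ideal_induct:
  assumes "f \<in> collinear_ideal \<tau>" "P 0" "\<And>a b. P a \<Longrightarrow> P b \<Longrightarrow> P (a + b)"
    "\<And>s q. s \<in> minors 3 (backprojection_mat \<tau>) \<Longrightarrow> q \<in> poly_ring \<tau> \<Longrightarrow> P (q * s)"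
    "\<And>\<sigma> q. \<sigma> \<subseteq> \<tau> \<Longrightarrow> card \<sigma> = 4 \<Longrightarrow> q \<in> poly_ring \<tau> \<Longrightarrow> P (q * det (Phi \<sigma>))"
  shows "P f"
proof -
  let ?A = "{\<sigma>. \<sigma> \<subseteq> \<tau> \<and> card \<sigma> = 4}"
  obtain a s where f: "a \<in> ideal_in (poly_ring \<tau>) (minors 3 (backprojection_mat \<tau>))"
    "\<forall>\<sigma>\<in>?A. s \<sigma> \<in> ideal_in (poly_ring \<tau>) {det (Phi \<sigma>)}" "f = a + (\<Sum>\<sigma>\<in>?A. s \<sigma>)"
    using assms(1) unfolding collinear_ideal_iff by blast
  have "P a" by (rule poly_ring.ideal_in_induct[OF f(1)]) (use assms in auto)
  moreover have "P (s \<sigma>)" if "\<sigma> \<in> ?A" for \<sigma>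
    using f(2)[rule_format, OF that] by (rule poly_ring.ideal_in_induct) (use assms that in auto)
  then have "P (\<Sum>\<sigma>\<in>B. s \<sigma>)" if "B \<subseteq> ?A" for B
    using that by (induction B rule: infinite_finite_induct) (auto intro: assms(2,3))
  ultimately show ?thesis unfolding f(3) using assms(3) by blast
qed

subsection \<open>Minors of the backprojection matrix\<close>

lemma backprojection_dims:
  "dim_row (backprojection_mat \<tau>) = 4" "dim_col (backprojection_mat \<tau>) = card \<tau>"
  by (simp_all add: backprojection_mat_def)

lemma backprojection_index:
  assumes "r < 4" "c < card \<tau>"
  shows "backprojection_mat \<tau> $$ (r, c) = backprojection_entry r (sorted_list_of_set \<tau> ! c)"
proof -
  let ?j = "sorted_list_of_set \<tau> ! c"
  have "backprojection_mat \<tau> $$ (r, c) = (transpose_mat (camera ?j) *\<^sub>v ell_vec ?j) $ r"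
    using assms by (simp add: backprojection_mat_def mat_of_cols_index)
  also have "\<dots> = (\<Sum>k<3. camera ?j $$ (k, r) * ell_vec ?j $ k)"
    using assms by (simp add: camera_def ell_vec_def scalar_prod_def mat_of_rows_list_def lessThan_atLeast0 numeral_3_eq_3)
  also have "\<dots> = backprojection_entry r ?j"
  proof -
    have "r = 0 \<or> r = 1 \<or> r = 2 \<or> r = 3" using assms by auto
    then show ?thesis
      by (elim disjE) (simp_all add: numeral_3_eq_3 lessThan_Suc camera_def ell_vec_def mat_of_rows_list_def
        backprojection_entry_def vec_of_list_index del: vec_of_list_Cons)
  qed
  finally show ?thesis .
qed

lemma det_submatrix_3:
  assumes "I \<subseteq> {..<4}" "card I = 3" "J \<subseteq> {..<card \<tau>}" "card J = 3"
  shows "det (submatrix (backprojection_mat \<tau>) I J) = minor3 (pick I 0) (pick I 1) (pick I 2)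
    (sorted_list_of_set \<tau> ! pick J 0) (sorted_list_of_set \<tau> ! pick J 1) (sorted_list_of_set \<tau> ! pick J 2)"
proof -
  let ?A = "backprojection_mat \<tau>"
  have I: "{a. a < dim_row ?A \<and> a \<in> I} = I" and J: "{a. a < dim_col ?A \<and> a \<in> J} = J"
    using assms by (auto simp: backprojection_dims)
  have "submatrix ?A I J = mat 3 3 (\<lambda>(a, b). ?A $$ (pick I a, pick J b))"
    unfolding submatrix_def I J assms(2,4) by auto
  also have "\<dots> = mat 3 3 (\<lambda>(a, b). backprojection_entry (pick I a) (sorted_list_of_set \<tau> ! pick J b))"
  proof (rule eq_matI)
    fix a b assume "a < dim_row (mat 3 3 (\<lambda>(a, b). backprojection_entry (pick I a) (sorted_list_of_set \<tau> ! pick J b)))"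
      "b < dim_col (mat 3 3 (\<lambda>(a, b). backprojection_entry (pick I a) (sorted_list_of_set \<tau> ! pick J b)))"
    then have "a < 3" "b < 3" by auto
    then have "pick I a < 4" "pick J b < card \<tau>" using pick_in_set_le[of a I] pick_in_set_le[of b J] assms by auto
    then show "mat 3 3 (\<lambda>(a, b). ?A $$ (pick I a, pick J b)) $$ (a, b) =
       mat 3 3 (\<lambda>(a, b). backprojection_entry (pick I a) (sorted_list_of_set \<tau> ! pick J b)) $$ (a, b)"
      using \<open>a < 3\<close> \<open>b < 3\<close> by (simp add: backprojection_index)
  qed auto
  finally show ?thesis
    using det_mat_3[of "\<lambda>a b. backprojection_entry (pick I a) (sorted_list_of_set \<tau> ! pick J b)"]
    by (simp only: minor3_def Let_def)
qed

lemma pick_three: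
  assumes "a < b" "b < c"
  shows "pick {a, b, c} 0 = a" "pick {a, b, c} 1 = b" "pick {a, b, c} 2 = c"
proof -
  have card: "card {a, b, c} = 3" using assms by auto
  have "pick {a, b, c} i \<in> {a, b, c}" if "i < 3" for i using pick_in_set_le[of i "{a, b, c}"] that card by auto
  from this[of 0] this[of 1] this[of 2]
  have in3: "pick {a, b, c} 0 \<in> {a, b, c}" "pick {a, b, c} 1 \<in> {a, b, c}" "pick {a, b, c} 2 \<in> {a, b, c}"
    by simp_all
  have "pick {a, b, c} 0 < pick {a, b, c} 1" "pick {a, b, c} 1 < pick {a, b, c} 2"
    by (rule pick_mono_le; simp only: card; simp)+
  then show "pick {a, b, c} 0 = a" "pick {a, b, c} 1 = b" "pick {a, b, c} 2 = c"
    using in3 assms by (auto simp del: pick.simps)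
qed

lemma minor3_in_minors:
  assumes "r < s" "s < t" "t < 4" "{i, j, k} \<subseteq> \<tau>" "i < j" "j < k"
  shows "minor3 r s t i j k \<in> minors 3 (backprojection_mat \<tau>)"
proof -
  let ?L = "sorted_list_of_set \<tau>"
  have "set ?L = \<tau>" "length ?L = card \<tau>" using fin by auto
  then have "\<exists>a<card \<tau>. ?L ! a = x" if "x \<in> \<tau>" for x using that in_set_conv_nth[of x ?L] by auto
  from this[of i] this[of j] this[of k] assms(4)
  obtain a b c where abc: "?L ! a = i" "?L ! b = j" "?L ! c = k" "a < card \<tau>" "b < card \<tau>" "c < card \<tau>"
    by auto
  have index_less: "p < q" if "?L ! p < ?L ! q" "p < card \<tau>" "q < card \<tau>" for p q
    using sorted_nth_mono[of ?L q p] that \<open>length ?L = card \<tau>\<close> by (cases "p < q") auto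
  have ab: "a < b" "b < c" using index_less[of a b] index_less[of b c] abc assms(5,6) by simp_all
  have IJ: "{r, s, t} \<subseteq> {..<4}" "card {r, s, t} = 3" "{a, b, c} \<subseteq> {..<card \<tau>}" "card {a, b, c} = 3"
    using assms(1-3) ab abc(4-6) by auto
  have "det (submatrix (backprojection_mat \<tau>) {r, s, t} {a, b, c}) = minor3 r s t i j k"
    unfolding det_submatrix_3[OF IJ] pick_three[OF ab] pick_three[OF assms(1,2)] abc(1-3) ..
  then show ?thesis
    unfolding minors_def backprojection_dims
    by (intro CollectI exI[of _ "{r, s, t}"] exI[of _ "{a, b, c}"]) (simp only: IJ simp_thms)
qed

lemma minors_cases:
  assumes "d \<in> minors 3 (backprojection_mat \<tau>)"
  obtains i j k where "{i, j, k} \<subseteq> \<tau>" "i < j" "j < k"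
    "d \<in> {minor3 0 1 2 i j k, minor3 0 1 3 i j k, minor3 0 2 3 i j k, minor3 1 2 3 i j k}"
proof -
  let ?L = "sorted_list_of_set \<tau>"
  obtain I J where IJ: "I \<subseteq> {..<4}" "card I = 3" "J \<subseteq> {..<card \<tau>}" "card J = 3"
    and d: "d = det (submatrix (backprojection_mat \<tau>) I J)"
    using assms by (auto simp: minors_def backprojection_dims)
  have I: "pick I 0 < pick I 1" "pick I 1 < pick I 2" "pick I 2 < 4"
    using pick_mono_le[of 1 I 0] pick_mono_le[of 2 I 1] pick_in_set_le[of 2 I] IJ by (auto simp del: pick.simps)
  have J: "pick J 0 < pick J 1" "pick J 1 < pick J 2" "pick J 2 < card \<tau>"
    using pick_mono_le[of 1 J 0] pick_mono_le[of 2 J 1] pick_in_set_le[of 2 J] IJ by (auto simp del: pick.simps)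
  have len: "length ?L = card \<tau>" by simp
  have lt: "?L ! p < ?L ! q" if "p < q" "q < card \<tau>" for p q
    using that sorted_wrt_nth_less[OF strict_sorted_list_of_set[of \<tau>], of p q] len by simp
  have mem: "?L ! p \<in> \<tau>" if "p < card \<tau>" for p
    using that len nth_mem[of p ?L] fin by simp
  have "(pick I 0 = 0 \<and> pick I 1 = 1 \<and> pick I 2 = 2) \<or> (pick I 0 = 0 \<and> pick I 1 = 1 \<and> pick I 2 = 3) \<or>
     (pick I 0 = 0 \<and> pick I 1 = 2 \<and> pick I 2 = 3) \<or> (pick I 0 = 1 \<and> pick I 1 = 2 \<and> pick I 2 = 3)"
    using I by arith
  then have "d \<in> {minor3 0 1 2 (?L ! pick J 0) (?L ! pick J 1) (?L ! pick J 2),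
      minor3 0 1 3 (?L ! pick J 0) (?L ! pick J 1) (?L ! pick J 2),
      minor3 0 2 3 (?L ! pick J 0) (?L ! pick J 1) (?L ! pick J 2),
      minor3 1 2 3 (?L ! pick J 0) (?L ! pick J 1) (?L ! pick J 2)}"
    unfolding d det_submatrix_3[OF IJ] by (elim disjE) (simp_all del: pick.simps One_nat_def)
  then show thesis using J lt mem by (intro that[of "?L ! pick J 0" "?L ! pick J 1" "?L ! pick J 2"]) auto
qed

end

lemma minor3_eq:
  "minor3 0 1 2 i j k = - gen_poly (Planar i j k)"
  "minor3 0 1 3 i j k = gen_poly (Affine 2 i j k)"
  "minor3 0 2 3 i j k = gen_poly (Affine 3 i j k)"
  "minor3 1 2 3 i j k = gen_poly (Spatial i j k) + v k * - gen_poly (Planar i j k)"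
  unfolding minor3_def backprojection_entry_def gen_poly_expand Let_def
  by (simp_all add: numeral_3_eq_3 numeral_2_eq_2 algebra_simps)

lemma gen_poly_in_ideal:
  assumes "finite \<tau>" "over \<tau> g"
  shows "gen_poly g \<in> collinear_ideal \<tau>"
proof -
  note minor = collinear_ideal_minor[OF assms(1) minor3_in_minors[OF assms(1)]]
  note intros = collinear_ideal_mult[OF assms(1)] collinear_ideal_minus[OF assms(1)] collinear_ideal_add[OF assms(1)]
    poly_ring_intros
  have Planar: "- gen_poly (Planar i j k) \<in> collinear_ideal \<tau>" if "{i, j, k} \<subseteq> \<tau>" "i < j" "j < k" for i j k
    using minor[of 0 1 2 i j k] that unfolding minor3_eq by simp
  have neg: "- f \<in> collinear_ideal \<tau> \<Longrightarrow> f \<in> collinear_ideal \<tau>" for f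
    using collinear_ideal_mult[OF assms(1), of "- f" "- 1"] by (simp add: poly_ring_uminus poly_ring_one)
  have Spatial: "gen_poly (Spatial i j k) \<in> collinear_ideal \<tau>" if "{i, j, k} \<subseteq> \<tau>" "i < j" "j < k" for i j k
  proof -
    have "minor3 1 2 3 i j k - v k * - gen_poly (Planar i j k) \<in> collinear_ideal \<tau>"
      using minor[of 1 2 3 i j k] Planar[OF that] that assms(1) by (intro intros) auto
    then show ?thesis unfolding minor3_eq(4) by simp
  qed
  show ?thesis
  proof (cases g)
    case (Affine c i j k)
    then show ?thesis using minor[of 0 1 3 i j k] minor[of 0 2 3 i j k] assms(2) minor3_eq(2,3) by auto
  next
    case (Planar i j k)
    then show ?thesis using neg \<open>\<And>i j k. _ \<Longrightarrow> _ \<Longrightarrow> _ \<Longrightarrow> - gen_poly (Planar i j k) \<in> _\<close> assms(2) by simp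
  next
    case (Spatial i j k)
    then show ?thesis using \<open>\<And>i j k. _ \<Longrightarrow> _ \<Longrightarrow> _ \<Longrightarrow> gen_poly (Spatial i j k) \<in> _\<close> assms(2) by simp
  next
    case (ZZYY i j k l)
    then have "det (Phi {i, j, k, l}) \<in> collinear_ideal \<tau>"
      using assms by (intro collinear_ideal_Phi) auto
    then show ?thesis using neg assms(2) det_Phi[of i j k l] ZZYY by simp
  next
    case (XZYY i j k l)
    show ?thesis unfolding XZYY gen_poly_expand(5)
      using assms XZYY by (intro intros \<open>\<And>i j k. _ \<Longrightarrow> _ \<Longrightarrow> _ \<Longrightarrow> gen_poly (Spatial i j k) \<in> _\<close>) auto
  next
    case (ZXYY i j k l)
    show ?thesis unfolding ZXYY gen_poly_expand(6)
      using assms ZXYY by (intro intros \<open>\<And>i j k. _ \<Longrightarrow> _ \<Longrightarrow> _ \<Longrightarrow> gen_poly (Spatial i j k) \<in> _\<close>) auto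
  qed
qed

lemma keys_poly_of: "keys (poly_of ts) \<subseteq> word_mon ` snd ` set ts"
proof (induction ts)
  case Nil
  then show ?case by (simp add: poly_of_Nil)
next
  case (Cons t ts)
  obtain c w where "t = (c, w)" by fastforce
  then show ?case
    using keys_add[of "single (word_mon w) c" "poly_of ts"] Cons by (auto simp: poly_of_Cons split: if_splits)
qed

lemma gen_poly_in_ring: "finite \<tau> \<Longrightarrow> over \<tau> g \<Longrightarrow> gen_poly g \<in> poly_ring \<tau>"
  using keys_poly_of[of "terms g"] terms_vars[of \<tau> g]
  by (fastforce simp: poly_ring_iff ring_mons_def gen_poly_def keys_word_mon)

lemma vanishing_ideal:
  "0 \<in> vanishing_on_lines" "f \<in> vanishing_on_lines \<Longrightarrow> g \<in> vanishing_on_lines \<Longrightarrow> f + g \<in> vanishing_on_lines"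
  "f \<in> vanishing_on_lines \<Longrightarrow> q * f \<in> vanishing_on_lines"
  "f \<in> vanishing_on_lines \<Longrightarrow> - f \<in> vanishing_on_lines"
  by (auto simp: vanishing_on_lines_def specialise_simps)

lemma card_4_cases:
  assumes "card \<sigma> = 4"
  obtains i j k l :: nat where "\<sigma> = {i, j, k, l}" "i < j" "j < k" "k < l"
proof -
  have fin: "finite \<sigma>" using assms card_ge_0_finite by force
  define L where "L = sorted_list_of_set \<sigma>"
  have "length L = 4" "set L = \<sigma>" "sorted_wrt (<) L" using assms fin by (auto simp: L_def)
  then obtain i j k l where "L = [i, j, k, l]" by (auto simp: length_Suc_conv numeral_eq_Suc)
  then show thesis using \<open>set L = \<sigma>\<close> \<open>sorted_wrt (<) L\<close> by (intro that[of i j k l]) auto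
qed

text \<open>
  Minors on the rows \<open>y, z, v x\<close> are combinations of \<open>Spatial\<close> and \<open>Planar\<close>, and all other
  minors and determinants in the definition of the ideal are generators up to sign.
\<close>

lemma ideal_generators:
  assumes "finite \<tau>" "f \<in> collinear_ideal \<tau>" "P 0" "\<And>a b. P a \<Longrightarrow> P b \<Longrightarrow> P (a + b)"
    "\<And>g q. over \<tau> g \<Longrightarrow> q \<in> poly_ring \<tau> \<Longrightarrow> P (q * gen_poly g)"
  shows "P f"
proof (rule collinear_ideal_induct[OF assms(1,2)])
  have neg: "P (q * - gen_poly g)" if "over \<tau> g" "q \<in> poly_ring \<tau>" for g q
    using assms(5)[OF that(1) poly_ring_uminus[OF that(2)]] by simp
  show "P (q * s)" if "s \<in> minors 3 (backprojection_mat \<tau>)" "q \<in> poly_ring \<tau>" for s q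
  proof -
    obtain i j k where ijk: "{i, j, k} \<subseteq> \<tau>" "i < j" "j < k"
      "s \<in> {minor3 0 1 2 i j k, minor3 0 1 3 i j k, minor3 0 2 3 i j k, minor3 1 2 3 i j k}"
      using minors_cases[OF assms(1) \<open>s \<in> _\<close>] .
    have "q * minor3 1 2 3 i j k = q * gen_poly (Spatial i j k) + (q * v k) * - gen_poly (Planar i j k)"
      unfolding minor3_eq by (simp add: algebra_simps)
    moreover have "P \<dots>"
      using ijk assms(1) that by (intro assms(4,5) neg poly_ring_mult poly_ring_v) auto
    moreover have "P (q * minor3 0 1 2 i j k)" "P (q * minor3 0 1 3 i j k)" "P (q * minor3 0 2 3 i j k)"
      unfolding minor3_eq using ijk that by (intro assms(5) neg; simp)+
    ultimately show ?thesis using ijk(4) by auto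
  qed
  show "P (q * det (Phi \<sigma>))" if \<sigma>: "\<sigma> \<subseteq> \<tau>" "card \<sigma> = 4" "q \<in> poly_ring \<tau>" for \<sigma> q
  proof -
    obtain i j k l where "\<sigma> = {i, j, k, l}" "i < j" "j < k" "k < l" using card_4_cases[OF \<sigma>(2)] .
    then show ?thesis using neg[of "ZZYY i j k l" q] \<sigma> det_Phi[of i j k l] by simp
  qed
qed (use assms in auto)

lemma collinear_ideal_vanishing:
  assumes "finite \<tau>" "f \<in> collinear_ideal \<tau>" shows "f \<in> vanishing_on_lines"
  using assms by (rule ideal_generators) (auto intro: vanishing_ideal gen_poly_vanishing)

lemma collinear_ideal_in_ring:
  assumes "finite \<tau>" "f \<in> collinear_ideal \<tau>" shows "f \<in> poly_ring \<tau>"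
  using assms by (rule ideal_generators) (use assms in \<open>auto intro: poly_ring_intros gen_poly_in_ring\<close>)

section \<open>The generators form the reduced Groebner basis\<close>

subsection \<open>Leading terms\<close>

lemma sum_count_list:
  assumes "finite S" shows "(\<Sum>x\<in>S. count_list w x) = length (filter (\<lambda>x. x \<in> S) w)"
proof (induction w)
  case (Cons a w)
  have "count_list (a # w) x = count_list w x + (if a = x then 1 else 0)" for x by simp
  then have "(\<Sum>x\<in>S. count_list (a # w) x) = (\<Sum>x\<in>S. count_list w x) + (\<Sum>x\<in>S. if a = x then 1 else 0)"
    by (simp only: sum.distrib)
  then show ?case using Cons assms by (simp add: sum.delta)
qed simp

lemma distinct_ell_vars: "distinct (ell_vars {1..m})"
  using sorted_ell_vars[of m] earlier_asym by (metis distinct_conv_nth linorder_neqE_nat sorted_wrt_iff_nth_less)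

lemma distinct_v_vars: "distinct (v_vars {1..m})"
  using sorted_v_vars[of m] earlier_asym by (metis distinct_conv_nth linorder_neqE_nat sorted_wrt_iff_nth_less)

context
  fixes m :: nat and w :: "var list"
  assumes w: "set w \<subseteq> ring_vars {1..m}"
begin

lemma ell_degree_word_mon: "ell_degree m (word_mon w) = length (ells w)"
proof -
  have "ell_degree m (word_mon w) = (\<Sum>x\<leftarrow>ell_vars {1..m}. count_list w x)"
    unfolding sum_ell_vars ell_degree_def exponent_word_mon ..
  also have "\<dots> = length (filter (\<lambda>x. x \<in> set (ell_vars {1..m})) w)"
    using distinct_ell_vars by (simp only: sum_list_distinct_conv_sum_set sum_count_list finite_set)
  also have "filter (\<lambda>x. x \<in> set (ell_vars {1..m})) w = ells w"
    unfolding ells_def using w by (intro filter_cong) (auto simp: set_ell_vars set_v_vars)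
  finally show ?thesis .
qed

lemma v_degree_word_mon: "v_degree m (word_mon w) = length (vs w)"
proof -
  have "v_degree m (word_mon w) = (\<Sum>x\<leftarrow>v_vars {1..m}. count_list w x)"
    unfolding sum_v_vars v_degree_def exponent_word_mon ..
  also have "\<dots> = length (filter (\<lambda>x. x \<in> set (v_vars {1..m})) w)"
    using distinct_v_vars by (simp only: sum_list_distinct_conv_sum_set sum_count_list finite_set)
  also have "filter (\<lambda>x. x \<in> set (v_vars {1..m})) w = vs w"
    unfolding vs_def using w by (intro filter_cong) (auto simp: set_ell_vars set_v_vars)
  finally show ?thesis .
qed

end

lemma count_filter: "P x \<Longrightarrow> count_list (filter P w) x = count_list w x"
  by (induction w) auto

lemma count_distinct: "distinct w \<Longrightarrow> count_list w x = (if x \<in> set w then 1 else 0)"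
  by (induction w) auto

lemma revlex_word:
  assumes less: "word_less (filter P w) (filter P t)"
    and X: "\<And>x. x \<in> X \<Longrightarrow> P x" "\<And>x. x \<in> set w \<union> set t \<Longrightarrow> P x \<Longrightarrow> x \<in> X"
  shows "revlex_less X (exponent (word_mon w)) (exponent (word_mon t))"
proof -
  obtain x where x: "x \<in> set (filter P w)" "x \<notin> set (filter P t)"
    and above: "\<And>y. y \<in> set (filter P w) \<union> set (filter P t) \<Longrightarrow> earlier x y \<Longrightarrow>
      (y \<in> set (filter P w) \<longleftrightarrow> y \<in> set (filter P t))"
    using less unfolding word_less_def by blast
  have d: "distinct (filter P w)" "distinct (filter P t)" using less by (auto simp: word_less_def)
  have ex: "exponent (word_mon w) y = (if y \<in> set (filter P w) then 1 else 0)"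
    "exponent (word_mon t) y = (if y \<in> set (filter P t) then 1 else 0)" if "P y" for y
    using count_distinct[OF d(1), of y] count_distinct[OF d(2), of y] count_filter[of P y] that
    by (simp_all add: exponent_word_mon)
  show ?thesis
    unfolding revlex_less_def
  proof (intro bexI[of _ x] conjI ballI impI)
    show xX: "x \<in> X" using x(1) by (intro X(2)) auto
    show "exponent (word_mon t) x < exponent (word_mon w) x" using ex[OF X(1)[OF xX]] x by simp
    fix y assume y: "y \<in> X" "earlier x y"
    show "exponent (word_mon w) y = exponent (word_mon t) y" using ex[OF X(1)[OF y(1)]] above[OF _ y(2)] by auto
  qed
qed

lemma word_less_mon_less:
  assumes "set w \<subseteq> ring_vars {1..m}"
    "set t \<subseteq> ring_vars {1..m}"
  shows "word_less (ells w) (ells t) \<Longrightarrow> grevlex_less (ell_vars {1..m}) (word_mon w) (word_mon t)"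
    and "word_less (vs w) (vs t) \<Longrightarrow> grevlex_less (v_vars {1..m}) (word_mon w) (word_mon t)"
proof -
  assume l: "word_less (ells w) (ells t)"
  then have "ell_degree m (word_mon w) = ell_degree m (word_mon t)"
    using ell_degree_word_mon[OF assms(1)] ell_degree_word_mon[OF assms(2)] by (simp add: word_less_def)
  moreover have "revlex_less (set (ell_vars {1..m})) (exponent (word_mon w)) (exponent (word_mon t))"
    by (rule revlex_word[OF l[unfolded ells_def]]) (use assms in \<open>auto simp: set_ell_vars set_v_vars\<close>)
  ultimately show "grevlex_less (ell_vars {1..m}) (word_mon w) (word_mon t)" unfolding grevlex_ell by blast
next
  assume l: "word_less (vs w) (vs t)"
  then have "v_degree m (word_mon w) = v_degree m (word_mon t)"
    using v_degree_word_mon[OF assms(1)] v_degree_word_mon[OF assms(2)] by (simp add: word_less_def)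
  moreover have "revlex_less (set (v_vars {1..m})) (exponent (word_mon w)) (exponent (word_mon t))"
    by (rule revlex_word[OF l[unfolded vs_def]]) (use assms in \<open>auto simp: set_ell_vars set_v_vars\<close>)
  ultimately show "grevlex_less (v_vars {1..m}) (word_mon w) (word_mon t)" unfolding grevlex_v by blast
qed

lemma ring_vars_mono: "\<tau> \<subseteq> {1..m} \<Longrightarrow> ring_vars \<tau> \<subseteq> ring_vars {1..m}"
  using finite_subset[of \<tau> "{1..m}"] by (auto simp: set_ell_vars set_v_vars)

lemma ring_mons_mono: "\<tau> \<subseteq> {1..m} \<Longrightarrow> ring_mons \<tau> \<subseteq> ring_mons {1..m}"
  using ring_vars_mono unfolding ring_mons_def by blast

lemma poly_ring_mono: "\<tau> \<subseteq> {1..m} \<Longrightarrow> poly_ring \<tau> \<subseteq> poly_ring {1..m}"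
  using ring_mons_mono[of \<tau> m] unfolding poly_ring_iff subset_iff by blast

lemma over_mono: "over \<tau> g \<Longrightarrow> \<tau> \<subseteq> \<tau>' \<Longrightarrow> over \<tau>' g"
  by (cases g) auto

lemma terms_words:
  assumes "over {1..m} g" "(c, w) \<in> set (terms g)"
  shows "set w \<subseteq> ring_vars {1..m}"
  using terms_vars[OF assms(1) _ assms(2)] by simp

lemma lead_word: "over {1..m} g \<Longrightarrow> set (lead g) \<subseteq> ring_vars {1..m}"
  by (rule terms_words[of m g 1], assumption, subst terms_lead) simp

lemma ell_exponents_eq:
  assumes "ells w = ells t" "is_ell x"
  shows "exponent (word_mon w) x = exponent (word_mon t) x"
  using count_filter[of is_ell x w] count_filter[of is_ell x t] assms by (simp add: exponent_word_mon ells_def)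

lemma tail_mon_less:
  assumes "over {1..m} g" "(c, w) \<in> set (tl (terms g))"
  shows "mon_less m (word_mon w) (word_mon (lead g))"
proof -
  have "(c, w) \<in> set (terms g)" using assms(2) by (subst terms_lead) simp
  note words = terms_words[OF assms(1) this] lead_word[OF assms(1)]
  from tail_word_less[OF assms] show ?thesis
  proof
    assume "word_less (ells w) (ells (lead g))"
    then show ?thesis using word_less_mon_less(1)[OF words] by (simp add: mon_less_def)
  next
    assume l: "ells w = ells (lead g) \<and> word_less (vs w) (vs (lead g))"
    then have "exponent (word_mon w) x = exponent (word_mon (lead g)) x" if "x \<in> set (ell_vars {1..m})" for x
      using that by (intro ell_exponents_eq) (auto simp: set_ell_vars)
    then show ?thesis using word_less_mon_less(2)[OF words] l by (simp add: mon_less_def)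
  qed
qed

lemma gen_poly_split: "gen_poly g = single (word_mon (lead g)) 1 + poly_of (tl (terms g))"
  unfolding gen_poly_def by (subst terms_lead) (rule poly_of_Cons)

lemma keys_gen_poly:
  assumes "t \<in> keys (gen_poly g)"
  shows "t = word_mon (lead g) \<or> (\<exists>c w. (c, w) \<in> set (tl (terms g)) \<and> t = word_mon w)"
proof -
  have "t \<in> word_mon ` snd ` set (terms g)" using keys_poly_of assms by (auto simp: gen_poly_def)
  then obtain c w where cw: "(c, w) \<in> set (terms g)" "t = word_mon w" by auto
  then have "(c, w) \<in> set ((1, lead g) # tl (terms g))" by (subst terms_lead[symmetric])
  then show ?thesis using cw(2) by auto
qed

lemma lookup_gen_poly_lead:
  assumes "over {1..m} g" shows "lookup (gen_poly g) (word_mon (lead g)) = 1"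
proof -
  have "word_mon (lead g) \<notin> keys (poly_of (tl (terms g)))"
    using keys_poly_of[of "tl (terms g)"] tail_mon_less[OF assms] mon_less_irrefl by fastforce
  then show ?thesis by (simp add: gen_poly_split lookup_add in_keys_iff)
qed

lemma lead_mon_gen_poly:
  assumes "over {1..m} g"
  shows "lead_mon (mon_less m) (gen_poly g) = word_mon (lead g)"
  unfolding lead_mon_def
proof (rule max_mon_eq)
  show "word_mon (lead g) \<in> keys (gen_poly g)"
    using lookup_gen_poly_lead[OF assms] by (simp add: in_keys_iff)
  show "mon_less m s (word_mon (lead g))" if "s \<in> keys (gen_poly g)" "s \<noteq> word_mon (lead g)" for s
    using keys_gen_poly[OF that(1)] that(2) tail_mon_less[OF assms] by auto
qed (rule mon_less_asym)

lemma lead_term_gen_poly: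
  assumes "over {1..m} g"
  shows "lead_term (mon_less m) (gen_poly g) = single (word_mon (lead g)) 1"
  unfolding lead_term_def leading_coeff_def lead_mon_gen_poly[OF assms] lookup_gen_poly_lead[OF assms] ..

lemma distinct_lead: "over \<tau> g \<Longrightarrow> distinct (lead g)"
  by (cases g) auto

lemma gen_poly_nonzero: "over {1..m} g \<Longrightarrow> gen_poly g \<noteq> 0"
  using lookup_gen_poly_lead by fastforce

subsection \<open>Divisibility of leading monomials\<close>

text \<open>
  Each of the seven divisibility conditions of \<open>standard_exponents\<close> fails only if the
  corresponding generator has a leading monomial that divides \<open>T\<close>; for squarefree monomials this
  is inclusion of the sets of variables.
\<close>

lemma not_standard_divisible:
  assumes "T \<in> ring_mons {1..m}"
    and "\<not> standard_exponents (\<lambda>i. exponent T (Ell 1 i)) (\<lambda>i. exponent T (Ell 2 i))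
     (\<lambda>i. exponent T (Ell 3 i)) (\<lambda>i. exponent T (V i)) (Suc m)"
  shows "\<exists>g. over {1..m} g \<and> set (lead g) \<subseteq> keys T"
proof (rule ccontr)
  assume "\<not> ?thesis"
  then have no: "\<not> set (lead g) \<subseteq> keys T" if "over {1..m} g" for g using that by blast
  have idx: "i \<in> {1..m}" if "exponent T (Ell c i) > 0" for c i
    using ring_mons_outside(1)[OF assms(1), of i c] that by (cases "i \<in> {1..m}") auto
  have "standard_exponents (\<lambda>i. exponent T (Ell 1 i)) (\<lambda>i. exponent T (Ell 2 i))
     (\<lambda>i. exponent T (Ell 3 i)) (\<lambda>i. exponent T (V i)) (Suc m)"
  proof (unfold_locales, goal_cases)
    case (1 i)
    then show ?case using ring_mons_outside(1)[OF assms(1), of i] by auto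
  next
    case (2 i j k)
    then show ?case using no[of "Affine 2 i j k"] idx[of 2 i] idx[of 1 j] idx[of 1 k] by (auto simp: in_keys_iff)
  next
    case (3 i j k)
    then show ?case using no[of "Affine 3 i j k"] idx[of 3 i] idx[of 1 j] idx[of 1 k] by (auto simp: in_keys_iff)
  next
    case (4 i j k)
    then show ?case using no[of "Planar i j k"] idx[of 3 i] idx[of 2 j] idx[of 1 k] by (auto simp: in_keys_iff)
  next
    case (5 i j k)
    then show ?case using no[of "Spatial i j k"] idx[of 3 i] idx[of 1 j] idx[of 2 k] by (auto simp: in_keys_iff)
  next
    case (6 i j k l)
    then show ?case using no[of "ZZYY i j k l"] idx[of 3 i] idx[of 3 j] idx[of 2 k] idx[of 2 l] by (auto simp: in_keys_iff)
  next
    case (7 i j k l)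
    then show ?case using no[of "XZYY i j k l"] idx[of 1 i] idx[of 3 j] idx[of 2 k] idx[of 2 l] by (auto simp: in_keys_iff)
  next
    case (8 i j k l)
    then show ?case using no[of "ZXYY i j k l"] idx[of 3 i] idx[of 1 j] idx[of 2 k] idx[of 2 l] by (auto simp: in_keys_iff)
  qed
  then show False using assms(2) by simp
qed

lemma over_restrict:
  assumes "over {1..m} g" "set (lead g) \<subseteq> ring_vars \<tau>" "finite \<tau>"
  shows "over \<tau> g"
  using assms by (cases g) (auto simp: set_ell_vars set_v_vars)

text \<open>
  A leading monomial in the variables of \<open>\<tau>\<close> can only be divisible by generators over \<open>\<tau>\<close>, so
  the result for all cameras restricts to subsets of cameras.
\<close>

lemma lead_divisible:
  assumes "\<tau> \<subseteq> {1..m}" "f \<in> collinear_ideal \<tau>" "f \<noteq> 0"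
  shows "\<exists>g. over \<tau> g \<and> mon_le (word_mon (lead g)) (lead_mon (mon_less m) f)"
proof -
  have fin: "finite \<tau>" using assms(1) finite_subset by blast
  have f: "f \<in> poly_ring \<tau>" "f \<in> vanishing_on_lines"
    using collinear_ideal_in_ring collinear_ideal_vanishing fin assms(2) by auto
  then have fm: "f \<in> poly_ring {1..m}" using ring_mons_mono[OF assms(1)] by (auto simp: poly_ring_iff)
  let ?T = "lead_mon (mon_less m) f"
  have T: "?T \<in> keys f" using lead_mon_props[OF fm assms(3)] by simp
  then have "?T \<in> ring_mons {1..m}" using fm by (auto simp: poly_ring_iff)
  then obtain g where g: "over {1..m} g" "set (lead g) \<subseteq> keys ?T"
    using not_standard_divisible lead_mon_not_standard[OF f(2) fm assms(3) refl] by blast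
  have "keys ?T \<subseteq> ring_vars \<tau>"
    using T f(1) by (auto simp: poly_ring_iff ring_mons_def)
  then have "over \<tau> g" using over_restrict[OF g(1) _ fin] g(2) by blast
  moreover have "mon_le (word_mon (lead g)) ?T" using word_mon_le_iff[OF distinct_lead[OF g(1)]] g(2) by simp
  ultimately show ?thesis by blast
qed

subsection \<open>Uniqueness and the explicit basis\<close>

text \<open>
  All monomials of an element of a monomial ideal are divisible by generators of that ideal.
\<close>

lemma groebner_divisor:
  assumes gb: "is_groebner_basis lt (poly_ring \<tau>) I G" and f: "f \<in> I" "f \<noteq> 0"
    and lc: "leading_coeff lt f \<noteq> 0"
  shows "\<exists>g\<in>G. g \<noteq> 0 \<and> mon_le (lead_mon lt g) (lead_mon lt f)"
proof -
  have "lead_term lt f \<in> ideal_in (poly_ring \<tau>) (lead_term lt ` (I - {0}))"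
    using f by (intro subsetD[OF poly_ring.ideal_in_incl] imageI) simp
  then have "lead_term lt f \<in> ideal_in (poly_ring \<tau>) (lead_term lt ` (G - {0}))"
    using gb by (simp add: is_groebner_basis_def)
  then have "\<forall>t\<in>keys (lead_term lt f). \<exists>g\<in>G. g \<noteq> 0 \<and> mon_le (lead_mon lt g) t"
  proof (rule poly_ring.ideal_in_induct)
    fix a b :: mpol
    assume "\<forall>t\<in>keys a. \<exists>g\<in>G. g \<noteq> 0 \<and> mon_le (lead_mon lt g) t"
      "\<forall>t\<in>keys b. \<exists>g\<in>G. g \<noteq> 0 \<and> mon_le (lead_mon lt g) t"
    then show "\<forall>t\<in>keys (a + b). \<exists>g\<in>G. g \<noteq> 0 \<and> mon_le (lead_mon lt g) t"
      using keys_add[of a b] by blast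
  next
    fix s q assume "s \<in> lead_term lt ` (G - {0})"
    then obtain g where g: "g \<in> G" "g \<noteq> 0" "s = lead_term lt g" by blast
    show "\<forall>t\<in>keys (q * s). \<exists>g\<in>G. g \<noteq> 0 \<and> mon_le (lead_mon lt g) t"
    proof
      fix t assume "t \<in> keys (q * s)"
      then obtain a where "t = a + lead_mon lt g"
        using keys_mult[of q s] g(3) by (auto simp: lead_term_def split: if_splits)
      then have "mon_le (lead_mon lt g) t" using mon_le_add[of "lead_mon lt g" a] by (simp add: add.commute)
      then show "\<exists>g\<in>G. g \<noteq> 0 \<and> mon_le (lead_mon lt g) t" using g by blast
    qed
  qed simp
  then show ?thesis using lc by (simp add: lead_term_def)
qed

text \<open>
  For \<open>g \<in> G\<close> there are \<open>h \<in> H\<close> and \<open>g2 \<in> G\<close> whose leading monomials divide that of \<open>g\<close> and of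
  \<open>h\<close>; as \<open>G\<close> is reduced, \<open>g2 = g\<close>, so \<open>g\<close> and \<open>h\<close> have the same leading monomial. Then \<open>g - h\<close>
  lies in the ideal, and its leading monomial would be a tail monomial of \<open>g\<close> or of \<open>h\<close>, which
  reducedness forbids.
\<close>

lemma reduced_basis_subset:
  assumes \<tau>: "\<tau> \<subseteq> {1..m}" and I: "I = collinear_ideal \<tau>"
    and G: "is_reduced_groebner_basis (mon_less m) (poly_ring \<tau>) I G"
    and H: "is_reduced_groebner_basis (mon_less m) (poly_ring \<tau>) I H"
  shows "G \<subseteq> H"
proof
  let ?lm = "lead_mon (mon_less m)"
  have fin: "finite \<tau>" using \<tau> finite_subset by blast
  have "I \<subseteq> poly_ring \<tau>" using collinear_ideal_in_ring[OF fin] by (auto simp: I)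
  then have IR: "I \<subseteq> poly_ring {1..m}" using poly_ring_mono[OF \<tau>] by auto
  have sub: "G \<subseteq> I" "H \<subseteq> I" using G H by (auto simp: is_reduced_groebner_basis_def is_groebner_basis_def)
  have lmk: "?lm f \<in> keys f" and lmmax: "\<And>s. s \<in> keys f \<Longrightarrow> s \<noteq> ?lm f \<Longrightarrow> mon_less m s (?lm f)"
    if "f \<in> I" "f \<noteq> 0" for f
    using lead_mon_props[of f m] that IR by auto
  have dvd: "\<exists>b\<in>B. b \<noteq> 0 \<and> mon_le (?lm b) (?lm f)"
    if "B = G \<or> B = H" "f \<in> I" "f \<noteq> 0" for B f
  proof (rule groebner_divisor)
    show "is_groebner_basis (mon_less m) (poly_ring \<tau>) I B"
      using that(1) G H by (auto simp: is_reduced_groebner_basis_def)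
    show "leading_coeff (mon_less m) f \<noteq> 0" using lmk[OF that(2,3)] by (simp add: leading_coeff_def in_keys_iff)
  qed (use that in auto)
  have lead: "lead_term (mon_less m) b = single (?lm b) 1" if "b \<in> B" "B = G \<or> B = H" for b B
    using that G H by (auto simp: is_reduced_groebner_basis_def lead_term_def)
  have reduced: "t = ?lm c" if B: "B = G \<or> B = H" "b \<in> B" "c \<in> B" "t \<in> keys c" "mon_le (?lm b) t" for B b c t
  proof (cases "b = c")
    case True
    have "c \<in> I" "c \<noteq> 0" using B sub G H by (auto simp: is_reduced_groebner_basis_def)
    then show ?thesis using lmmax[of c t] B(4,5) True mon_le_not_less by blast
  next
    case False
    then have "\<not> lead_term (mon_less m) b dvd single t (lookup c t)"
      using B G H by (auto simp: is_reduced_groebner_basis_def)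
    then show ?thesis using mon_le_imp_single_dvd[OF B(5)] lead[OF B(2,1)] by simp
  qed
  have same: "b = c" if B: "B = G \<or> B = H" "b \<in> B" "c \<in> B" "mon_le (?lm b) (?lm c)" for B b c
  proof (rule ccontr)
    assume "b \<noteq> c"
    have "c \<in> I" "c \<noteq> 0" using B sub G H by (auto simp: is_reduced_groebner_basis_def)
    then have "\<not> lead_term (mon_less m) b dvd single (?lm c) (lookup c (?lm c))"
      using B G H lmk[of c] \<open>b \<noteq> c\<close> by (auto simp: is_reduced_groebner_basis_def)
    then show False using mon_le_imp_single_dvd[OF B(4)] lead[OF B(2,1)] by simp
  qed
  fix g assume g: "g \<in> G"
  have g': "g \<in> I" "g \<noteq> 0" using g sub G by (auto simp: is_reduced_groebner_basis_def)
  obtain h where h: "h \<in> H" "h \<noteq> 0" "mon_le (?lm h) (?lm g)" using dvd[OF _ g', of H] by blast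
  have hI: "h \<in> I" using h sub by blast
  obtain g2 where g2: "g2 \<in> G" "mon_le (?lm g2) (?lm h)" using dvd[OF _ hI h(2), of G] by blast
  have "mon_le (?lm g2) (?lm g)" using g2(2) h(3) by (auto simp: mon_le_def intro: order_trans)
  then have "g2 = g" using same[of G g2 g] g2 g by blast
  then have lm: "?lm h = ?lm g"
    using g2(2) h(3) by (intro poly_mapping_eqI) (auto simp: mon_le_def intro: order_antisym)
  have lc: "lookup g (?lm g) = 1" "lookup h (?lm h) = 1"
    using g h G H by (auto simp: is_reduced_groebner_basis_def leading_coeff_def)
  have "g - h = 0"
  proof (rule ccontr)
    assume nz: "g - h \<noteq> 0"
    have dI: "g - h \<in> I" unfolding I using g'(1) hI fin by (intro collinear_ideal_minus) (auto simp: I)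
    let ?t = "?lm (g - h)"
    have t: "?t \<in> keys (g - h)" using lmk[OF dI nz] .
    have tne: "?t \<noteq> ?lm g" using t lc lm by (auto simp: in_keys_iff lookup_minus)
    have "?t \<in> keys g \<or> ?t \<in> keys h" using t by (auto simp: in_keys_iff lookup_minus)
    then show False
    proof
      assume "?t \<in> keys g"
      moreover obtain b where "b \<in> G" "mon_le (?lm b) ?t" using dvd[OF _ dI nz, of G] by blast
      ultimately show False using reduced[of G b g ?t] g tne by blast
    next
      assume "?t \<in> keys h"
      moreover obtain b where "b \<in> H" "mon_le (?lm b) ?t" using dvd[OF _ dI nz, of H] by blast
      ultimately show False using reduced[of H b h ?t] h(1) tne lm by metis
    qed
  qed
  then show "g \<in> H" using h by simp
qed

definition explicit_basis :: "nat set \<Rightarrow> mpol set" where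
  "explicit_basis \<tau> = gen_poly ` {g. over \<tau> g}"

lemma finite_generators:
  assumes "finite \<tau>" shows "finite {g. over \<tau> g}"
proof (rule finite_subset)
  let ?T3 = "\<tau> \<times> \<tau> \<times> \<tau>" and ?T4 = "\<tau> \<times> \<tau> \<times> \<tau> \<times> \<tau>"
  let ?U = "(\<lambda>(i, j, k). Affine 2 i j k) ` ?T3 \<union> (\<lambda>(i, j, k). Affine 3 i j k) ` ?T3 \<union>
    (\<lambda>(i, j, k). Planar i j k) ` ?T3 \<union> (\<lambda>(i, j, k). Spatial i j k) ` ?T3 \<union>
    (\<lambda>(i, j, k, l). ZZYY i j k l) ` ?T4 \<union> (\<lambda>(i, j, k, l). XZYY i j k l) ` ?T4 \<union>
    (\<lambda>(i, j, k, l). ZXYY i j k l) ` ?T4"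
  have "g \<in> ?U" if "over \<tau> g" for g using that by (cases g) (auto simp: image_iff)
  then show "{g. over \<tau> g} \<subseteq> ?U" by blast
  show "finite ?U" using assms by simp
qed

text \<open>
  Over every set of cameras the leading terms of the generators generate the initial ideal by
  \<open>lead_divisible\<close>, and \<open>lead_incomparable\<close> gives reducedness.
\<close>

lemma explicit_basis_reduced:
  assumes \<tau>: "\<tau> \<subseteq> {1..m}"
  shows "is_reduced_groebner_basis (mon_less m) (poly_ring \<tau>) (collinear_ideal \<tau>) (explicit_basis \<tau>)"
proof -
  let ?I = "collinear_ideal \<tau>" and ?G = "explicit_basis \<tau>" and ?lt = "lead_term (mon_less m)"
  have fin: "finite \<tau>" using \<tau> finite_subset by blast
  have om: "over {1..m} g" if "over \<tau> g" for g using over_mono[OF that \<tau>] .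
  have GI: "?G \<subseteq> ?I" using gen_poly_in_ideal[OF fin] by (auto simp: explicit_basis_def)
  have "?lt f \<in> ideal_in (poly_ring \<tau>) (?lt ` (?G - {0}))" if f: "f \<in> ?I" "f \<noteq> 0" for f
  proof -
    let ?t = "lead_mon (mon_less m) f"
    obtain g where g: "over \<tau> g" "mon_le (word_mon (lead g)) ?t" using lead_divisible[OF \<tau> f] by blast
    have "f \<in> poly_ring \<tau>" using collinear_ideal_in_ring[OF fin f(1)] .
    moreover then have "?t \<in> keys f"
      using lead_mon_props(1)[of f m] f(2) ring_mons_mono[OF \<tau>] by (auto simp: poly_ring_iff)
    ultimately have "?t \<in> ring_mons \<tau>" by (auto simp: poly_ring_iff)
    moreover have "keys (?t - word_mon (lead g)) \<subseteq> keys ?t"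
      by (auto simp: in_keys_iff lookup_minus)
    ultimately have "single (?t - word_mon (lead g)) (leading_coeff (mon_less m) f) \<in> poly_ring \<tau>"
      by (intro poly_ring_single) (auto simp: ring_mons_def)
    moreover have "?lt (gen_poly g) \<in> ?lt ` (?G - {0})"
      using g(1) gen_poly_nonzero[OF om] by (auto simp: explicit_basis_def)
    ultimately have "single (?t - word_mon (lead g)) (leading_coeff (mon_less m) f) * ?lt (gen_poly g)
        \<in> ideal_in (poly_ring \<tau>) (?lt ` (?G - {0}))"
      by (intro poly_ring.ideal_in_memI)
    moreover have "single (?t - word_mon (lead g)) (leading_coeff (mon_less m) f) * ?lt (gen_poly g) = ?lt f"
      using mon_le_split[OF g(2)] unfolding lead_term_gen_poly[OF om[OF g(1)]] mult_single
      by (simp add: lead_term_def add.commute)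
    ultimately show ?thesis by simp
  qed
  then have "ideal_in (poly_ring \<tau>) (?lt ` (?I - {0})) \<subseteq> ideal_in (poly_ring \<tau>) (?lt ` (?G - {0}))"
    by (intro poly_ring.ideal_in_subset) auto
  moreover have "ideal_in (poly_ring \<tau>) (?lt ` (?G - {0})) \<subseteq> ideal_in (poly_ring \<tau>) (?lt ` (?I - {0}))"
  proof (intro poly_ring.ideal_in_subset)
    have "?lt ` (?G - {0}) \<subseteq> ?lt ` (?I - {0})" using GI by blast
    then show "?lt ` (?G - {0}) \<subseteq> ideal_in (poly_ring \<tau>) (?lt ` (?I - {0}))"
      by (rule subset_trans[OF _ poly_ring.ideal_in_incl])
  qed
  ultimately have "is_groebner_basis (mon_less m) (poly_ring \<tau>) ?I ?G"
    using GI finite_generators[OF fin] by (auto simp: is_groebner_basis_def explicit_basis_def)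
  moreover have "0 \<notin> ?G" using gen_poly_nonzero[OF om] by (auto simp: explicit_basis_def)
  moreover have "leading_coeff (mon_less m) p = 1" if "p \<in> ?G" for p
    using that lookup_gen_poly_lead[OF om] lead_mon_gen_poly[OF om]
    by (auto simp: explicit_basis_def leading_coeff_def)
  moreover have "\<not> ?lt p dvd single t (lookup q t)"
    if pq: "p \<in> ?G" "q \<in> ?G" "p \<noteq> q" and t: "t \<in> keys q" for p q t
  proof
    obtain g h where gh: "over \<tau> g" "over \<tau> h" "p = gen_poly g" "q = gen_poly h" "g \<noteq> h"
      using pq by (auto simp: explicit_basis_def)
    assume "?lt p dvd single t (lookup q t)"
    then have "mon_le (word_mon (lead g)) t"
      using single_dvd_imp_mon_le t unfolding gh(3) lead_term_gen_poly[OF om[OF gh(1)]]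
      by (metis lookup_not_eq_zero_eq_in_keys)
    then have "set (lead g) \<subseteq> keys t" using word_mon_le_iff[OF distinct_lead[OF gh(1)]] by simp
    moreover obtain c w where "(c, w) \<in> set (terms h)" "t = word_mon w"
      using t keys_poly_of[of "terms h"] unfolding gh(4) gen_poly_def by auto
    ultimately have "g = h" using lead_incomparable[OF gh(1,2)] by (simp add: keys_word_mon)
    then show False using gh(5) by simp
  qed
  ultimately show ?thesis by (simp add: is_reduced_groebner_basis_def)
qed

lemma reduced_gb_eq:
  assumes "\<tau> \<subseteq> {1..m}"
  shows "reduced_gb m \<tau> = explicit_basis \<tau>"
  unfolding reduced_gb_def
proof (rule the_equality)
  show *: "is_reduced_groebner_basis (mon_less m) (poly_ring \<tau>) (collinear_ideal \<tau>) (explicit_basis \<tau>)"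
    by (rule explicit_basis_reduced[OF assms])
  fix G assume G: "is_reduced_groebner_basis (mon_less m) (poly_ring \<tau>) (collinear_ideal \<tau>) G"
  show "G = explicit_basis \<tau>"
    using reduced_basis_subset[OF assms refl G *] reduced_basis_subset[OF assms refl * G] by (rule equalityI)
qed

subsection \<open>Subsets of four cameras, divisibility by line coordinates\<close>

lemma over_four_cameras:
  assumes "m \<ge> 4" "over {1..m} g"
  shows "\<exists>\<sigma>. \<sigma> \<subseteq> {1..m} \<and> card \<sigma> = 4 \<and> over \<sigma> g"
proof -
  have "\<exists>S. S \<subseteq> {1..m} \<and> card S \<le> 4 \<and> over S g"
  proof (cases g)
    case (Affine c i j k)
    then show ?thesis using assms(2) card_length[of "[i, j, k]"] by (intro exI[of _ "{i, j, k}"]) auto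
  next
    case (Planar i j k)
    then show ?thesis using assms(2) card_length[of "[i, j, k]"] by (intro exI[of _ "{i, j, k}"]) auto
  next
    case (Spatial i j k)
    then show ?thesis using assms(2) card_length[of "[i, j, k]"] by (intro exI[of _ "{i, j, k}"]) auto
  next
    case (ZZYY i j k l)
    then show ?thesis using assms(2) card_length[of "[i, j, k, l]"] by (intro exI[of _ "{i, j, k, l}"]) auto
  next
    case (XZYY i j k l)
    then show ?thesis using assms(2) card_length[of "[i, j, k, l]"] by (intro exI[of _ "{i, j, k, l}"]) auto
  next
    case (ZXYY i j k l)
    then show ?thesis using assms(2) card_length[of "[i, j, k, l]"] by (intro exI[of _ "{i, j, k, l}"]) auto
  qed
  then obtain S where S: "S \<subseteq> {1..m}" "card S \<le> 4" "over S g" by blast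
  then obtain \<sigma> where "S \<subseteq> \<sigma>" "\<sigma> \<subseteq> {1..m}" "card \<sigma> = 4"
    using exists_subset_between[of S 4 "{1..m}"] assms(1) by auto
  then show ?thesis using over_mono[OF S(3)] by blast
qed

lemma explicit_basis_union:
  assumes "m \<ge> 4"
  shows "explicit_basis {1..m} = (\<Union>\<sigma>\<in>{\<sigma>. \<sigma> \<subseteq> {1..m} \<and> card \<sigma> = 4}. explicit_basis \<sigma>)"
proof (rule equalityI; rule subsetI)
  fix p assume "p \<in> explicit_basis {1..m}"
  then obtain g where g: "over {1..m} g" "p = gen_poly g" unfolding explicit_basis_def by blast
  then obtain \<sigma> where "\<sigma> \<subseteq> {1..m}" "card \<sigma> = 4" "over \<sigma> g" using over_four_cameras[OF assms] by blast
  then show "p \<in> (\<Union>\<sigma>\<in>{\<sigma>. \<sigma> \<subseteq> {1..m} \<and> card \<sigma> = 4}. explicit_basis \<sigma>)"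
    unfolding explicit_basis_def g(2) by blast
next
  fix p assume "p \<in> (\<Union>\<sigma>\<in>{\<sigma>. \<sigma> \<subseteq> {1..m} \<and> card \<sigma> = 4}. explicit_basis \<sigma>)"
  then obtain \<sigma> g where g: "\<sigma> \<subseteq> {1..m}" "over \<sigma> g" "p = gen_poly g" unfolding explicit_basis_def by blast
  then show "p \<in> explicit_basis {1..m}" using over_mono[OF g(2,1)] unfolding explicit_basis_def by simp
qed

lemma specialise_mon_word_mon: "specialise_mon \<theta> (word_mon w) = (\<Prod>x\<leftarrow>w. \<theta> x)"
proof (induction w)
  case Nil
  then show ?case by (simp add: word_mon_def specialise_mon_zero)
next
  case (Cons x w)
  then show ?case by (simp only: word_mon_Cons specialise_mon_add specialise_mon_var list.map prod_list.Cons)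
qed

lemma specialise_poly_of: "specialise \<theta> (poly_of ts) = (\<Sum>(c, w)\<leftarrow>ts. smult c (specialise_mon \<theta> (word_mon w)))"
  by (induction ts) (auto simp: poly_of_Nil poly_of_Cons specialise_zero specialise_add specialise_single)

lemma gen_poly_not_divisible:
  assumes "over \<tau> g"
  shows "\<not> ell a b dvd gen_poly g"
proof
  assume "ell a b dvd gen_poly g"
  then obtain q where q: "gen_poly g = ell a b * q" by (auto simp: dvd_def)
  obtain S where S: "Ell a b \<notin> S" "(\<Sum>(c, w)\<leftarrow>terms g. if set w \<subseteq> S then c else 0) \<noteq> 0"
    using avoid_variable[OF assms] by blast
  define \<theta> where "\<theta> x = (if x \<in> S then 1 else 0 :: complex poly)" for x
  have "specialise_mon \<theta> (word_mon w) = (if set w \<subseteq> S then 1 else 0)" for w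
    unfolding specialise_mon_word_mon by (induction w) (auto simp: \<theta>_def)
  then have "specialise \<theta> (gen_poly g) = (\<Sum>(c, w)\<leftarrow>terms g. [:if set w \<subseteq> S then c else 0:])"
    unfolding gen_poly_def specialise_poly_of by (intro arg_cong[of _ _ sum_list] map_cong) auto
  also have "\<dots> = [:\<Sum>(c, w)\<leftarrow>terms g. if set w \<subseteq> S then c else 0:]"
  proof -
    have "(\<Sum>(c, w)\<leftarrow>ts. [:if set w \<subseteq> S then c else 0:]) = [:\<Sum>(c, w)\<leftarrow>ts. if set w \<subseteq> S then c else 0:]"
      for ts :: "(complex \<times> var list) list"
      by (induction ts) auto
    then show ?thesis .
  qed
  finally have "specialise \<theta> (gen_poly g) \<noteq> 0" using S(2) by simp
  moreover have "specialise \<theta> (gen_poly g) = 0" using S(1) by (simp add: q specialise_mult specialise_Var \<theta>_def)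
  ultimately show False by simp
qed

lemma squarefree_lead: "over \<tau> g \<Longrightarrow> squarefree_mon (word_mon (lead g))"
  using count_distinct[OF distinct_lead] by (simp add: squarefree_mon_def exponent_word_mon)

subsection \<open>Leading coefficients in the translation parameters\<close>

text \<open>
  The coefficient of the line monomial \<open>M\<close>; for \<open>M\<close> the leading one it is \<open>ell_lead_coeff\<close>, but
  unlike that it is additive in the polynomial.
\<close>

definition coefficient_of :: "mon \<Rightarrow> mpol \<Rightarrow> mpol" where
  "coefficient_of M p = (\<Sum>t\<in>{t \<in> keys p. ell_part t = M}.
        single (v_part t) (lookup p t))"

lemma coefficient_of_superset:
  assumes "finite S" "keys p \<subseteq> S"
  shows "coefficient_of M p = (\<Sum>t\<in>{t \<in> S. ell_part t = M}. single (v_part t) (lookup p t))"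
  unfolding coefficient_of_def using assms by (intro sum.mono_neutral_left) (auto simp: in_keys_iff)

lemma coefficient_of_add: "coefficient_of M (p + q) = coefficient_of M p + coefficient_of M q"
proof -
  let ?S = "keys p \<union> keys q"
  have S: "finite ?S" "keys (p + q) \<subseteq> ?S" "keys p \<subseteq> ?S" "keys q \<subseteq> ?S"
    using keys_add[of p q] by auto
  show ?thesis
    unfolding coefficient_of_superset[OF S(1,2)] coefficient_of_superset[OF S(1,3)] coefficient_of_superset[OF S(1,4)]
    by (simp add: lookup_add single_add sum.distrib)
qed

lemma coefficient_of_single:
  "coefficient_of M (single t c) = (if ell_part t = M then single (v_part t) c else 0)"
proof (cases "c = 0")
  case False
  then have "{s \<in> keys (single t c). ell_part s = M} = (if ell_part t = M then {t} else {})"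
    by auto
  then show ?thesis by (simp add: coefficient_of_def)
qed (simp add: coefficient_of_def)

lemma coefficient_of_poly_of:
  "coefficient_of M (poly_of ts) = (\<Sum>(c, w)\<leftarrow>ts. if ell_part (word_mon w) = M then single (v_part (word_mon w)) c else 0)"
  by (induction ts) (auto simp: poly_of_Nil poly_of_Cons coefficient_of_add coefficient_of_single,
      simp add: coefficient_of_def)

lemma exponent_ell_part: "exponent (ell_part t) x = (if is_ell x then exponent t x else 0)"
  by (cases x) (auto simp: ell_part_def lookup_mapp when_def in_keys_iff)

lemma exponent_v_part: "exponent (v_part t) x = (if is_ell x then 0 else exponent t x)"
  by (cases x) (auto simp: v_part_def lookup_mapp when_def in_keys_iff)

lemma count_filter_if: "count_list (filter P w) x = (if P x then count_list w x else 0)"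
  by (induction w) auto

lemma ell_part_word_mon: "ell_part (word_mon w) = word_mon (ells w)"
  by (rule poly_mapping_eqI) (simp add: exponent_ell_part exponent_word_mon ells_def count_filter_if)

lemma v_part_word_mon: "v_part (word_mon w) = word_mon (vs w)"
  by (rule poly_mapping_eqI) (simp add: exponent_v_part exponent_word_mon vs_def count_filter_if)

text \<open>
  The leading monomial maximises the line part first, so a term either shares its line part or
  has a smaller one.
\<close>

lemma ells_lead_or_less:
  assumes "over {1..m} g" "(c, w) \<in> set (terms g)"
  shows "ells w = ells (lead g) \<or> grevlex_less (ell_vars {1..m}) (word_mon (ells w)) (word_mon (ells (lead g)))"
proof (cases "w = lead g")
  case False
  have "(c, w) \<in> set ((1, lead g) # tl (terms g))" using assms(2) by (subst terms_lead[symmetric])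
  then have "(c, w) \<in> set (tl (terms g))" using False by auto
  moreover have "grevlex_less (ell_vars {1..m}) (word_mon w) (word_mon (lead g)) \<longleftrightarrow>
      grevlex_less (ell_vars {1..m}) (word_mon (ells w)) (word_mon (ells (lead g)))"
    unfolding ell_part_word_mon[symmetric]
    by (rule grevlex_cong) (auto simp: exponent_ell_part set_ell_vars)
  ultimately show ?thesis
    using tail_word_less[OF assms(1)] word_less_mon_less(1)[OF terms_words[OF assms] lead_word[OF assms(1)]] by blast
qed simp

lemma grevlex_asym: "grevlex_less xs s t \<Longrightarrow> \<not> grevlex_less xs t s"
  using grevlex_trans grevlex_irrefl by blast

lemma ell_lead_mon_gen_poly:
  assumes "over {1..m} g"
  shows "ell_lead_mon m (gen_poly g) = word_mon (ells (lead g))"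
  unfolding ell_lead_mon_def
proof (rule max_mon_eq)
  have "word_mon (lead g) \<in> keys (gen_poly g)"
    using lookup_gen_poly_lead[OF assms] by (simp add: in_keys_iff)
  then show "word_mon (ells (lead g)) \<in> ell_part ` keys (gen_poly g)"
    by (auto simp flip: ell_part_word_mon)
  show "grevlex_less (ell_vars {1..m}) s (word_mon (ells (lead g)))"
    if s: "s \<in> ell_part ` keys (gen_poly g)" "s \<noteq> word_mon (ells (lead g))" for s
  proof -
    obtain c w where w: "(c, w) \<in> set (terms g)" "s = ell_part (word_mon w)"
      using s(1) keys_poly_of[of "terms g"] unfolding gen_poly_def by fastforce
    then show ?thesis using ells_lead_or_less[OF assms w(1)] s(2) by (auto simp: ell_part_word_mon)
  qed
qed (rule grevlex_asym)

lemma ell_lead_coeff_gen_poly: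
  assumes "over {1..m} g"
  shows "ell_lead_coeff m (gen_poly g) = (\<Sum>(c, w)\<leftarrow>terms g. if ells w = ells (lead g) then single (word_mon (vs w)) c else 0)"
proof -
  have "word_mon (ells w) = word_mon (ells (lead g)) \<longleftrightarrow> ells w = ells (lead g)" if "(c, w) \<in> set (terms g)" for c w
    using ells_lead_or_less[OF assms that] grevlex_irrefl by auto
  then have "map (\<lambda>(c, w). if ell_part (word_mon w) = word_mon (ells (lead g)) then single (v_part (word_mon w)) c else 0) (terms g)
      = map (\<lambda>(c, w). if ells w = ells (lead g) then single (word_mon (vs w)) c else 0) (terms g)"
    by (intro map_cong) (auto simp: ell_part_word_mon v_part_word_mon)
  then show ?thesis
    unfolding ell_lead_coeff_def ell_lead_mon_gen_poly[OF assms] coefficient_of_def[symmetric]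
    by (simp only: gen_poly_def coefficient_of_poly_of)
qed

lemma ell_lead_coeff_cases:
  assumes "over {1..m} g"
  shows "ell_lead_coeff m (gen_poly g) = 1
         \<or> (\<exists>a\<in>{1..m}. \<exists>b\<in>{1..m}. ell_lead_coeff m (gen_poly g) = v a - v b)
         \<or> (\<exists>a\<in>{1..m}. \<exists>b\<in>{1..m}. \<exists>c\<in>{1..m}. \<exists>d\<in>{1..m}.
              ell_lead_coeff m (gen_poly g) = (v a - v b) * (v c - v d))"
proof -
  have minus: "v a - v b = single (word_mon [V a]) 1 + single (word_mon [V b]) (- 1)" for a b
    unfolding word_uminus word_Cons word_Nil by simp
  have times: "(v a - v b) * (v c - v d) = single (word_mon [V a, V c]) 1 + single (word_mon [V a, V d]) (- 1)
    + single (word_mon [V b, V c]) (- 1) + single (word_mon [V b, V d]) 1" for a b c d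
    unfolding word_uminus word_Cons word_Nil by (simp add: algebra_simps)
  show ?thesis
  proof (cases g)
    case (Affine e i j k)
    then have *: "i < j" "j < k" "i < k" and e: "e \<noteq> Suc 0" using assms by auto
    note n = e * *[THEN distinct_indices(1)] *[THEN distinct_indices(2)]
    have "ell_lead_coeff m (gen_poly g) = v j - v k"
      using ell_lead_coeff_gen_poly[OF assms] unfolding minus Affine by (simp add: n term_simps ells_def vs_def)
    moreover have "j \<in> {1..m}" "k \<in> {1..m}" using assms Affine by auto
    ultimately show ?thesis by blast
  next
    case (Planar i j k)
    then have *: "i < j" "j < k" "i < k" using assms by auto
    note n = * *[THEN distinct_indices(1)] *[THEN distinct_indices(2)]
    have "ell_lead_coeff m (gen_poly g) = single (word_mon []) 1"
      using ell_lead_coeff_gen_poly[OF assms] unfolding Planar by (simp add: n term_simps ells_def vs_def)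
    then show ?thesis unfolding word_Nil by simp
  next
    case (Spatial i j k)
    then have *: "i < j" "j < k" "i < k" using assms by auto
    note n = * *[THEN distinct_indices(1)] *[THEN distinct_indices(2)]
    have "ell_lead_coeff m (gen_poly g) = v j - v k"
      using ell_lead_coeff_gen_poly[OF assms] unfolding minus Spatial by (simp add: n term_simps ells_def vs_def)
    moreover have "j \<in> {1..m}" "k \<in> {1..m}" using assms Spatial by auto
    ultimately show ?thesis by blast
  next
    case (ZZYY i j k l)
    then have *: "i < j" "j < k" "i < k" "k < l" "i < l" "j < l" using assms by auto
    note n = * *[THEN distinct_indices(1)] *[THEN distinct_indices(2)]
    have "ell_lead_coeff m (gen_poly g) = (v i - v j) * (v k - v l)"
      using ell_lead_coeff_gen_poly[OF assms] unfolding times ZZYY by (simp add: n term_simps ells_def vs_def)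
    moreover have "i \<in> {1..m}" "j \<in> {1..m}" "k \<in> {1..m}" "l \<in> {1..m}" using assms ZZYY by auto
    ultimately show ?thesis by blast
  next
    case (XZYY i j k l)
    then have *: "i < j" "j < k" "i < k" "k < l" "i < l" "j < l" using assms by auto
    note n = * *[THEN distinct_indices(1)] *[THEN distinct_indices(2)]
    have "ell_lead_coeff m (gen_poly g) = (v i - v j) * (v k - v l)"
      using ell_lead_coeff_gen_poly[OF assms] unfolding times XZYY by (simp add: n term_simps ells_def vs_def)
    moreover have "i \<in> {1..m}" "j \<in> {1..m}" "k \<in> {1..m}" "l \<in> {1..m}" using assms XZYY by auto
    ultimately show ?thesis by blast
  next
    case (ZXYY i j k l)
    then have *: "i < j" "j < k" "i < k" "k < l" "i < l" "j < l" using assms by auto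
    note n = * *[THEN distinct_indices(1)] *[THEN distinct_indices(2)]
    have "ell_lead_coeff m (gen_poly g) = v k - v l"
      using ell_lead_coeff_gen_poly[OF assms] unfolding minus ZXYY by (simp add: n term_simps ells_def vs_def)
    moreover have "k \<in> {1..m}" "l \<in> {1..m}" using assms ZXYY by auto
    ultimately show ?thesis by blast
  qed
qed

theorem proposition6p1:
  fixes m :: nat
  assumes "m \<ge> 4"
  shows "reduced_gb m {1..m} = (\<Union>\<sigma>\<in>{\<sigma>. \<sigma> \<subseteq> {1..m} \<and> card \<sigma> = 4}. reduced_gb m \<sigma>)
    \<and> (\<forall>g\<in>reduced_gb m {1..m}. \<forall>i\<in>{1..3}. \<forall>j\<in>{1..m}. \<not> ell i j dvd g)
    \<and> (\<forall>g\<in>reduced_gb m {1..m}. squarefree_mon (lead_mon (mon_less m) g))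
    \<and> (\<forall>g\<in>reduced_gb m {1..m}.
         ell_lead_coeff m g = 1
         \<or> (\<exists>a\<in>{1..m}. \<exists>b\<in>{1..m}. ell_lead_coeff m g = v a - v b)
         \<or> (\<exists>a\<in>{1..m}. \<exists>b\<in>{1..m}. \<exists>c\<in>{1..m}. \<exists>d\<in>{1..m}.
              ell_lead_coeff m g = (v a - v b) * (v c - v d)))"
proof -
  have basis: "reduced_gb m {1..m} = explicit_basis {1..m}" by (rule reduced_gb_eq) simp
  have "(\<Union>\<sigma>\<in>{\<sigma>. \<sigma> \<subseteq> {1..m} \<and> card \<sigma> = 4}. reduced_gb m \<sigma>) =
      (\<Union>\<sigma>\<in>{\<sigma>. \<sigma> \<subseteq> {1..m} \<and> card \<sigma> = 4}. explicit_basis \<sigma>)"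
    by (intro SUP_cong refl reduced_gb_eq) simp
  then have "reduced_gb m {1..m} = (\<Union>\<sigma>\<in>{\<sigma>. \<sigma> \<subseteq> {1..m} \<and> card \<sigma> = 4}. reduced_gb m \<sigma>)"
    using explicit_basis_union[OF assms] basis by simp
  moreover have "(\<forall>i\<in>{1..3}. \<forall>j\<in>{1..m}. \<not> ell i j dvd g) \<and> squarefree_mon (lead_mon (mon_less m) g)
      \<and> (ell_lead_coeff m g = 1
         \<or> (\<exists>a\<in>{1..m}. \<exists>b\<in>{1..m}. ell_lead_coeff m g = v a - v b)
         \<or> (\<exists>a\<in>{1..m}. \<exists>b\<in>{1..m}. \<exists>c\<in>{1..m}. \<exists>d\<in>{1..m}.
              ell_lead_coeff m g = (v a - v b) * (v c - v d)))"
    if "g \<in> reduced_gb m {1..m}" for g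
  proof -
    from that obtain h where h: "over {1..m} h" and g: "g = gen_poly h"
      unfolding basis explicit_basis_def by blast
    have "\<forall>i\<in>{1..3}. \<forall>j\<in>{1..m}. \<not> ell i j dvd g"
      unfolding g using gen_poly_not_divisible[OF h] by simp
    moreover have "squarefree_mon (lead_mon (mon_less m) g)"
      unfolding g lead_mon_gen_poly[OF h] by (rule squarefree_lead[OF h])
    ultimately show ?thesis using ell_lead_coeff_cases[OF h] unfolding g by (intro conjI)
  qed
  ultimately show ?thesis by (intro conjI ballI) simp_all
qed

end
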